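(* Let $n\le 5$ and $m\ge 1$, and let $f:\mathbb{R}^n\to\mathbb{R}^m$ be an entire smooth solution of the minimal surface system with graph $\Sigma=\{(x,f(x)):x\in\mathbb{R}^n\}\subset\mathbb{R}^{n+m}$. Suppose that the normal bundle of $\Sigma$ is flat and that there is a constant $c$ such that $\mathrm{Vol}(\Sigma\cap B_R)\le cR^n$ for all $R>0$, where $B_R$ is the ball of radius $R$ in $\mathbb{R}^{n+m}$ centered at the origin and $\mathrm{Vol}$ is the $n$-dimensional volume. Then $f$ is a linear map (i.e. affine: $\Sigma$ is an $n$-plane).
   Context: Minimal surface system: $f=(f^1,\dots,f^m)$ is a solution if $\sum_{i,j=1}^n\frac{\partial}{\partial x^i}\left(\sqrt{g}\,g^{ij}\frac{\partial f^\alpha}{\partial x^j}\right)=0$ for each $\alpha=1,\dots,m$, where $g_{ij}=\delta_{ij}+\sum_{\beta=1}^m\frac{\partial f^\beta}{\partial x^i}\frac{\partial f^\beta}{\partial x^j}$, $(g^{ij})=(g_{ij})^{-1}$ and $g=\det(g_{ij})$. The graph of a solution is a minimal submanifold of $\mathbb{R}^{n+m}$ of dimension $n$ and codimension $m$. Flat normal bundle: near a point of $\Sigma$ choose an orthonormal frame $e_1,\dots,e_n$ of the tangent bundle and $e_{n+1},\dots,e_{n+m}$ of the normal bundle. The coefficients of the second fundamental form are $h_{\alpha ij}=\langle\nabla_{e_i}e_\alpha,e_j\rangle$, where $\nabla$ is the flat connection of $\mathbb{R}^{n+m}$. By the Ricci equation the curvature of the normal bundle is $R_{\alpha\beta ij}=\sum_{k}(h_{\alpha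 ik}h_{\beta jk}-h_{\alpha jk}h_{\beta ik})$. $\Sigma$ has flat normal bundle if $R_{\alpha\beta ij}\equiv 0$ for all $\alpha,\beta,i,j$. *)

theory Defs
  imports "HOL-Analysis.Analysis"
begin

definition partial :: "'n \<Rightarrow> (real^'n \<Rightarrow> 'b) \<Rightarrow> real^'n \<Rightarrow> 'b::real_normed_vector"
  where "partial i u x = frechet_derivative u (at x) (axis i 1)"

(* C^k on an open set S; only meaningful for open S, since partial is the
   derivative in the whole space. *)
primrec Ck_on :: "nat \<Rightarrow> (real^'n) set \<Rightarrow> (real^'n \<Rightarrow> 'b::real_normed_vector) \<Rightarrow> bool"
  where
    "Ck_on 0 S u \<longleftrightarrow> continuous_on S u"
  | "Ck_on (Suc k) S u \<longleftrightarrow>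
       (\<forall>x\<in>S. u differentiable (at x)) \<and> (\<forall>i. Ck_on k S (partial i u))"

definition smooth_on :: "(real^'n) set \<Rightarrow> (real^'n \<Rightarrow> 'b::real_normed_vector) \<Rightarrow> bool"
  where "smooth_on S u \<longleftrightarrow> (\<forall>k. Ck_on k S u)"

definition metric :: "(real^'n \<Rightarrow> real^'m) \<Rightarrow> real^'n \<Rightarrow> real^'n^'n"
  where "metric f x = (\<chi> i j. (if i = j then 1 else 0) +
           (\<Sum>\<beta>\<in>UNIV. partial i (\<lambda>y. f y $ \<beta>) x * partial j (\<lambda>y. f y $ \<beta>) x))"

definition minimal_surface_system :: "(real^'n \<Rightarrow> real^'m) \<Rightarrow> bool"
  where "minimal_surface_system f \<longleftrightarrow>
    (\<forall>\<alpha> x. (\<Sum>i\<in>UNIV. \<Sum>j\<in>UNIV.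
       partial i (\<lambda>y. sqrt (det (metric f y)) * matrix_inv (metric f y) $ i $ j
                        * partial j (\<lambda>z. f z $ \<alpha>) y) x) = 0)"

(* Riemannian n-dimensional volume of {(x, f x) | x} \<inter> A, where the ambient
   space is the product (real^'n) \<times> (real^'m) with its Euclidean norm, computed in the global
   chart x \<mapsto> (x, f x), whose volume density is sqrt (det (metric f x)). *)
definition graph_volume :: "(real^'n \<Rightarrow> real^'m) \<Rightarrow> ((real^'n) \<times> (real^'m)) set \<Rightarrow> ennreal"
  where "graph_volume f A =
    (\<integral>\<^sup>+x. ennreal (sqrt (det (metric f x))) * indicator ((\<lambda>x. (x, f x)) -` A) x \<partial>lborel)"

definition tangent_space :: "(real^'n \<Rightarrow> real^'m) \<Rightarrow> real^'n \<Rightarrow> ((real^'n) \<times> (real^'m)) set"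
  where "tangent_space f x = range (\<lambda>v. (v, frechet_derivative f (at x) v))"

(* A smooth orthonormal frame e of the tangent bundle and nu of the normal
   bundle over the part of the graph lying above the open set U. Vector fields
   along the graph are written as functions of the base point x, standing for
   the point (x, f x). *)
definition adapted_frame ::
  "(real^'n \<Rightarrow> real^'m) \<Rightarrow> (real^'n) set \<Rightarrow>
   ('n \<Rightarrow> real^'n \<Rightarrow> (real^'n) \<times> (real^'m)) \<Rightarrow>
   ('m \<Rightarrow> real^'n \<Rightarrow> (real^'n) \<times> (real^'m)) \<Rightarrow> bool"
  where "adapted_frame f U e \<nu> \<longleftrightarrow>
    (\<forall>i. smooth_on U (e i)) \<and> (\<forall>\<alpha>. smooth_on U (\<nu> \<alpha>)) \<and>
    (\<forall>x\<in>U.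
       (\<forall>i. e i x \<in> tangent_space f x) \<and>
       (\<forall>\<alpha>. \<forall>w\<in>tangent_space f x. \<nu> \<alpha> x \<bullet> w = 0) \<and>
       (\<forall>i j. e i x \<bullet> e j x = (if i = j then 1 else 0)) \<and>
       (\<forall>\<alpha> \<beta>. \<nu> \<alpha> x \<bullet> \<nu> \<beta> x = (if \<alpha> = \<beta> then 1 else 0)))"

(* h_{\<alpha>ij} = \<langle>\<nabla>_{e_i} \<nu>_\<alpha>, e_j\<rangle>. In the chart x \<mapsto> (x, f x) the tangent vector
   e_i is represented by its first component fst (e_i), so the ambient flat
   derivative of \<nu>_\<alpha> along e_i is the derivative of \<nu>_\<alpha> in the direction
   fst (e_i). *)
definition second_ff ::
  "('n \<Rightarrow> real^'n \<Rightarrow> (real^'n) \<times> (real^'m)) \<Rightarrow> ('m \<Rightarrow> real^'n \<Rightarrow> (real^'n) \<times> (real^'m)) \<Rightarrow>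
   real^'n \<Rightarrow> 'm \<Rightarrow> 'n \<Rightarrow> 'n \<Rightarrow> real"
  where "second_ff e \<nu> x \<alpha> i j = frechet_derivative (\<nu> \<alpha>) (at x) (fst (e i x)) \<bullet> e j x"

definition normal_curvature ::
  "('n \<Rightarrow> real^'n \<Rightarrow> (real^'n) \<times> (real^'m)) \<Rightarrow> ('m \<Rightarrow> real^'n \<Rightarrow> (real^'n) \<times> (real^'m)) \<Rightarrow>
   real^'n \<Rightarrow> 'm \<Rightarrow> 'm \<Rightarrow> 'n \<Rightarrow> 'n \<Rightarrow> real"
  where "normal_curvature e \<nu> x \<alpha> \<beta> i j =
    (\<Sum>k\<in>UNIV. second_ff e \<nu> x \<alpha> i k * second_ff e \<nu> x \<beta> j k
              - second_ff e \<nu> x \<alpha> j k * second_ff e \<nu> x \<beta> i k)"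

(* The vanishing of the normal curvature does not depend on the chosen adapted
   frame, so it is required for one such frame near each point. *)
definition flat_normal_bundle :: "(real^'n \<Rightarrow> real^'m) \<Rightarrow> bool"
  where "flat_normal_bundle f \<longleftrightarrow>
    (\<forall>p. \<exists>U e \<nu>. open U \<and> p \<in> U \<and> adapted_frame f U e \<nu> \<and>
       (\<forall>x\<in>U. \<forall>\<alpha> \<beta> i j. normal_curvature e \<nu> x \<alpha> \<beta> i j = 0))"

end

theory Submission
  imports Defs
begin

text \<open>
  Write \<open>X\<close> for the coordinate functions of the graph, \<open>\<delta>\<^sub>a\<close> for the derivative along the tangential
  projection of the a-th ambient unit vector and \<open>P\<close> for the matrix of this projection. Tensor
  calculus on the graph becomes calculus with the functions \<open>P a b\<close> and the operators \<open>\<delta>\<^sub>a\<close>; pointwise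
  identities are verified after an ambient rotation that makes \<open>P\<close> diagonal at the given point.

  Let S be the squared norm of the second fundamental form and l the logarithm of the volume
  density. Flatness of the normal bundle makes the shape operators commute, which gives
  \<open>\<Delta>l = S + \<bar>\<nabla>l\<bar>\<^sup>2\<close> (the substitute for stability) and Simons' inequality
  \<open>\<Delta>S \<ge> 2\<bar>\<nabla>A\<bar>\<^sup>2 - 2S\<^sup>2\<close>. Together with an improved Kato inequality they show, as in the work of
  Schoen, Simon and Yau, that for a suitable cutoff function the divergence of one explicit
  compactly supported vector field bounds \<open>S\<^bsup>13/5\<^esup>\<close> from above up to an error of order \<open>R\<^bsup>-26/5\<^esup>\<close>.
  The integral of a divergence vanishes and the volume grows at most like \<open>R\<^sup>n\<close> with n at most 5, so
  S vanishes; then \<open>P\<close> is constant and the graph is a plane.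
\<close>

section \<open>Smooth functions and partial derivatives\<close>

text \<open>Ambient components replace covariant derivatives: \<open>P\<close> is a globally defined
  matrix of smooth functions, and since ambient rotations are constant, tensors transform by plain
  matrix products and can be normalised at one point at a time. The price is that the operators
  \<delta>_a do not commute. At an adapted point the tangential commutators vanish, and their first
  derivatives are the Gauss curvature. The identity for l says that the reciprocal w of the volume
  density is a positive solution of \<Delta>w + S w = 0, the equation behind stability of
  hypersurface graphs; commuting shape operators make it survive in higher codimension. Both
  curvature inequalities go into a single vector field, so that only a pointwise inequality and one
  use of the divergence theorem remain. The dimension enters twice: the Kato constant 1 + 2/n
  restricts the exponent q by q^2 < 2/n, and beating the volume growth needs 4 + 2q > n. Both can be
  met for n = 5 but not for n = 6. The constants are chosen for n = 5 and also serve smaller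
  n.\<close>

abbreviation sum_all :: "('a \<Rightarrow> 'b::comm_monoid_add) \<Rightarrow> 'b"  (binder "\<Sigma>" 10)
  where "sum_all u \<equiv> sum u UNIV"

lemma partial_eqI: "(u has_derivative D) (at x) \<Longrightarrow> partial i u x = D (axis i 1)"
  unfolding partial_def using frechet_derivative_at by metis

lemma has_derivative_partial_sum:
  fixes u :: "real^'n \<Rightarrow> 'b::real_normed_vector"
  assumes "u differentiable (at x)"
  shows "(u has_derivative (\<lambda>v. \<Sigma> i. v $ i *\<^sub>R partial i u x)) (at x)"
proof -
  have D: "(u has_derivative frechet_derivative u (at x)) (at x)"
    using assms frechet_derivative_works by blast
  then have lin: "linear (frechet_derivative u (at x))"
    by (rule has_derivative_linear)
  have "frechet_derivative u (at x) v = (\<Sigma> i. v $ i *\<^sub>R partial i u x)" for v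
  proof -
    have "v = (\<Sigma> i. v $ i *\<^sub>R axis i 1)"
      using basis_expansion[of v] by (simp add: scalar_mult_eq_scaleR)
    then have "frechet_derivative u (at x) v
      = frechet_derivative u (at x) (\<Sigma> i. v $ i *\<^sub>R axis i 1)" by simp
    also have "\<dots> = (\<Sigma> i. v $ i *\<^sub>R frechet_derivative u (at x) (axis i 1))"
      using lin by (simp add: linear_sum linear_cmul)
    finally show ?thesis by (simp add: partial_def)
  qed
  then show ?thesis using D by presburger
qed

lemma partial_const: "partial i (\<lambda>_. c) x = 0"
  by (rule partial_eqI[OF has_derivative_const])

lemma partial_add:
  assumes "u differentiable (at x)" "v differentiable (at x)"
  shows "partial i (\<lambda>y. u y + v y) x = partial i u x + partial i v x"
  using partial_eqI[OF has_derivative_add[OF assms[unfolded frechet_derivative_works]]]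
  by (simp add: partial_def)

lemma partial_mult:
  fixes u v :: "real^'n \<Rightarrow> real"
  assumes "u differentiable (at x)" "v differentiable (at x)"
  shows "partial i (\<lambda>y. u y * v y) x = partial i u x * v x + u x * partial i v x"
  using partial_eqI[OF has_derivative_mult[OF assms[unfolded frechet_derivative_works]]]
  by (simp add: partial_def)

lemma partial_sum:
  assumes "\<And>a. a \<in> A \<Longrightarrow> u a differentiable (at x)"
  shows "partial i (\<lambda>y. \<Sum>a\<in>A. u a y) x = (\<Sum>a\<in>A. partial i (u a) x)"
proof -
  have "((\<lambda>y. \<Sum>a\<in>A. u a y) has_derivative (\<lambda>h. \<Sum>a\<in>A. frechet_derivative (u a) (at x) h)) (at x)"
    by (rule has_derivative_sum) (use assms frechet_derivative_works in blast)
  then show ?thesis by (simp add: partial_eqI partial_def[symmetric])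
qed

lemma partial_bounded_linear:
  assumes "bounded_linear T" "u differentiable (at x)"
  shows "partial i (\<lambda>y. T (u y)) x = T (partial i u x)"
  using partial_eqI[OF bounded_linear.has_derivative[OF assms(1) assms(2)[unfolded frechet_derivative_works]]]
  by (simp add: partial_def)

lemma partial_compose_real:
  fixes u :: "real^'n \<Rightarrow> real"
  assumes "(G has_field_derivative G') (at (u x))" "u differentiable (at x)"
  shows "partial i (\<lambda>y. G (u y)) x = G' * partial i u x"
proof -
  have "(u has_derivative frechet_derivative u (at x)) (at x)"
    using assms(2) frechet_derivative_works by blast
  moreover have "(G has_derivative (*) G') (at (u x))"
    using assms(1) by (simp add: has_field_derivative_def)
  ultimately have "((\<lambda>y. G (u y)) has_derivative (\<lambda>h. G' * frechet_derivative u (at x) h)) (at x)"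
    by (rule has_derivative_compose)
  then show ?thesis by (subst partial_eqI) (auto simp: partial_def)
qed

lemma partial_coord: "partial i (\<lambda>y. y $ k) x = (if i = k then 1 else 0)"
  by (subst partial_eqI[OF bounded_linear_imp_has_derivative[OF bounded_linear_vec_nth]])
    (simp add: axis_def)

section \<open>Closure properties of C^k and smooth functions\<close>

lemma Ck_on_Suc_differentiable: "Ck_on (Suc k) UNIV u \<Longrightarrow> u differentiable (at x)"
  by simp

lemma Ck_on_Suc_imp: "Ck_on (Suc k) UNIV u \<Longrightarrow> Ck_on k UNIV u"
proof (induction k arbitrary: u)
  case 0
  then show ?case
    by (auto intro!: continuous_at_imp_continuous_on differentiable_imp_continuous_within)
next
  case (Suc k)
  from Suc.prems have "Ck_on (Suc k) UNIV (partial i u)" for i by (simp del: Ck_on.simps(1))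
  then have "Ck_on k UNIV (partial i u)" for i by (rule Suc.IH)
  then show ?case using Suc.prems by simp
qed

lemma Ck_on_const: "Ck_on k UNIV (\<lambda>_::real^'n. c)"
proof (induction k arbitrary: c)
  case (Suc k)
  have "partial i (\<lambda>_::real^'n. c) = (\<lambda>_. 0)" for i by (rule ext) (rule partial_const)
  then show ?case using Suc[of 0] by simp
qed simp

lemma Ck_on_add: "Ck_on k UNIV u \<Longrightarrow> Ck_on k UNIV v \<Longrightarrow> Ck_on k UNIV (\<lambda>x. u x + v x)"
proof (induction k arbitrary: u v)
  case (Suc k)
  have "partial i (\<lambda>x. u x + v x) = (\<lambda>x. partial i u x + partial i v x)" for i
    using Suc.prems by (auto intro!: partial_add)
  then show ?case using Suc by simp
qed (simp add: continuous_on_add)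

lemma Ck_on_mult:
  fixes u v :: "real^'n \<Rightarrow> real"
  shows "Ck_on k UNIV u \<Longrightarrow> Ck_on k UNIV v \<Longrightarrow> Ck_on k UNIV (\<lambda>x. u x * v x)"
proof (induction k arbitrary: u v)
  case (Suc k)
  have "partial i (\<lambda>x. u x * v x) = (\<lambda>x. partial i u x * v x + u x * partial i v x)" for i
    using Suc.prems by (auto intro!: partial_mult)
  then show ?case using Suc Ck_on_Suc_imp[of k u] Ck_on_Suc_imp[of k v]
    by (auto intro!: Ck_on_add)
qed (simp add: continuous_on_mult)

lemma Ck_on_sum: "(\<And>a. a \<in> A \<Longrightarrow> Ck_on k UNIV (u a)) \<Longrightarrow> Ck_on k UNIV (\<lambda>x. \<Sum>a\<in>A. u a x)"
  by (induction A rule: infinite_finite_induct) (auto intro: Ck_on_const Ck_on_add)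

text \<open>The exponent is generalised in the induction because differentiation lowers it.
  Reciprocals and square roots of positive functions are later written as real powers, so their
  smoothness comes from here too.\<close>

lemma Ck_on_powr:
  fixes u :: "real^'n \<Rightarrow> real"
  assumes "\<And>x. u x > 0"
  shows "Ck_on k UNIV u \<Longrightarrow> Ck_on k UNIV (\<lambda>x. u x powr r)"
proof (induction k arbitrary: r)
  case 0
  have "u x \<noteq> 0" for x using assms[of x] by simp
  then show ?case using 0 by (simp add: continuous_on_powr)
next
  case (Suc k)
  have du: "u differentiable (at x)" for x using Suc.prems by simp
  have "((\<lambda>y. y powr r) has_field_derivative r * u x powr (r - 1)) (at (u x))" for x
    using assms[of x] by (rule has_real_derivative_powr)
  note D = partial_compose_real[OF this du]
  have "partial i (\<lambda>x. u x powr r) = (\<lambda>x. r * u x powr (r - 1) * partial i u x)" for i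
    using D by auto
  moreover have "(\<lambda>x. u x powr r) differentiable (at x)" for x
  proof -
    have "(\<lambda>y. y powr r) differentiable (at (u x))"
      using has_real_derivative_powr[OF assms[of x]] real_differentiable_def by blast
    then show ?thesis using differentiable_compose[OF _ du] by blast
  qed
  ultimately show ?case using Suc Ck_on_Suc_imp[OF Suc.prems]
    by (auto intro!: Ck_on_mult Ck_on_const)
qed

abbreviation smooth :: "(real^'n \<Rightarrow> real) \<Rightarrow> bool" where "smooth \<equiv> smooth_on UNIV"

lemma smooth_differentiable: "smooth u \<Longrightarrow> u differentiable (at x)"
  unfolding smooth_on_def using Ck_on_Suc_differentiable by blast

lemma smooth_continuous: "smooth u \<Longrightarrow> continuous_on UNIV u"
  unfolding smooth_on_def by (metis Ck_on.simps(1))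

lemma smooth_partial: "smooth u \<Longrightarrow> smooth (partial i u)"
  unfolding smooth_on_def by (metis Ck_on.simps(2))

lemma smooth_const: "smooth (\<lambda>_. c)"
  by (simp add: smooth_on_def Ck_on_const)

lemma smooth_add: "smooth u \<Longrightarrow> smooth v \<Longrightarrow> smooth (\<lambda>x. u x + v x)"
  by (simp add: smooth_on_def Ck_on_add)

lemma smooth_mult: "smooth u \<Longrightarrow> smooth v \<Longrightarrow> smooth (\<lambda>x. u x * v x)"
  by (simp add: smooth_on_def Ck_on_mult)

lemma smooth_minus: "smooth u \<Longrightarrow> smooth (\<lambda>x. - u x)"
  using smooth_mult[OF smooth_const[of "-1"]] by simp

lemma smooth_diff: "smooth u \<Longrightarrow> smooth v \<Longrightarrow> smooth (\<lambda>x. u x - v x)"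
  using smooth_add[OF _ smooth_minus] by simp

lemma smooth_sum: "(\<And>a. a \<in> A \<Longrightarrow> smooth (u a)) \<Longrightarrow> smooth (\<lambda>x. \<Sum>a\<in>A. u a x)"
  unfolding smooth_on_def by (auto intro: Ck_on_sum)

lemma smooth_prod: "(\<And>a. a \<in> A \<Longrightarrow> smooth (u a)) \<Longrightarrow> smooth (\<lambda>x. \<Prod>a\<in>A. u a x)"
  by (induction A rule: infinite_finite_induct) (auto intro: smooth_const smooth_mult)

lemma smooth_power: "smooth u \<Longrightarrow> smooth (\<lambda>x. u x ^ k)"
  by (induction k) (auto intro: smooth_const smooth_mult)

lemma smooth_powr: "(\<And>x. u x > 0) \<Longrightarrow> smooth u \<Longrightarrow> smooth (\<lambda>x. u x powr r)"
  by (simp add: smooth_on_def Ck_on_powr)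

lemma smooth_coord: "smooth (\<lambda>x::real^'n. x $ k)"
  unfolding smooth_on_def
proof
  fix j show "Ck_on j UNIV (\<lambda>x::real^'n. x $ k)"
  proof (cases j)
    case (Suc l)
    have "partial i (\<lambda>x::real^'n. x $ k) = (\<lambda>_. if i = k then 1 else 0)" for i
      by (rule ext) (rule partial_coord)
    then show ?thesis using Suc
      by (simp add: Ck_on_const bounded_linear_imp_differentiable[OF bounded_linear_vec_nth])
  qed (simp add: continuous_on_component)
qed

lemma smooth_ln:
  assumes "\<And>x. u x > 0" "smooth u"
  shows "smooth (\<lambda>x. ln (u x))"
proof -
  have D: "partial i (\<lambda>x. ln (u x)) = (\<lambda>x. u x powr (-1) * partial i u x)" for i
    using partial_compose_real[OF DERIV_ln[OF assms(1)] smooth_differentiable[OF assms(2)]] assms(1)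
    by (auto simp: powr_minus fun_eq_iff abs_of_pos)
  have diff: "(\<lambda>x. ln (u x)) differentiable (at x)" for x
    using differentiable_compose[OF _ smooth_differentiable[OF assms(2)]] DERIV_ln[OF assms(1)]
      real_differentiable_def by blast
  have "smooth (partial i (\<lambda>x. ln (u x)))" for i
    unfolding D using assms by (intro smooth_mult smooth_powr smooth_partial)
  then have "Ck_on (Suc k) UNIV (\<lambda>x. ln (u x))" for k
    using diff by (simp add: smooth_on_def)
  then show ?thesis unfolding smooth_on_def using Ck_on_Suc_imp by blast
qed

lemma smooth_component:
  fixes f :: "real^'n \<Rightarrow> real^'m"
  assumes "smooth_on UNIV f" shows "smooth (\<lambda>x. f x $ k)"
proof -
  have "Ck_on j UNIV f \<Longrightarrow> Ck_on j UNIV (\<lambda>x. f x $ k)" for j and f :: "real^'n \<Rightarrow> real^'m"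
  proof (induction j arbitrary: f)
    case (Suc j)
    have "partial i (\<lambda>x. f x $ k) = (\<lambda>x. partial i f x $ k)" for i
      using Suc.prems by (auto intro!: partial_bounded_linear[OF bounded_linear_vec_nth])
    moreover have "(\<lambda>x. f x $ k) differentiable (at x)" for x
      using differentiable_compose[OF bounded_linear_imp_differentiable[OF bounded_linear_vec_nth]]
        Suc.prems by (metis Ck_on_Suc_differentiable)
    ultimately show ?case using Suc by simp
  qed (simp add: continuous_on_component)
  then show ?thesis using assms by (simp add: smooth_on_def)
qed

lemmas smooth_intros = smooth_const smooth_add smooth_mult smooth_minus smooth_diff
  smooth_sum smooth_prod smooth_power smooth_powr smooth_coord smooth_ln smooth_partial

section \<open>Symmetry of second derivatives\<close>

lemma has_real_derivative_along_axis:
  fixes u :: "real^'n \<Rightarrow> real"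
  assumes "u differentiable (at (x + s *\<^sub>R axis i 1))"
  shows "((\<lambda>s. u (x + s *\<^sub>R axis i 1)) has_real_derivative partial i u (x + s *\<^sub>R axis i 1)) (at s)"
proof -
  let ?y = "x + s *\<^sub>R axis i 1"
  have D: "(u has_derivative frechet_derivative u (at ?y)) (at ?y)"
    using assms frechet_derivative_works by blast
  have "((\<lambda>s. x + s *\<^sub>R axis i 1) has_derivative (\<lambda>h. h *\<^sub>R axis i 1)) (at s)"
    by (auto intro!: derivative_eq_intros)
  from has_derivative_compose[OF this D]
  have "((\<lambda>s. u (x + s *\<^sub>R axis i 1)) has_derivative (\<lambda>h. frechet_derivative u (at ?y) (h *\<^sub>R axis i 1))) (at s)" .
  moreover have "frechet_derivative u (at ?y) (h *\<^sub>R axis i 1) = partial i u ?y * h" for h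
    using linear_cmul[OF has_derivative_linear[OF D]] by (simp add: partial_def mult.commute)
  ultimately show ?thesis by (simp add: has_field_derivative_def)
qed

text \<open>Both mixed partials are limits of the second difference quotient over a square.\<close>

lemma second_difference_MVT:
  fixes u :: "real^'n \<Rightarrow> real"
  assumes u: "smooth u" and h: "h > 0"
  obtains s t where "0 < s" "s < h" "0 < t" "t < h"
    "u (x + h *\<^sub>R axis i 1 + h *\<^sub>R axis j 1) - u (x + h *\<^sub>R axis i 1) - u (x + h *\<^sub>R axis j 1) + u x
      = h * h * partial j (partial i u) (x + s *\<^sub>R axis i 1 + t *\<^sub>R axis j 1)"
proof -
  define \<phi> where "\<phi> s = u (x + h *\<^sub>R axis j 1 + s *\<^sub>R axis i 1) - u (x + s *\<^sub>R axis i 1)" for s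
  have "(\<phi> has_real_derivative partial i u (x + h *\<^sub>R axis j 1 + s *\<^sub>R axis i 1)
      - partial i u (x + s *\<^sub>R axis i 1)) (at s)" for s
    unfolding \<phi>_def using u
    by (intro DERIV_diff has_real_derivative_along_axis smooth_differentiable)
  from MVT2[OF h this] obtain s where s: "0 < s" "s < h"
    and e1: "\<phi> h - \<phi> 0 = h * (partial i u (x + h *\<^sub>R axis j 1 + s *\<^sub>R axis i 1)
      - partial i u (x + s *\<^sub>R axis i 1))" by auto
  have "((\<lambda>t. partial i u (x + s *\<^sub>R axis i 1 + t *\<^sub>R axis j 1)) has_real_derivative
      partial j (partial i u) (x + s *\<^sub>R axis i 1 + t *\<^sub>R axis j 1)) (at t)" for t
    using u by (intro has_real_derivative_along_axis smooth_differentiable smooth_partial)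
  from MVT2[OF h this] obtain t where t: "0 < t" "t < h"
    and e2: "partial i u (x + s *\<^sub>R axis i 1 + h *\<^sub>R axis j 1) - partial i u (x + s *\<^sub>R axis i 1)
      = h * partial j (partial i u) (x + s *\<^sub>R axis i 1 + t *\<^sub>R axis j 1)" by auto
  have "\<phi> h - \<phi> 0 = h * h * partial j (partial i u) (x + s *\<^sub>R axis i 1 + t *\<^sub>R axis j 1)"
    using e1 e2 by (simp add: add_ac)
  then show ?thesis using that[OF s t] by (simp add: \<phi>_def add_ac)
qed

lemma partial_commute:
  fixes u :: "real^'n \<Rightarrow> real"
  assumes u: "smooth u"
  shows "partial i (partial j u) x = partial j (partial i u) x"
proof -
  \<comment> \<open>One inequality up to an arbitrary e suffices, because it is proved for all pairs
    of indices and can be applied with i and j exchanged.\<close>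
  have key: "partial i (partial j u) x \<le> partial j (partial i u) x + e" if e: "e > 0" for e i j
  proof -
    have cont: "isCont (partial i (partial j u)) x" for i j
      using smooth_continuous[OF smooth_partial[OF smooth_partial[OF u]]]
      by (simp add: continuous_on_eq_continuous_at)
    obtain d1 where d1: "d1 > 0" "\<And>y. dist y x < d1 \<Longrightarrow> \<bar>partial i (partial j u) y - partial i (partial j u) x\<bar> < e/2"
      using cont[of i j] e unfolding continuous_at_eps_delta dist_real_def by (meson half_gt_zero)
    obtain d2 where d2: "d2 > 0" "\<And>y. dist y x < d2 \<Longrightarrow> \<bar>partial j (partial i u) y - partial j (partial i u) x\<bar> < e/2"
      using cont[of j i] e unfolding continuous_at_eps_delta dist_real_def by (meson half_gt_zero)
    define h where "h = min d1 d2 / 2"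
    have h: "h > 0" "2 * h \<le> d1" "2 * h \<le> d2" using d1(1) d2(1) by (auto simp: h_def)
    have near: "dist (x + s *\<^sub>R axis k 1 + t *\<^sub>R axis l 1) x < 2 * h"
      if "0 < s" "s < h" "0 < t" "t < h" for s t and k l :: 'n
    proof -
      have "norm (s *\<^sub>R axis k 1 + t *\<^sub>R axis l 1 :: real^'n) \<le> \<bar>s\<bar> + \<bar>t\<bar>"
        by (rule norm_triangle_le) simp
      then show ?thesis using that by (simp add: dist_norm)
    qed
    obtain s t where st: "0 < s" "s < h" "0 < t" "t < h"
      "u (x + h *\<^sub>R axis i 1 + h *\<^sub>R axis j 1) - u (x + h *\<^sub>R axis i 1) - u (x + h *\<^sub>R axis j 1) + u x
      = h * h * partial j (partial i u) (x + s *\<^sub>R axis i 1 + t *\<^sub>R axis j 1)"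
      using second_difference_MVT[OF u h(1)] by metis
    obtain s' t' where st': "0 < s'" "s' < h" "0 < t'" "t' < h"
      "u (x + h *\<^sub>R axis j 1 + h *\<^sub>R axis i 1) - u (x + h *\<^sub>R axis j 1) - u (x + h *\<^sub>R axis i 1) + u x
      = h * h * partial i (partial j u) (x + s' *\<^sub>R axis j 1 + t' *\<^sub>R axis i 1)"
      using second_difference_MVT[OF u h(1)] by metis
    have "h * h * partial j (partial i u) (x + s *\<^sub>R axis i 1 + t *\<^sub>R axis j 1)
      = h * h * partial i (partial j u) (x + s' *\<^sub>R axis j 1 + t' *\<^sub>R axis i 1)"
      unfolding st(5)[symmetric] st'(5)[symmetric] by (simp add: add_ac)
    then have "partial j (partial i u) (x + s *\<^sub>R axis i 1 + t *\<^sub>R axis j 1)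
      = partial i (partial j u) (x + s' *\<^sub>R axis j 1 + t' *\<^sub>R axis i 1)" using h(1) by simp
    moreover have "\<bar>partial j (partial i u) (x + s *\<^sub>R axis i 1 + t *\<^sub>R axis j 1) - partial j (partial i u) x\<bar> < e/2"
      using near[OF st(1-4)] h(3) by (intro d2(2)) (rule less_le_trans)
    moreover have "\<bar>partial i (partial j u) (x + s' *\<^sub>R axis j 1 + t' *\<^sub>R axis i 1) - partial i (partial j u) x\<bar> < e/2"
      using near[OF st'(1-4)] h(2) by (intro d1(2)) (rule less_le_trans)
    ultimately show ?thesis by linarith
  qed
  show ?thesis
    by (intro antisym; rule field_le_epsilon) (erule key)+
qed

section \<open>Determinants and the divergence theorem\<close>

lemma smooth_det:
  assumes "\<And>i j. smooth (\<lambda>x. A x $ i $ j)"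
  shows "smooth (\<lambda>x. det (A x))"
  unfolding det_def by (intro smooth_intros assms)

lemma matrix_inv_mult:
  fixes A :: "real^'k^'k"
  assumes "det A \<noteq> 0"
  shows "A ** matrix_inv A = mat 1" "matrix_inv A ** A = mat 1"
proof -
  have "\<exists>B. A ** B = mat 1 \<and> B ** A = mat 1"
    using assms by (simp add: invertible_det_nz[symmetric] invertible_def)
  from someI_ex[OF this] show "A ** matrix_inv A = mat 1" "matrix_inv A ** A = mat 1"
    by (auto simp: matrix_inv_def)
qed

text \<open>Cramer's rule. It exhibits the inverse as a quotient of polynomials in the entries,
  which is how smoothness passes to \<open>matrix_inv\<close>.\<close>

lemma matrix_inv_entry:
  fixes A :: "real^'k^'k"
  assumes "det A \<noteq> 0"
  shows "matrix_inv A $ i $ j = det (\<chi> r l. if l = i then axis j 1 $ r else A $ r $ l) / det A"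
proof -
  have "A *v (matrix_inv A *v axis j 1) = axis j 1"
    by (simp add: matrix_vector_mul_assoc matrix_inv_mult assms)
  then have "matrix_inv A *v axis j 1
      = (\<chi> k. det (\<chi> r l. if l = k then axis j 1 $ r else A $ r $ l) / det A)"
    using cramer[OF assms] by blast
  moreover have "(matrix_inv A *v axis j 1) $ i = matrix_inv A $ i $ j"
    by (simp add: matrix_vector_mult_def axis_def if_distrib cong: if_cong)
  ultimately show ?thesis by simp
qed

lemma smooth_matrix_inv:
  assumes "\<And>i j. smooth (\<lambda>x. A x $ i $ j)" "\<And>x. det (A x) > 0"
  shows "smooth (\<lambda>x. matrix_inv (A x) $ i $ j)"
proof -
  have "matrix_inv (A x) $ i $ j
      = det (\<chi> r l. if l = i then axis j 1 $ r else A x $ r $ l) * det (A x) powr (-1)" for x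
    using assms(2)[of x] matrix_inv_entry[of "A x" i j]
    by (simp add: powr_minus abs_of_pos divide_inverse)
  then have eq: "(\<lambda>x. matrix_inv (A x) $ i $ j)
      = (\<lambda>x. det (\<chi> r l. if l = i then axis j 1 $ r else A x $ r $ l) * det (A x) powr (-1))" by auto
  have "smooth (\<lambda>x. if l = i then axis j 1 $ r else A x $ r $ l)" for l r
    using assms(1) by (cases "l = i") (auto intro: smooth_const)
  then show ?thesis unfolding eq
    by (intro smooth_intros smooth_det assms) simp_all
qed

lemma partial_prod:
  fixes u :: "'a \<Rightarrow> real^'n \<Rightarrow> real"
  assumes "finite A" "\<And>a. a \<in> A \<Longrightarrow> u a differentiable (at x)"
  shows "partial i (\<lambda>y. \<Prod>a\<in>A. u a y) x = (\<Sum>a\<in>A. partial i (u a) x * (\<Prod>b\<in>A - {a}. u b x))"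
proof -
  have "((\<lambda>y. \<Prod>a\<in>A. u a y) has_derivative
      (\<lambda>y. \<Sum>a\<in>A. frechet_derivative (u a) (at x) y * (\<Prod>b\<in>A - {a}. u b x))) (at x)"
    by (rule has_derivative_prod) (use assms(2) frechet_derivative_works in blast)
  then show ?thesis by (subst partial_eqI) (auto simp: partial_def)
qed

lemma differentiable_prod:
  fixes u :: "'a \<Rightarrow> real^'n \<Rightarrow> real"
  assumes "\<And>a. a \<in> A \<Longrightarrow> u a differentiable (at x)"
  shows "(\<lambda>y. \<Prod>a\<in>A. u a y) differentiable (at x)"
  using assms by (induction A rule: infinite_finite_induct) (auto intro: differentiable_mult)

text \<open>Jacobi's formula. Differentiating the Leibniz expansion replaces one row at a time by
  its derivative, and each resulting determinant is evaluated by expressing that derivative through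
  the rows of the matrix.\<close>

lemma partial_det:
  fixes A :: "real^'n \<Rightarrow> real^'k^'k"
  assumes diff: "\<And>i j. (\<lambda>y. A y $ i $ j) differentiable (at x)" and det: "det (A x) \<noteq> 0"
  shows "partial k (\<lambda>y. det (A y)) x
    = det (A x) * (\<Sigma> i j. matrix_inv (A x) $ j $ i * partial k (\<lambda>y. A y $ i $ j) x)"
proof -
  define D where "D i j = partial k (\<lambda>y. A y $ i $ j) x" for i j
  let ?P = "{p. p permutes (UNIV::'k set)}"
  have "partial k (\<lambda>y. det (A y)) x
      = (\<Sum>p\<in>?P. of_int (sign p) * (\<Sigma> i. D i (p i) * (\<Prod>r\<in>UNIV - {i}. A x $ r $ p r)))"
    unfolding det_def D_def
    by (simp add: partial_sum partial_mult partial_const partial_prod diff differentiable_prod)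
  also have "\<dots> = (\<Sigma> i. \<Sum>p\<in>?P. of_int (sign p) * (D i (p i) * (\<Prod>r\<in>UNIV - {i}. A x $ r $ p r)))"
    by (subst sum.swap) (simp add: sum_distrib_left)
  also have "\<dots> = (\<Sigma> i. det (A x) * (\<Sigma> j. matrix_inv (A x) $ j $ i * D i j))"
  proof (rule sum.cong[OF refl])
    fix i :: 'k
    \<comment> \<open>Coefficients of the differentiated row i in the rows of \<open>A x\<close>. By
      multilinearity only the i-th coefficient contributes to the determinant.\<close>
    define c :: "real^'k" where "c = (\<chi> l. \<Sigma> j. D i j * matrix_inv (A x) $ j $ l)"
    have inv: "matrix_inv (A x) ** A x = mat 1"
      using det by (rule matrix_inv_mult)
    have row: "(\<Sigma> l. c $ l *s row l (A x)) = (\<chi> m. D i m)"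
    proof (simp add: vec_eq_iff, intro allI)
      fix m
      have "(\<Sigma> l. c $ l * row l (A x) $ m)
          = (\<Sigma> j. D i j * (\<Sigma> l. matrix_inv (A x) $ j $ l * A x $ l $ m))"
        unfolding c_def row_def
        by (simp add: sum_distrib_right sum_distrib_left mult.assoc) (rule sum.swap)
      also have "\<dots> = (\<Sigma> j. D i j * (matrix_inv (A x) ** A x) $ j $ m)"
        by (simp add: matrix_matrix_mult_def)
      also have "\<dots> = D i m" by (simp add: inv mat_def if_distrib cong: if_cong)
      finally show "(\<Sigma> l. c $ l * row l (A x) $ m) = D i m" .
    qed
    have "(\<Sum>p\<in>?P. of_int (sign p) * (D i (p i) * (\<Prod>r\<in>UNIV - {i}. A x $ r $ p r)))
        = det (\<chi> r. if r = i then \<Sigma> l. c $ l *s row l (A x) else row r (A x))"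
      unfolding det_def
    proof (rule sum.cong[OF refl])
      fix p
      have "(\<Prod>r\<in>UNIV. (\<chi> r. if r = i then \<Sigma> l. c $ l *s row l (A x) else row r (A x)) $ r $ p r)
          = D i (p i) * (\<Prod>r\<in>UNIV - {i}. A x $ r $ p r)"
        unfolding row by (subst prod.remove[of UNIV i]) (auto simp: row_def intro!: prod.cong)
      then show "of_int (sign p) * (D i (p i) * (\<Prod>r\<in>UNIV - {i}. A x $ r $ p r))
          = of_int (sign p) * (\<Prod>r\<in>UNIV. (\<chi> r. if r = i then \<Sigma> l. c $ l *s row l (A x) else row r (A x)) $ r $ p r)"
        by simp
    qed
    also have "\<dots> = c $ i * det (A x)" by (rule cramer_lemma_transpose)
    also have "\<dots> = det (A x) * (\<Sigma> j. matrix_inv (A x) $ j $ i * D i j)"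
      by (simp add: c_def mult.commute)
    finally show "(\<Sum>p\<in>?P. of_int (sign p) * (D i (p i) * (\<Prod>r\<in>UNIV - {i}. A x $ r $ p r)))
        = det (A x) * (\<Sigma> j. matrix_inv (A x) $ j $ i * D i j)" .
  qed
  finally show ?thesis by (simp add: D_def sum_distrib_left)
qed

section \<open>Integrals of derivatives with compact support\<close>

lemma integrable_continuous_compact_support:
  fixes v :: "real^'n \<Rightarrow> real"
  assumes "continuous_on UNIV v" "\<And>x. norm x > R \<Longrightarrow> v x = 0"
  shows "integrable lborel v"
proof -
  have "integrable lborel (\<lambda>x. indicator (cball 0 R) x *\<^sub>R v x)"
    using borel_integrable_compact[of "cball 0 R" v] continuous_on_subset[OF assms(1)]
    by (simp add: set_integrable_def)
  moreover have "(\<lambda>x. indicator (cball 0 R) x *\<^sub>R v x) = v"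
    using assms(2) by (auto simp: indicator_def fun_eq_iff not_le)
  ultimately show ?thesis by simp
qed

text \<open>Translation invariance makes the integral of every difference quotient vanish, and
  dominated convergence passes to the derivative. Only differentiability and a continuous partial
  are assumed, because the cutoff fields used later are C^1 but not smooth.\<close>

lemma integral_partial_eq_0:
  fixes u :: "real^'n \<Rightarrow> real"
  assumes diff: "\<And>x. u differentiable (at x)"
    and cont: "continuous_on UNIV (partial i u)"
    and supp: "\<And>x. norm x > R \<Longrightarrow> u x = 0"
  shows "integrable lborel (partial i u)" "integral\<^sup>L lborel (partial i u) = 0"
proof -
  have supp': "partial i u x = 0" if "norm x > R" for x
  proof -
    have "open {x::real^'n. norm x > R}" by (intro open_Collect_less continuous_intros)
    then have "(u has_derivative (\<lambda>_. 0)) (at x)"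
      using that supp by (intro has_derivative_transform_within_open[OF has_derivative_const[of 0]]) auto
    then show ?thesis by (simp add: partial_eqI)
  qed
  have "bounded (partial i u ` cball 0 R)"
    by (intro compact_imp_bounded compact_continuous_image continuous_on_subset[OF cont]) auto
  then obtain C0 where C0: "\<And>x. x \<in> cball 0 R \<Longrightarrow> \<bar>partial i u x\<bar> \<le> C0"
    by (fastforce simp: bounded_iff)
  define C where "C = max C0 0"
  have C: "\<bar>partial i u x\<bar> \<le> C" for x
    using C0[of x] supp'[of x] by (cases "norm x \<le> R") (auto simp: C_def)
  have contu: "continuous_on UNIV u"
    using diff by (simp add: continuous_at_imp_continuous_on differentiable_imp_continuous_within)
  note int = integrable_continuous_compact_support
  show "integrable lborel (partial i u)" by (rule int[OF cont supp'])
  have intu: "integrable lborel u" by (rule int[OF contu supp])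
  \<comment> \<open>Steps of length at most 1 keep all difference quotients supported in the ball of
    radius R + 1, where a constant dominates them.\<close>
  define h where "h k = inverse (real (Suc k))" for k
  have h: "0 < h k" "h k \<le> 1" for k by (auto simp: h_def inverse_le_1_iff)
  define q where "q k x = (u (h k *\<^sub>R axis i 1 + x) - u x) / h k" for k x
  have mu: "u \<in> borel_measurable borel" using contu by (rule borel_measurable_continuous_onI)
  have intt: "integrable lborel (\<lambda>x. u (t + x))" and valt: "integral\<^sup>L lborel (\<lambda>x. u (t + x)) = integral\<^sup>L lborel u" for t
  proof -
    have "integrable (distr lborel borel ((+) t)) u" using intu by (simp add: lborel_distr_plus)
    then show "integrable lborel (\<lambda>x. u (t + x))"
      by (subst (asm) integrable_distr_eq) (auto simp: mu)
    have "integral\<^sup>L (distr lborel borel ((+) t)) u = integral\<^sup>L lborel (\<lambda>x. u (t + x))"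
      by (intro integral_distr) (auto simp: mu)
    then show "integral\<^sup>L lborel (\<lambda>x. u (t + x)) = integral\<^sup>L lborel u" by (simp add: lborel_distr_plus)
  qed
  have q0: "integral\<^sup>L lborel (q k) = 0" for k
    unfolding q_def using intu intt valt by simp
  have mvt: "\<exists>s. 0 < s \<and> s < h k \<and> q k x = partial i u (x + s *\<^sub>R axis i 1)" for k x
  proof -
    have "((\<lambda>s. u (x + s *\<^sub>R axis i 1)) has_real_derivative partial i u (x + s *\<^sub>R axis i 1)) (at s)" for s
      by (rule has_real_derivative_along_axis[OF diff])
    from MVT2[OF h(1)[of k] this] obtain s where "0 < s" "s < h k"
      "u (x + h k *\<^sub>R axis i 1) - u (x + 0 *\<^sub>R axis i 1) = (h k - 0) * partial i u (x + s *\<^sub>R axis i 1)"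
      by auto
    then show ?thesis using h(1)[of k] by (auto simp: q_def add.commute field_simps)
  qed
  have "(\<lambda>k. integral\<^sup>L lborel (q k)) \<longlonglongrightarrow> integral\<^sup>L lborel (partial i u)"
  proof (rule integral_dominated_convergence[where w = "\<lambda>x. C * indicator (cball 0 (R + 1)) x"])
    show "partial i u \<in> borel_measurable lborel"
      using cont by (simp add: borel_measurable_continuous_onI)
    have "continuous_on UNIV (q k)" for k
      unfolding q_def using h(1)[of k]
      by (intro continuous_intros continuous_on_compose2[OF contu]) auto
    then show "q k \<in> borel_measurable lborel" for k
      by (simp add: borel_measurable_continuous_onI)
    show "integrable lborel (\<lambda>x::real^'n. C * indicator (cball 0 (R + 1)) x)"
      using emeasure_lborel_cball_finite[of "0::real^'n" "R + 1"]
      by (intro integrable_mult_right integrable_real_indicator) auto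
    show "AE x in lborel. (\<lambda>k. q k x) \<longlonglongrightarrow> partial i u x"
    proof (intro AE_I2)
      fix x
      obtain s where s: "\<And>k. 0 < s k \<and> s k < h k \<and> q k x = partial i u (x + s k *\<^sub>R axis i 1)"
        using mvt[of _ x] by metis
      have "h \<longlonglongrightarrow> 0" unfolding h_def by (rule LIMSEQ_inverse_real_of_nat)
      moreover have "\<And>k. 0 \<le> s k" "\<And>k. s k \<le> h k" using s by (auto intro: less_imp_le)
      ultimately have "s \<longlonglongrightarrow> 0"
        by (intro tendsto_sandwich[of "\<lambda>_. 0" s _ h 0] always_eventually allI tendsto_const)
      then have "(\<lambda>k. x + s k *\<^sub>R axis i 1) \<longlonglongrightarrow> x"
        using tendsto_add[OF tendsto_const tendsto_scaleR[OF _ tendsto_const], of s 0] by fastforce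
      moreover have "isCont (partial i u) x" using cont by (simp add: continuous_on_eq_continuous_at)
      ultimately have "(\<lambda>k. partial i u (x + s k *\<^sub>R axis i 1)) \<longlonglongrightarrow> partial i u x"
        by (rule isCont_tendsto_compose[rotated])
      then show "(\<lambda>k. q k x) \<longlonglongrightarrow> partial i u x" using s by simp
    qed
    show "AE x in lborel. norm (q k x) \<le> C * indicator (cball 0 (R + 1)) x" for k
    proof (intro AE_I2)
      fix x
      obtain s where s: "0 < s" "s < h k" "q k x = partial i u (x + s *\<^sub>R axis i 1)" using mvt by blast
      show "norm (q k x) \<le> C * indicator (cball 0 (R + 1)) x"
      proof (cases "norm x \<le> R + 1")
        case True
        then show ?thesis using s(3) C by simp
      next
        case False
        have "norm x \<le> norm (x + s *\<^sub>R axis i 1) + norm (s *\<^sub>R axis i 1 :: real^'n)"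
          by (metis add_diff_cancel_right' norm_triangle_ineq4)
        then have "norm (x + s *\<^sub>R axis i 1) > R" using False s h(2)[of k] by simp
        then show ?thesis using s(3) supp' False by simp
      qed
    qed
  qed
  then have "(\<lambda>k::nat. 0::real) \<longlonglongrightarrow> integral\<^sup>L lborel (partial i u)" by (simp add: q0)
  then show "integral\<^sup>L lborel (partial i u) = 0"
    using LIMSEQ_unique tendsto_const by blast
qed

section \<open>Tangential calculus on a minimal graph\<close>

text \<open>On the segment from the identity to A every matrix is positive definite, so the
  determinant starts at 1 and never vanishes.\<close>

lemma det_pos_if_positive_definite:
  fixes A :: "real^'k^'k"
  assumes pos: "\<And>v. v \<noteq> 0 \<Longrightarrow> v \<bullet> (A *v v) > 0"
  shows "det A > 0"
proof -
  define h where "h t = det ((1 - t) *\<^sub>R mat 1 + t *\<^sub>R A)" for t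
  have cont: "continuous_on {0..1} h"
    unfolding h_def det_def by (intro continuous_intros)
  have nz: "h t \<noteq> 0" if "0 \<le> t" "t \<le> 1" for t
  proof
    assume "h t = 0"
    then obtain v where v: "v \<noteq> 0" "((1 - t) *\<^sub>R mat 1 + t *\<^sub>R A) *v v = 0"
      unfolding h_def using matrix_left_invertible_ker invertible_det_nz invertible_left_inverse by metis
    then have "(1 - t) * (v \<bullet> v) + t * (v \<bullet> (A *v v)) = 0"
      by (metis (no_types, lifting) inner_add_right inner_scaleR_right inner_zero_right
          matrix_vector_mul_lid matrix_vector_mult_add_rdistrib scaleR_matrix_vector_assoc)
    moreover have "v \<bullet> v > 0" "v \<bullet> (A *v v) > 0" using v(1) pos by auto
    ultimately show False using that
      by (smt (verit) mult_nonneg_nonneg mult_pos_pos zero_less_mult_iff)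
  qed
  show ?thesis
  proof (rule ccontr)
    assume "\<not> det A > 0"
    then have "h 1 \<le> 0" "0 \<le> h 0" by (simp_all add: h_def)
    then obtain t where "0 \<le> t" "t \<le> 1" "h t = 0"
      using IVT2'[of h 1 0 0] cont by auto
    then show False using nz by blast
  qed
qed

lemma sum_swap3: "(\<Sum>i\<in>A. \<Sum>j\<in>B. \<Sum>a\<in>C. h i j a) = (\<Sum>a\<in>C. \<Sum>i\<in>A. \<Sum>j\<in>B. h i j a)"
proof -
  have "(\<Sum>i\<in>A. \<Sum>j\<in>B. \<Sum>a\<in>C. h i j a) = (\<Sum>i\<in>A. \<Sum>a\<in>C. \<Sum>j\<in>B. h i j a)"
    by (rule sum.cong[OF refl], rule sum.swap)
  also have "\<dots> = (\<Sum>a\<in>C. \<Sum>i\<in>A. \<Sum>j\<in>B. h i j a)" by (rule sum.swap)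
  finally show ?thesis .
qed

lemma matrix_inv_symmetric:
  fixes A :: "real^'k^'k"
  assumes "det A \<noteq> 0" "\<And>i j. A $ i $ j = A $ j $ i"
  shows "matrix_inv A $ i $ j = matrix_inv A $ j $ i"
proof -
  have T: "transpose A = A" using assms(2) by (simp add: transpose_def vec_eq_iff)
  let ?I = "matrix_inv A"
  have "transpose (A ** ?I) = mat 1"
    by (simp only: matrix_inv_mult(1)[OF assms(1)] transpose_mat)
  then have L: "transpose ?I ** A = mat 1" by (simp only: matrix_transpose_mul T)
  have "transpose ?I = transpose ?I ** (A ** ?I)"
    by (simp only: matrix_inv_mult(1)[OF assms(1)] matrix_mul_rid)
  also have "\<dots> = ?I" by (simp only: matrix_mul_assoc L matrix_mul_lid)
  finally show ?thesis by (simp add: transpose_def vec_eq_iff)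
qed

definition gram :: "('a::finite \<Rightarrow> real^'n \<Rightarrow> real) \<Rightarrow> real^'n \<Rightarrow> real^'n^'n"
  where "gram X x = (\<chi> i j. \<Sigma> a. partial i (X a) x * partial j (X a) x)"

text \<open>In the chart, the tangential projection of the a-th ambient unit vector is the vector field
  with components \<open>dual X a i\<close>, and \<open>tder X a\<close> is the derivative along it.\<close>

definition dual :: "('a::finite \<Rightarrow> real^'n \<Rightarrow> real) \<Rightarrow> 'a \<Rightarrow> 'n \<Rightarrow> real^'n \<Rightarrow> real"
  where "dual X a i x = (\<Sigma> j. matrix_inv (gram X x) $ i $ j * partial j (X a) x)"

definition tder :: "('a::finite \<Rightarrow> real^'n \<Rightarrow> real) \<Rightarrow> 'a \<Rightarrow> (real^'n \<Rightarrow> real) \<Rightarrow> real^'n \<Rightarrow> real"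
  where "tder X a u x = (\<Sigma> i. dual X a i x * partial i u x)"

definition proj :: "('a::finite \<Rightarrow> real^'n \<Rightarrow> real) \<Rightarrow> 'a \<Rightarrow> 'a \<Rightarrow> real^'n \<Rightarrow> real"
  where "proj X a b = tder X a (X b)"

definition log_vol :: "('a::finite \<Rightarrow> real^'n \<Rightarrow> real) \<Rightarrow> real^'n \<Rightarrow> real"
  where "log_vol X x = ln (det (gram X x)) / 2"

text \<open>The derivative of the projection contains the second fundamental form twice, in the
  tangent-normal and in the normal-tangent block; hence the division by 2.\<close>

definition sqnorm_A :: "('a::finite \<Rightarrow> real^'n \<Rightarrow> real) \<Rightarrow> real^'n \<Rightarrow> real"
  where "sqnorm_A X x = (\<Sigma> a b d. (tder X a (proj X b d) x)\<^sup>2) / 2"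

text \<open>The tangential divergence of the tangential gradient, i.e. the Laplace-Beltrami operator
  of the graph written without Christoffel symbols.\<close>

definition laplace :: "('a::finite \<Rightarrow> real^'n \<Rightarrow> real) \<Rightarrow> (real^'n \<Rightarrow> real) \<Rightarrow> real^'n \<Rightarrow> real"
  where "laplace X u x = (\<Sigma> a. tder X a (tder X a u) x)"

section \<open>Sum, product and chain rules for tangential derivatives\<close>

lemma tder_const: "tder X a (\<lambda>_. k) x = 0"
  by (simp add: tder_def partial_const)

text \<open>The versions ending in \<open>_at\<close> ask for differentiability at one point. They
  serve the cutoff function and the local frame fields, to which the smooth versions do not
  apply.\<close>

lemma tder_add_at:
  assumes "u differentiable (at x)" "v differentiable (at x)"
  shows "tder X a (\<lambda>y. u y + v y) x = tder X a u x + tder X a v x"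
  using assms by (simp add: tder_def partial_add distrib_left sum.distrib)

lemma tder_mult_at:
  assumes "u differentiable (at x)" "v differentiable (at x)"
  shows "tder X a (\<lambda>y. u y * v y) x = tder X a u x * v x + u x * tder X a v x"
  using assms by (simp add: tder_def partial_mult distrib_left sum.distrib sum_distrib_left sum_distrib_right mult_ac)

lemma tder_sum_at:
  assumes "\<And>b. b \<in> B \<Longrightarrow> u b differentiable (at x)"
  shows "tder X a (\<lambda>y. \<Sum>b\<in>B. u b y) x = (\<Sum>b\<in>B. tder X a (u b) x)"
  using assms by (simp add: tder_def partial_sum sum_distrib_left) (rule sum.swap)

lemmas tder_add = tder_add_at[OF smooth_differentiable smooth_differentiable]
lemmas tder_mult = tder_mult_at[OF smooth_differentiable smooth_differentiable]
lemmas tder_sum = tder_sum_at[OF smooth_differentiable]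

lemma tder_cmult: "smooth u \<Longrightarrow> tder X a (\<lambda>y. k * u y) x = k * tder X a u x"
  using tder_mult[OF smooth_const[of k]] by (simp add: tder_const)

lemma tder_minus: "smooth u \<Longrightarrow> tder X a (\<lambda>y. - u y) x = - tder X a u x"
  using tder_cmult[of u X a "-1"] by simp

lemma tder_diff: "smooth u \<Longrightarrow> smooth v \<Longrightarrow> tder X a (\<lambda>y. u y - v y) x = tder X a u x - tder X a v x"
  using tder_add[OF _ smooth_minus[of v], of u X a x] tder_minus[of v X a x] by simp

lemma tder_compose_real:
  assumes "(G has_field_derivative G') (at (u x))" "u differentiable (at x)"
  shows "tder X a (\<lambda>y. G (u y)) x = G' * tder X a u x"
  by (simp add: tder_def partial_compose_real[OF assms] sum_distrib_left mult_ac)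

lemma tder_coord: "tder X a (\<lambda>x. x $ k) x = dual X a k x"
  by (simp add: tder_def partial_coord if_distrib cong: if_cong)

text \<open>The coefficients \<open>c\<close> recover the chart linearly from the ambient
  coordinates. For a graph they merely select the first n coordinates, but in this general form the
  assumption is stable under ambient rotations. It also makes the differential of X
  injective.\<close>

locale immersed_chart =
  fixes X :: "'a::finite \<Rightarrow> real^'n \<Rightarrow> real" and c :: "'n \<Rightarrow> 'a \<Rightarrow> real"
  assumes smooth_X: "\<And>a. smooth (X a)"
    and chart: "\<And>k x. (\<Sigma> a. c k a * X a x) = x $ k"
begin

abbreviation "M \<equiv> dual X"
abbreviation "\<delta> \<equiv> tder X"
abbreviation "P \<equiv> proj X"

lemma gram_symmetric: "gram X x $ i $ j = gram X x $ j $ i"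
  by (simp add: gram_def mult.commute)

lemma partial_chart: "(\<Sigma> a. c k a * partial i (X a) x) = (if i = k then 1 else 0)"
proof -
  have "(\<lambda>x. \<Sigma> a. c k a * X a x) = (\<lambda>x. x $ k)" using chart by auto
  then have "partial i (\<lambda>x. \<Sigma> a. c k a * X a x) x = (if i = k then 1 else 0)"
    by (simp add: partial_coord)
  then show ?thesis
    by (simp add: partial_sum partial_mult partial_const smooth_differentiable smooth_mult smooth_const smooth_X)
qed

lemma det_gram_pos: "det (gram X x) > 0"
proof (rule det_pos_if_positive_definite)
  fix v :: "real^'n" assume v: "v \<noteq> 0"
  define w where "w a = (\<Sigma> i. v $ i * partial i (X a) x)" for a
  have "v \<bullet> (gram X x *v v) = (\<Sigma> i j a. (v $ i * partial i (X a) x) * (v $ j * partial j (X a) x))"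
    by (simp add: inner_vec_def matrix_vector_mult_def gram_def sum_distrib_left sum_distrib_right mult_ac)
  also have "\<dots> = (\<Sigma> a i j. (v $ i * partial i (X a) x) * (v $ j * partial j (X a) x))"
    by (rule sum_swap3)
  also have "\<dots> = (\<Sigma> a. (w a)\<^sup>2)"
    by (simp add: w_def power2_eq_square sum_product)
  finally have eq: "v \<bullet> (gram X x *v v) = (\<Sigma> a. (w a)\<^sup>2)" .
  have "\<exists>a. w a \<noteq> 0"
  proof (rule ccontr)
    assume "\<not> (\<exists>a. w a \<noteq> 0)"
    then have w0: "w a = 0" for a by blast
    have "v $ k = 0" for k
    proof -
      have "(\<Sigma> a. c k a * w a) = (\<Sigma> i. v $ i * (\<Sigma> a. c k a * partial i (X a) x))"
        unfolding w_def sum_distrib_left by (subst sum.swap) (simp add: mult_ac)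
      then show ?thesis by (simp add: w0 partial_chart if_distrib cong: if_cong)
    qed
    then show False using v by (simp add: vec_eq_iff)
  qed
  then obtain a where "w a \<noteq> 0" by blast
  then have "(\<Sigma> a. (w a)\<^sup>2) > 0"
    by (intro sum_pos2[of _ a]) auto
  then show "v \<bullet> (gram X x *v v) > 0" by (simp add: eq)
qed

lemma det_gram_nz: "det (gram X x) \<noteq> 0"
  using det_gram_pos[of x] by simp

lemma smooth_gram: "smooth (\<lambda>x. gram X x $ i $ j)"
  unfolding gram_def by (simp, intro smooth_intros smooth_X)

lemma smooth_dual: "smooth (dual X a i)"
  unfolding dual_def[abs_def] by (intro smooth_intros smooth_X smooth_matrix_inv smooth_gram det_gram_pos)

lemma smooth_tder: "smooth u \<Longrightarrow> smooth (tder X a u)"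
  unfolding tder_def[abs_def] by (intro smooth_intros smooth_dual)

lemma smooth_proj: "smooth (proj X a b)"
  unfolding proj_def by (intro smooth_tder smooth_X)

lemma smooth_log_vol: "smooth (log_vol X)"
proof -
  have "log_vol X = (\<lambda>x. ln (det (gram X x)) * (1/2))" by (simp add: log_vol_def fun_eq_iff)
  then show ?thesis by (simp only:) (intro smooth_intros smooth_det smooth_gram det_gram_pos)
qed

lemma smooth_sqnorm_A: "smooth (sqnorm_A X)"
proof -
  have "sqnorm_A X = (\<lambda>x. (\<Sigma> a b d. (tder X a (proj X b d) x)^2) * (1/2))"
    by (simp add: sqnorm_A_def fun_eq_iff)
  then show ?thesis by (simp only:) (intro smooth_intros smooth_tder smooth_proj)
qed

lemma smooth_vol: "smooth (\<lambda>x. sqrt (det (gram X x)))"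
proof -
  have "(\<lambda>x. sqrt (det (gram X x))) = (\<lambda>x. det (gram X x) powr (1/2))"
    using det_gram_pos by (auto simp: fun_eq_iff powr_half_sqrt[OF less_imp_le])
  then show ?thesis by (simp only:) (intro smooth_intros smooth_det smooth_gram det_gram_pos)
qed

lemmas smooth_rules = smooth_intros smooth_X smooth_dual smooth_tder smooth_proj smooth_log_vol
  smooth_sqnorm_A smooth_vol

lemma inv_gram_symmetric: "matrix_inv (gram X x) $ i $ j = matrix_inv (gram X x) $ j $ i"
  by (rule matrix_inv_symmetric[OF det_gram_nz gram_symmetric])

lemma dual_biorthogonal: "(\<Sigma> a. M a i x * partial j (X a) x) = (if i = j then 1 else 0)"
proof -
  have "(\<Sigma> a. M a i x * partial j (X a) x)
      = (\<Sigma> k. matrix_inv (gram X x) $ i $ k * (\<Sigma> a. partial k (X a) x * partial j (X a) x))"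
    unfolding dual_def sum_distrib_right sum_distrib_left by (subst sum.swap) (simp add: mult_ac)
  also have "\<dots> = (matrix_inv (gram X x) ** gram X x) $ i $ j"
    by (simp add: matrix_matrix_mult_def gram_def)
  finally show ?thesis by (simp add: matrix_inv_mult(2)[OF det_gram_nz] mat_def)
qed

text \<open>The chart derivatives are recovered from the \<delta>_a by biorthogonality. In
  particular a function with vanishing tangential derivatives is constant.\<close>

lemma partial_eq_tder: "partial j u x = (\<Sigma> a. partial j (X a) x * \<delta> a u x)"
proof -
  have "(\<Sigma> a. partial j (X a) x * \<delta> a u x)
      = (\<Sigma> i. (\<Sigma> a. M a i x * partial j (X a) x) * partial i u x)"
    unfolding tder_def sum_distrib_right sum_distrib_left by (subst sum.swap) (simp add: mult_ac)
  then show ?thesis by (simp add: dual_biorthogonal if_distrib[of "\<lambda>z. z * _"] cong: if_cong)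
qed

lemma proj_sym: "P a b x = P b a x"
proof -
  have *: "P a b x = (\<Sigma> i j. matrix_inv (gram X x) $ i $ j * partial j (X a) x * partial i (X b) x)" for a b
    by (simp add: proj_def tder_def dual_def sum_distrib_right)
  show ?thesis
    unfolding * by (subst sum.swap) (simp add: inv_gram_symmetric[of x] mult_ac)
qed

lemma proj_sym_fun: "P a b = P b a"
  using proj_sym by auto

text \<open>The \<delta>_a are components of a tangential gradient and so are fixed by the
  projection. Taking u to be an ambient coordinate or a chart coordinate gives the two identities
  that follow.\<close>

lemma proj_tder: "(\<Sigma> b. P a b x * \<delta> b u x) = \<delta> a u x"
proof -
  have "(\<Sigma> b. P a b x * \<delta> b u x) = (\<Sigma> i. M a i x * (\<Sigma> b. partial i (X b) x * \<delta> b u x))"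
    unfolding proj_def tder_def[of X a] sum_distrib_right sum_distrib_left
    by (subst sum.swap) (simp add: mult_ac)
  then show ?thesis by (simp add: partial_eq_tder[symmetric] tder_def[of X a])
qed

lemma proj_idem: "(\<Sigma> b. P a b x * P b d x) = P a d x"
  using proj_tder[of a x "X d"] by (simp add: proj_def)

lemma proj_dual: "(\<Sigma> b. P a b x * M b k x) = M a k x"
  using proj_tder[of a x "\<lambda>x. x $ k"] by (simp add: tder_coord)

lemma proj_partial: "(\<Sigma> b. P a b x * partial k (X b) x) = partial k (X a) x"
  using partial_eq_tder[of k "X a" x] by (simp add: proj_def[symmetric] proj_sym[of a] mult.commute)

text \<open>The chart coordinates are linear in the ambient ones, so their gradients are linear in P
  with constant coefficients. Derivatives of M thereby reduce to derivatives of P.\<close>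

lemma dual_eq_proj: "M a k x = (\<Sigma> b. c k b * P a b x)"
proof -
  have "(\<lambda>x. x $ k) = (\<lambda>x. \<Sigma> b. c k b * X b x)" using chart by auto
  then have "M a k x = \<delta> a (\<lambda>x. \<Sigma> b. c k b * X b x) x" by (metis tder_coord)
  also have "\<dots> = (\<Sigma> b. c k b * P a b x)"
    by (simp add: tder_sum tder_cmult smooth_rules proj_def)
  finally show ?thesis .
qed

lemma tder_tder:
  assumes "smooth u"
  shows "\<delta> a (\<delta> b u) x = (\<Sigma> i. \<delta> a (M b i) x * partial i u x)
    + (\<Sigma> i j. M b i x * M a j x * partial j (partial i u) x)"
proof -
  have "\<delta> a (\<delta> b u) x = \<delta> a (\<lambda>x. \<Sigma> i. M b i x * partial i u x) x"
    by (simp add: tder_def[of X b, abs_def])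
  also have "\<dots> = (\<Sigma> i. \<delta> a (M b i) x * partial i u x + M b i x * \<delta> a (partial i u) x)"
    using assms by (simp add: tder_sum tder_mult smooth_rules)
  finally show ?thesis
    by (simp add: sum.distrib tder_def[of X a "partial _ u"] sum_distrib_left mult_ac)
qed

text \<open>The second derivatives cancel, so the commutator is a vector field; its ambient
  components are found by applying it to the coordinates \<open>X d\<close>.\<close>

lemma tder_commute:
  assumes "smooth u"
  shows "\<delta> a (\<delta> b u) x = \<delta> b (\<delta> a u) x + (\<Sigma> d. (\<delta> a (P b d) x - \<delta> b (P a d) x) * \<delta> d u x)"
proof -
  define Z where "Z i = \<delta> a (M b i) x - \<delta> b (M a i) x" for i
  have *: "\<delta> a (\<delta> b u) x - \<delta> b (\<delta> a u) x = (\<Sigma> i. Z i * partial i u x)" if "smooth u" for u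
  proof -
    have "(\<Sigma> i j. M b i x * M a j x * partial j (partial i u) x)
        = (\<Sigma> i j. M a i x * M b j x * partial j (partial i u) x)"
      by (subst sum.swap) (simp add: partial_commute[OF that] mult_ac)
    then show ?thesis
      by (simp add: tder_tder[OF that] Z_def left_diff_distrib sum_subtractf)
  qed
  have "(\<Sigma> d. (\<delta> a (P b d) x - \<delta> b (P a d) x) * \<delta> d u x)
      = (\<Sigma> d. (\<Sigma> i. Z i * partial i (X d) x) * \<delta> d u x)"
    by (simp add: proj_def *[OF smooth_X])
  also have "\<dots> = (\<Sigma> i. Z i * (\<Sigma> d. partial i (X d) x * \<delta> d u x))"
    unfolding sum_distrib_right sum_distrib_left by (subst sum.swap) (simp add: mult_ac)
  also have "\<dots> = \<delta> a (\<delta> b u) x - \<delta> b (\<delta> a u) x"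
    by (simp add: partial_eq_tder[symmetric] *[OF assms])
  finally show ?thesis by simp
qed

section \<open>Volume density and mean curvature\<close>

lemma partial_log_vol: "partial k (log_vol X) x = (\<Sigma> a j. M a j x * partial k (partial j (X a)) x)"
proof -
  have sm: "smooth (\<lambda>x. det (gram X x))" by (intro smooth_det smooth_gram)
  have "partial k (log_vol X) x = 1/2 * partial k (\<lambda>x. ln (det (gram X x))) x"
  proof -
    have "log_vol X = (\<lambda>x. 1/2 * ln (det (gram X x)))" by (simp add: log_vol_def fun_eq_iff)
    then show ?thesis
      by (simp only: partial_mult partial_const smooth_differentiable smooth_const smooth_ln sm det_gram_pos)
  qed
  also have "partial k (\<lambda>x. ln (det (gram X x))) x = inverse (det (gram X x)) * partial k (\<lambda>x. det (gram X x)) x"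
    by (rule partial_compose_real[OF DERIV_ln[OF det_gram_pos] smooth_differentiable[OF sm]])
  also have "\<dots> = (\<Sigma> i j. matrix_inv (gram X x) $ j $ i * partial k (\<lambda>y. gram X y $ i $ j) x)"
    using det_gram_nz[of x] by (simp add: partial_det[OF smooth_differentiable[OF smooth_gram] det_gram_nz])
  also have "\<dots> = (\<Sigma> i j a. matrix_inv (gram X x) $ j $ i * (partial i (X a) x * partial k (partial j (X a)) x))
      + (\<Sigma> i j a. matrix_inv (gram X x) $ i $ j * (partial j (X a) x * partial k (partial i (X a)) x))"
  proof -
    have "partial k (\<lambda>y. gram X y $ i $ j) x
        = (\<Sigma> a. partial i (X a) x * partial k (partial j (X a)) x)
          + (\<Sigma> a. partial j (X a) x * partial k (partial i (X a)) x)" for i j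
      by (simp add: gram_def partial_sum partial_mult smooth_differentiable smooth_rules sum.distrib mult_ac)
    moreover have "matrix_inv (gram X x) $ j $ i = matrix_inv (gram X x) $ i $ j" for i j
      by (rule inv_gram_symmetric)
    ultimately show ?thesis
      by (simp add: sum.distrib distrib_left sum_distrib_left)
  qed
  also have "(\<Sigma> i j a. matrix_inv (gram X x) $ j $ i * (partial i (X a) x * partial k (partial j (X a)) x))
     = (\<Sigma> i j a. matrix_inv (gram X x) $ i $ j * (partial j (X a) x * partial k (partial i (X a)) x))"
    by (rule sum.swap)
  also have "\<dots> = (\<Sigma> i a. M a i x * partial k (partial i (X a)) x)"
    by (rule sum.cong[OF refl], subst sum.swap) (simp add: dual_def sum_distrib_right sum_distrib_left mult_ac)
  also have "\<dots> = (\<Sigma> a i. M a i x * partial k (partial i (X a)) x)"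
    by (rule sum.swap)
  finally show ?thesis by simp
qed

text \<open>Since the total trace of M against the chart derivatives of X is the constant n, the
  derivative can be shifted from these chart derivatives to M, and from there to P by
  \<open>dual_eq_proj\<close>. This expresses the gradient of the log density through the second
  fundamental form.\<close>

lemma tder_log_vol:
  "\<delta> a (log_vol X) x = - (\<Sigma> b j d. c j d * (partial j (X b) x * \<delta> a (P b d) x))"
proof -
  have "\<delta> a (log_vol X) x = (\<Sigma> k b j. M a k x * (M b j x * partial k (partial j (X b)) x))"
    by (simp add: tder_def[of X a] partial_log_vol sum_distrib_left)
  also have "\<dots> = (\<Sigma> b k j. M a k x * (M b j x * partial k (partial j (X b)) x))"
    by (rule sum.swap)
  also have "\<dots> = (\<Sigma> b j. M b j x * \<delta> a (partial j (X b)) x)"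
    by (rule sum.cong[OF refl], subst sum.swap) (simp add: tder_def[of X a] sum_distrib_left mult_ac)
  also have "\<dots> = - (\<Sigma> b j. \<delta> a (M b j) x * partial j (X b) x)"
  proof -
    have "(\<lambda>y. \<Sigma> b j. M b j y * partial j (X b) y) = (\<lambda>y. real CARD('n))"
    proof
      fix y
      show "(\<Sigma> b j. M b j y * partial j (X b) y) = real CARD('n)"
        by (subst sum.swap) (simp add: dual_biorthogonal)
    qed
    then have "\<delta> a (\<lambda>y. \<Sigma> b j. M b j y * partial j (X b) y) x = 0"
      by (simp add: tder_const)
    then show ?thesis
      by (simp add: tder_sum tder_mult smooth_rules sum.distrib)
  qed
  also have "(\<Sigma> b j. \<delta> a (M b j) x * partial j (X b) x)
      = (\<Sigma> b j d. c j d * (partial j (X b) x * \<delta> a (P b d) x))"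
  proof -
    have "\<delta> a (M b j) x = (\<Sigma> d. c j d * \<delta> a (P b d) x)" for b j
    proof -
      have "M b j = (\<lambda>x. \<Sigma> d. c j d * P b d x)" using dual_eq_proj by auto
      then show ?thesis by (simp add: tder_sum tder_cmult smooth_rules)
    qed
    then show ?thesis by (simp add: sum_distrib_right sum_distrib_left mult_ac)
  qed
  finally show ?thesis .
qed

text \<open>The inner sum is the mean curvature vector times the volume density, and it is normal
  for every immersion. The proof differentiates the biorthogonality relation; the terms with second
  derivatives of X match the derivative of the density.\<close>

lemma mean_curvature_normal:
  "(\<Sigma> a. (\<Sigma> i. partial i (\<lambda>y. sqrt (det (gram X y)) * M a i y) x) * partial k (X a) x) = 0"
proof -
  let ?v = "\<lambda>y. sqrt (det (gram X y))"
  have exp: "?v = (\<lambda>y. exp (log_vol X y))"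
    using exp_ln[OF real_sqrt_gt_zero[OF det_gram_pos]]
    by (simp add: log_vol_def ln_sqrt[OF less_imp_le[OF det_gram_pos]])
  have vk: "partial k ?v x = ?v x * partial k (log_vol X) x"
    using partial_compose_real[OF DERIV_exp smooth_differentiable[OF smooth_log_vol], of k x]
      fun_cong[OF exp, of x] by (simp add: exp)
  have "(\<lambda>y. \<Sigma> a. ?v y * M a i y * partial k (X a) y) = (\<lambda>y. ?v y * (if i = k then 1 else 0))" for i
    by (simp only: mult.assoc sum_distrib_left[symmetric] dual_biorthogonal)
  then have "partial i (\<lambda>y. \<Sigma> a. ?v y * M a i y * partial k (X a) y) x = (if i = k then 1 else 0) * partial i ?v x" for i
    by (simp add: partial_const)
  moreover have "partial i (\<lambda>y. \<Sigma> a. ?v y * M a i y * partial k (X a) y) x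
      = (\<Sigma> a. partial i (\<lambda>y. ?v y * M a i y) x * partial k (X a) x + ?v x * (M a i x * partial i (partial k (X a)) x))" for i
  proof -
    have d: "(\<lambda>y. ?v y * M a i y) differentiable (at x)" "partial k (X a) differentiable (at x)" for a
      by (intro smooth_differentiable smooth_rules)+
    have "partial i (\<lambda>y. \<Sigma> a. ?v y * M a i y * partial k (X a) y) x
        = (\<Sigma> a. partial i (\<lambda>y. ?v y * M a i y * partial k (X a) y) x)"
      by (simp only: partial_sum differentiable_mult d)
    then show ?thesis by (simp only: partial_mult[OF d]) (simp add: mult.assoc)
  qed
  ultimately have "(\<Sigma> i a. partial i (\<lambda>y. ?v y * M a i y) x * partial k (X a) x)
      + (\<Sigma> i a. ?v x * (M a i x * partial i (partial k (X a)) x)) = (\<Sigma> i. (if i = k then 1 else 0) * partial i ?v x)"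
    by (simp add: sum.distrib[symmetric])
  also have "\<dots> = partial k ?v x" by (simp add: if_distrib[of "\<lambda>z. z * _"] cong: if_cong)
  also have "\<dots> = (\<Sigma> i a. ?v x * (M a i x * partial i (partial k (X a)) x))"
    unfolding vk partial_log_vol sum_distrib_left by (subst sum.swap) (simp add: partial_commute[OF smooth_X, of _ k])
  finally have "(\<Sigma> i a. partial i (\<lambda>y. ?v y * M a i y) x * partial k (X a) x) = 0" by simp
  then show ?thesis unfolding sum_distrib_right by (subst sum.swap)
qed

end

locale minimal_graph = immersed_chart X c
  for X :: "'a::finite \<Rightarrow> real^'n \<Rightarrow> real" and c +
  assumes minimal: "\<And>a x. (\<Sigma> i. partial i (\<lambda>y. sqrt (det (gram X y)) * dual X a i y) x) = 0"
begin

text \<open>The left side is the divergence of the tangential part of Y. It may be computed from all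
  of Y, because the normal part would only contribute its product with the mean curvature
  vector.\<close>

lemma divergence:
  assumes "\<And>a. Y a differentiable (at x)"
  shows "(\<Sigma> i. partial i (\<lambda>y. sqrt (det (gram X y)) * (\<Sigma> a. M a i y * Y a y)) x)
    = sqrt (det (gram X x)) * (\<Sigma> a. \<delta> a (Y a) x)"
proof -
  have "partial i (\<lambda>y. sqrt (det (gram X y)) * (\<Sigma> a. M a i y * Y a y)) x
      = (\<Sigma> a. partial i (\<lambda>y. sqrt (det (gram X y)) * M a i y) x * Y a x
          + sqrt (det (gram X x)) * (M a i x * partial i (Y a) x))" for i
  proof -
    have d: "(\<lambda>y. sqrt (det (gram X y)) * M a i y) differentiable (at x)" for a
      by (intro smooth_differentiable smooth_rules)
    have "(\<lambda>y. sqrt (det (gram X y)) * (\<Sigma> a. M a i y * Y a y))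
        = (\<lambda>y. \<Sigma> a. sqrt (det (gram X y)) * M a i y * Y a y)"
      by (simp add: sum_distrib_left mult_ac)
    then have "partial i (\<lambda>y. sqrt (det (gram X y)) * (\<Sigma> a. M a i y * Y a y)) x
        = (\<Sigma> a. partial i (\<lambda>y. sqrt (det (gram X y)) * M a i y * Y a y) x)"
      using assms by (simp only: partial_sum differentiable_mult d)
    then show ?thesis
      by (simp only: partial_mult[OF d assms]) (simp add: mult.assoc)
  qed
  then have "(\<Sigma> i. partial i (\<lambda>y. sqrt (det (gram X y)) * (\<Sigma> a. M a i y * Y a y)) x)
      = (\<Sigma> i a. partial i (\<lambda>y. sqrt (det (gram X y)) * M a i y) x * Y a x)
        + (\<Sigma> i a. sqrt (det (gram X x)) * (M a i x * partial i (Y a) x))"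
    by (simp add: sum.distrib)
  also have "(\<Sigma> i a. partial i (\<lambda>y. sqrt (det (gram X y)) * M a i y) x * Y a x) = 0"
    by (subst sum.swap) (simp add: sum_distrib_right[symmetric] minimal)
  also have "(\<Sigma> i a. sqrt (det (gram X x)) * (M a i x * partial i (Y a) x))
      = sqrt (det (gram X x)) * (\<Sigma> a. \<delta> a (Y a) x)"
    by (subst sum.swap) (simp add: tder_def sum_distrib_left)
  finally show ?thesis by simp
qed

text \<open>Minimality as a trace identity: \<open>divergence\<close> applied to a column of P,
  whose tangential part is again a gradient of an ambient coordinate.\<close>

lemma tder_proj_trace: "(\<Sigma> a. \<delta> a (P a b) x) = 0"
proof -
  have "(\<Sigma> a. M a i y * P a b y) = M b i y" for i y
    using proj_dual[of b y i] by (simp add: proj_sym[of b] mult.commute)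
  then have "sqrt (det (gram X x)) * (\<Sigma> a. \<delta> a (P a b) x) = 0"
    using divergence[of "\<lambda>a. P a b" x] minimal[of b x] by (simp add: smooth_differentiable smooth_rules)
  then show ?thesis using det_gram_nz[of x] by simp
qed

end

section \<open>Algebra of commuting shape matrices\<close>

text \<open>Six nested sums are permuted by passing to one sum over tuples, where an explicit
  bijection performs the permutation in one step.\<close>

lemma sum6_tuple:
  "(\<Sigma> a b c d e f. F a b c d e f)
    = (\<Sum>(a, b, c, d, e, f)\<in>UNIV. F a b c d e f)"
  by (simp add: sum.cartesian_product)

text \<open>The assumption \<open>comm\<close> says that the shape matrices commute, i.e. that the normal curvature vanishes.\<close>

locale shape_matrices =
  fixes h :: "'m::finite \<Rightarrow> 'n::finite \<Rightarrow> 'n \<Rightarrow> real"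
  assumes sym: "h \<alpha> i j = h \<alpha> j i"
    and tracefree: "(\<Sigma> i. h \<alpha> i i) = 0"
    and comm: "(\<Sigma> k. h \<alpha> i k * h \<beta> j k) = (\<Sigma> k. h \<alpha> j k * h \<beta> i k)"
begin

text \<open>With A_\<alpha> for the shape matrices, Q is the sum of |A_\<alpha> A_\<beta>|^2, and G
  below is the sum of the squared inner products of A_\<alpha> and A_\<beta>. Every quartic term of
  Simons' identity reduces to these two.\<close>

definition Q where "Q = (\<Sigma> \<alpha> \<beta> i j. (\<Sigma> k. h \<alpha> i k * h \<beta> j k)\<^sup>2)"

definition G where "G = (\<Sigma> \<alpha> \<beta>. (\<Sigma> i j. h \<alpha> i j * h \<beta> i j)\<^sup>2)"

lemma Q_eq: "Q = (\<Sum>(\<alpha>, \<beta>, i, j, k, l)\<in>UNIV. h \<alpha> i k * h \<beta> j k * (h \<alpha> i l * h \<beta> j l))"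
  unfolding Q_def power2_eq_square sum_product sum6_tuple[symmetric] ..

text \<open>Commutation is used in one of the two factors of each square, which crosses i and j. The
  contractions below produce Q in both shapes.\<close>

lemma Q_eq': "Q = (\<Sum>(\<alpha>, \<beta>, i, j, k, l)\<in>UNIV. h \<alpha> i k * h \<beta> j k * (h \<alpha> j l * h \<beta> i l))"
proof -
  have "Q = (\<Sigma> \<alpha> \<beta> i j. (\<Sigma> k. h \<alpha> i k * h \<beta> j k) * (\<Sigma> l. h \<alpha> j l * h \<beta> i l))"
    unfolding Q_def power2_eq_square by (subst (2) comm) simp
  then show ?thesis unfolding sum_product sum6_tuple .
qed

lemma G_eq: "G = (\<Sum>(\<alpha>, \<beta>, i, j, k, l)\<in>UNIV. h \<alpha> i j * h \<beta> i j * (h \<alpha> k l * h \<beta> k l))"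
proof -
  have "G = (\<Sigma> \<alpha> \<beta> i k j l. h \<alpha> i j * h \<beta> i j * (h \<alpha> k l * h \<beta> k l))"
    unfolding G_def power2_eq_square sum_product ..
  also have "\<dots> = (\<Sum>(\<alpha>, \<beta>, i, k, j, l)\<in>UNIV. h \<alpha> i j * h \<beta> i j * (h \<alpha> k l * h \<beta> k l))"
    unfolding sum6_tuple ..
  also have "\<dots> = (\<Sum>(\<alpha>, \<beta>, i, j, k, l)\<in>UNIV. h \<alpha> i j * h \<beta> i j * (h \<alpha> k l * h \<beta> k l))"
    by (rule sum.reindex_bij_witness[of _ "\<lambda>(\<alpha>, \<beta>, i, j, k, l). (\<alpha>, \<beta>, i, k, j, l)" "\<lambda>(\<alpha>, \<beta>, i, k, j, l). (\<alpha>, \<beta>, i, j, k, l)"]) auto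
  finally show ?thesis .
qed

lemma G_le: "G \<le> (\<Sigma> \<alpha> i j. (h \<alpha> i j)\<^sup>2)\<^sup>2"
proof -
  define s where "s \<alpha> = (\<Sigma> i j. (h \<alpha> i j)\<^sup>2)" for \<alpha>
  have "(\<Sigma> i j. h \<alpha> i j * h \<beta> i j)\<^sup>2 \<le> s \<alpha> * s \<beta>" for \<alpha> \<beta>
    using Cauchy_Schwarz_ineq_sum[of "\<lambda>(i, j). h \<alpha> i j" "\<lambda>(i, j). h \<beta> i j" UNIV]
    by (simp add: s_def sum.cartesian_product case_prod_unfold)
  then have "G \<le> (\<Sigma> \<alpha> \<beta>. s \<alpha> * s \<beta>)" unfolding G_def by (intro sum_mono)
  also have "\<dots> = (\<Sigma> \<alpha>. s \<alpha>)\<^sup>2" by (simp add: power2_eq_square sum_product)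
  finally show ?thesis by (simp add: s_def)
qed

text \<open>The right side of the Gauss equation. In this calculus it arises as the derivative of a
  commutator coefficient, see \<open>tder_tors_x0\<close>.\<close>

definition curv :: "'n \<Rightarrow> 'n \<Rightarrow> 'n \<Rightarrow> 'n \<Rightarrow> real"
  where "curv m i k l = (\<Sigma> \<gamma>. h \<gamma> m i * h \<gamma> k l - h \<gamma> m k * h \<gamma> i l)"

text \<open>\<open>cT\<close> and \<open>cN\<close> are the second derivatives at an adapted point
  of the tangent-tangent and normal-normal blocks of P. The first derivatives of these blocks vanish
  there, but P P = P forces quadratic second derivatives.\<close>

definition cT :: "'n \<Rightarrow> 'n \<Rightarrow> 'n \<Rightarrow> 'n \<Rightarrow> real"
  where "cT i j k l = - (\<Sigma> \<alpha>. h \<alpha> i k * h \<alpha> j l + h \<alpha> j k * h \<alpha> i l)"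

definition cN :: "'n \<Rightarrow> 'n \<Rightarrow> 'm \<Rightarrow> 'm \<Rightarrow> real"
  where "cN i j \<alpha> \<beta> = (\<Sigma> k. h \<alpha> i k * h \<beta> j k + h \<alpha> j k * h \<beta> i k)"

lemma sum_curv_trace: "(\<Sigma> i. curv i i k l) = - (\<Sigma> i \<gamma>. h \<gamma> i k * h \<gamma> i l)"
proof -
  have "(\<Sigma> i \<gamma>. h \<gamma> i i * h \<gamma> k l) = 0"
    by (subst sum.swap) (simp add: sum_distrib_right[symmetric] tracefree)
  then show ?thesis by (simp add: curv_def sum_subtractf)
qed

lemma sum_cT: "(\<Sigma> i j k l. (cT i j k l)\<^sup>2) = 2 * G + 2 * Q"
proof -
  define R where "R i k j l = (\<Sigma> \<alpha>. h \<alpha> i k * h \<alpha> j l)" for i k j l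
  have 1: "(\<Sigma> i j k l. (R i k j l)\<^sup>2) = G"
  proof -
    have "(\<Sigma> i j k l. (R i k j l)\<^sup>2)
        = (\<Sum>(i, j, k, l, \<alpha>, \<beta>)\<in>UNIV. h \<alpha> i k * h \<alpha> j l * (h \<beta> i k * h \<beta> j l))"
      unfolding R_def power2_eq_square sum_product sum6_tuple ..
    also have "\<dots> = G" unfolding G_eq
      by (rule sum.reindex_bij_witness[of _ "\<lambda>(\<alpha>, \<beta>, i, k, j, l). (i, j, k, l, \<alpha>, \<beta>)" "\<lambda>(i, j, k, l, \<alpha>, \<beta>). (\<alpha>, \<beta>, i, k, j, l)"])
        (auto simp: mult_ac)
    finally show ?thesis .
  qed
  have 2: "(\<Sigma> i j k l. (R j k i l)\<^sup>2) = G"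
    unfolding 1[symmetric] by (rule sum.swap)
  have 3: "(\<Sigma> i j k l. R i k j l * R j k i l) = Q"
  proof -
    have "(\<Sigma> i j k l. R i k j l * R j k i l)
        = (\<Sum>(i, j, k, l, \<alpha>, \<beta>)\<in>UNIV. h \<alpha> i k * h \<alpha> j l * (h \<beta> j k * h \<beta> i l))"
      unfolding R_def sum_product sum6_tuple ..
    also have "\<dots> = Q" unfolding Q_eq'
      by (rule sum.reindex_bij_witness[of _ "\<lambda>(\<alpha>, \<beta>, i, j, k, l). (i, j, k, l, \<alpha>, \<beta>)" "\<lambda>(i, j, k, l, \<alpha>, \<beta>). (\<alpha>, \<beta>, i, j, k, l)"])
        (auto simp: mult_ac)
    finally show ?thesis .
  qed
  have "(cT i j k l)\<^sup>2 = (R i k j l)\<^sup>2 + (R j k i l)\<^sup>2 + 2 * (R i k j l * R j k i l)" for i j k l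
    by (simp add: cT_def R_def sum.distrib power2_eq_square algebra_simps)
  then show ?thesis
    by (simp add: sum.distrib sum_distrib_left[symmetric] 1 2 3)
qed

lemma sum_cN: "(\<Sigma> i j \<alpha> \<beta>. (cN i j \<alpha> \<beta>)\<^sup>2) = 4 * Q"
proof -
  have "cN i j \<alpha> \<beta> = 2 * (\<Sigma> k. h \<alpha> i k * h \<beta> j k)" for i j \<alpha> \<beta>
    using comm[of \<alpha> i \<beta> j] by (simp add: cN_def sum.distrib)
  then have "(cN i j \<alpha> \<beta>)\<^sup>2 = 4 * (\<Sigma> k. h \<alpha> i k * h \<beta> j k)\<^sup>2" for i j \<alpha> \<beta>
    by (simp only: power_mult_distrib) simp
  then have "(\<Sigma> i j \<alpha> \<beta>. (cN i j \<alpha> \<beta>)\<^sup>2)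
      = 4 * (\<Sigma> i j \<alpha> \<beta>. (\<Sigma> k. h \<alpha> i k * h \<beta> j k)\<^sup>2)"
    by (simp only: sum_distrib_left)
  also have "(\<Sigma> i j \<alpha> \<beta>. (\<Sigma> k. h \<alpha> i k * h \<beta> j k)\<^sup>2) = Q"
    unfolding Q_def sum.cartesian_product UNIV_Times_UNIV
    by (rule sum.reindex_bij_witness[of _ "\<lambda>(\<alpha>, \<beta>, i, j). (i, j, \<alpha>, \<beta>)" "\<lambda>(i, j, \<alpha>, \<beta>). (\<alpha>, \<beta>, i, j)"]) auto
  finally show ?thesis .
qed

lemma sum_quadratic_normal:
  "(\<Sigma> i \<alpha> k \<beta>. (\<Sigma> j. h \<alpha> i j * h \<beta> j k)\<^sup>2) = Q"
  unfolding Q_def sum.cartesian_product UNIV_Times_UNIV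
  by (rule sum.reindex_bij_witness[of _ "\<lambda>(\<alpha>, \<beta>, i, k). (i, \<alpha>, k, \<beta>)" "\<lambda>(i, \<alpha>, k, \<beta>). (\<alpha>, \<beta>, i, k)"])
    (auto simp: sym)

text \<open>The bracket is the right side of \<open>third_derivatives\<close>. The Ricci type terms
  give -Q each, the full curvature term 2 (Q - G), and the two \<open>cN\<close> terms -2Q
  each.\<close>

lemma contraction:
  "(\<Sigma> \<alpha> j k. h \<alpha> j k *
      ((\<Sigma> l. (\<Sigma> i. curv i i j l) * h \<alpha> l k) + (\<Sigma> l. (\<Sigma> i. curv i i k l) * h \<alpha> j l)
        + 2 * (\<Sigma> i l. curv j i k l * h \<alpha> i l)
        - (\<Sigma> \<beta> l. h \<beta> j l * cN k l \<beta> \<alpha> + h \<beta> k l * cN j l \<beta> \<alpha>)))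
    = - 4 * Q - 2 * G" (is "?L = _")
proof -
  have 1: "(\<Sigma> \<alpha> j k. h \<alpha> j k * (\<Sigma> l. (\<Sigma> i. curv i i j l) * h \<alpha> l k)) = - Q"
  proof -
    have "(\<Sigma> \<alpha> j k. h \<alpha> j k * (\<Sigma> l. (\<Sigma> i. curv i i j l) * h \<alpha> l k))
      = - (\<Sum>(\<alpha>, j, k, l, i, \<beta>)\<in>UNIV. h \<alpha> j k * (h \<beta> i j * h \<beta> i l * h \<alpha> l k))"
      unfolding sum_curv_trace mult_minus_left mult_minus_right sum_negf sum_distrib_left sum_distrib_right sum6_tuple ..
    also have "(\<Sum>(\<alpha>, j, k, l, i, \<beta>)\<in>UNIV. h \<alpha> j k * (h \<beta> i j * h \<beta> i l * h \<alpha> l k)) = Q" unfolding Q_eq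
      by (rule sum.reindex_bij_witness[of _ "\<lambda>(\<alpha>, \<beta>, k, i, j, l). (\<alpha>, j, k, l, i, \<beta>)" "\<lambda>(\<alpha>, j, k, l, i, \<beta>). (\<alpha>, \<beta>, k, i, j, l)"])
        (auto simp: sym)
    finally show ?thesis .
  qed
  have 2: "(\<Sigma> \<alpha> j k. h \<alpha> j k * (\<Sigma> l. (\<Sigma> i. curv i i k l) * h \<alpha> j l)) = - Q"
    unfolding 1[symmetric] by (rule sum.cong[OF refl], subst sum.swap) (simp add: sym)
  have 3: "(\<Sigma> \<alpha> j k. h \<alpha> j k * (\<Sigma> i l. curv j i k l * h \<alpha> i l)) = Q - G"
  proof -
    have "(\<Sigma> \<alpha> j k. h \<alpha> j k * (\<Sigma> i l. curv j i k l * h \<alpha> i l))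
      = (\<Sum>(\<alpha>, j, k, i, l, \<beta>)\<in>UNIV. h \<alpha> j k * (h \<beta> j i * h \<beta> k l * h \<alpha> i l))
       - (\<Sum>(\<alpha>, j, k, i, l, \<beta>)\<in>UNIV. h \<alpha> j k * (h \<beta> j k * h \<beta> i l * h \<alpha> i l))"
      unfolding sum6_tuple[symmetric] curv_def sum_subtractf left_diff_distrib right_diff_distrib sum_distrib_left sum_distrib_right ..
    also have "(\<Sum>(\<alpha>, j, k, i, l, \<beta>)\<in>UNIV. h \<alpha> j k * (h \<beta> j i * h \<beta> k l * h \<alpha> i l)) = Q" unfolding Q_eq'
      by (rule sum.reindex_bij_witness[of _ "\<lambda>(\<alpha>, \<beta>, j, l, k, i). (\<alpha>, j, k, i, l, \<beta>)" "\<lambda>(\<alpha>, j, k, i, l, \<beta>). (\<alpha>, \<beta>, j, l, k, i)"])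
        (auto simp: sym)
    also have "(\<Sum>(\<alpha>, j, k, i, l, \<beta>)\<in>UNIV. h \<alpha> j k * (h \<beta> j k * h \<beta> i l * h \<alpha> i l)) = G" unfolding G_eq
      by (rule sum.reindex_bij_witness[of _ "\<lambda>(\<alpha>, \<beta>, j, k, i, l). (\<alpha>, j, k, i, l, \<beta>)" "\<lambda>(\<alpha>, j, k, i, l, \<beta>). (\<alpha>, \<beta>, j, k, i, l)"])
        (auto simp: sym)
    finally show ?thesis .
  qed
  have cN: "cN i j \<alpha> \<beta> = 2 * (\<Sigma> k. h \<alpha> i k * h \<beta> j k)" for i j \<alpha> \<beta>
    using comm[of \<alpha> i \<beta> j] by (simp add: cN_def sum.distrib)
  have 4: "(\<Sigma> \<alpha> j k. h \<alpha> j k * (\<Sigma> \<beta> l. h \<beta> j l * cN k l \<beta> \<alpha>)) = 2 * Q"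
  proof -
    have "(\<Sigma> \<alpha> j k. h \<alpha> j k * (\<Sigma> \<beta> l. h \<beta> j l * cN k l \<beta> \<alpha>))
      = (\<Sum>(\<alpha>, j, k, \<beta>, l, i)\<in>UNIV. 2 * (h \<alpha> j k * (h \<beta> j l * (h \<beta> k i * h \<alpha> l i))))"
      unfolding cN sum6_tuple[symmetric] sum_distrib_left by (simp add: mult_ac)
    also have "\<dots> = 2 * (\<Sum>(\<alpha>, j, k, \<beta>, l, i)\<in>UNIV. h \<alpha> j k * (h \<beta> j l * (h \<beta> k i * h \<alpha> l i)))"
      unfolding sum_distrib_left by (simp add: case_prod_unfold)
    also have "(\<Sum>(\<alpha>, j, k, \<beta>, l, i)\<in>UNIV. h \<alpha> j k * (h \<beta> j l * (h \<beta> k i * h \<alpha> l i))) = Q" unfolding Q_eq'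
      by (rule sum.reindex_bij_witness[of _ "\<lambda>(\<alpha>, \<beta>, j, i, k, l). (\<alpha>, j, k, \<beta>, l, i)" "\<lambda>(\<alpha>, j, k, \<beta>, l, i). (\<alpha>, \<beta>, j, i, k, l)"])
        (auto simp: sym)
    finally show ?thesis .
  qed
  have 5: "(\<Sigma> \<alpha> j k. h \<alpha> j k * (\<Sigma> \<beta> l. h \<beta> k l * cN j l \<beta> \<alpha>)) = 2 * Q"
    unfolding 4[symmetric] by (rule sum.cong[OF refl], subst sum.swap) (simp add: sym)
  have "?L = (\<Sigma> \<alpha> j k. h \<alpha> j k * (\<Sigma> l. (\<Sigma> i. curv i i j l) * h \<alpha> l k))
      + (\<Sigma> \<alpha> j k. h \<alpha> j k * (\<Sigma> l. (\<Sigma> i. curv i i k l) * h \<alpha> j l))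
      + 2 * (\<Sigma> \<alpha> j k. h \<alpha> j k * (\<Sigma> i l. curv j i k l * h \<alpha> i l))
      - (\<Sigma> \<alpha> j k. h \<alpha> j k * (\<Sigma> \<beta> l. h \<beta> j l * cN k l \<beta> \<alpha>))
      - (\<Sigma> \<alpha> j k. h \<alpha> j k * (\<Sigma> \<beta> l. h \<beta> k l * cN j l \<beta> \<alpha>))"
  proof -
    have pt: "r * (a + b + 2 * d - (\<Sigma> \<beta> l. u \<beta> l + v \<beta> l))
        = r * a + r * b + 2 * (r * d) - r * (\<Sigma> \<beta> l. u \<beta> l) - r * (\<Sigma> \<beta> l. v \<beta> l)"
      for r a b d and u v :: "'m \<Rightarrow> 'n \<Rightarrow> real"
      by (simp add: sum.distrib algebra_simps)
    show ?thesis unfolding pt by (simp add: sum.distrib sum_subtractf sum_distrib_left[of 2])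
  qed
  also have "\<dots> = - Q + - Q + 2 * (Q - G) - 2 * Q - 2 * Q" by (simp only: 1 2 3 4 5)
  finally show ?thesis by simp
qed

end

text \<open>Used for the slice in the direction of the gradient of the squared norm of the second fundamental
  form, this is the improved Kato inequality, whose sharp constant is 1 + 2/n.\<close>

lemma symmetric_tracefree_slice:
  fixes D :: "'n::finite \<Rightarrow> 'n \<Rightarrow> 'n \<Rightarrow> real"
  assumes s1: "\<And>i j k. D i j k = D j i k" and s2: "\<And>i j k. D i j k = D i k j"
    and tr: "\<And>i. (\<Sigma> j. D i j j) = 0" and card: "CARD('n) \<le> 5"
  shows "7 / 5 * (\<Sigma> j k. (D p j k)\<^sup>2) \<le> (\<Sigma> i j k. (D i j k)\<^sup>2)"
proof -
  let ?U = "UNIV - {p}"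
  \<comment> \<open>Here y, z, w collect the slice entries with none, one or both of the last two
    indices equal to p. By symmetry the other slices contain at least z + 2 y, and w <= 4 y yields
    2/5 (w + 2 z + y) <= z + 2 y.\<close>
  define y where "y = (\<Sum>i\<in>?U. \<Sum>k\<in>?U. (D p i k)\<^sup>2)"
  define z where "z = (\<Sum>i\<in>?U. (D p p i)\<^sup>2)"
  define w where "w = (D p p p)\<^sup>2"
  have split: "(\<Sigma> j. F j) = F p + (\<Sum>j\<in>?U. F j)" for F :: "'n \<Rightarrow> real"
    by (simp add: sum.remove)
  have slice: "(\<Sigma> j k. (D p j k)\<^sup>2) = w + 2 * z + y"
  proof -
    have "(\<Sum>k\<in>?U. (D p k p)\<^sup>2) = z"
      unfolding z_def by (rule sum.cong) (simp_all only: s2[of p p])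
    then show ?thesis unfolding split by (simp add: sum.distrib y_def z_def w_def)
  qed
  have "(D i p p)\<^sup>2 + 2 * (\<Sum>k\<in>?U. (D i p k)\<^sup>2) \<le> (\<Sigma> j k. (D i j k)\<^sup>2)" for i
  proof -
    have "(\<Sigma> j k. (D i j k)\<^sup>2)
        = (D i p p)\<^sup>2 + 2 * (\<Sum>k\<in>?U. (D i p k)\<^sup>2) + (\<Sum>j\<in>?U. \<Sum>k\<in>?U. (D i j k)\<^sup>2)"
    proof -
      have "(\<Sum>k\<in>?U. (D i k p)\<^sup>2) = (\<Sum>k\<in>?U. (D i p k)\<^sup>2)"
        by (rule sum.cong) (simp_all only: s2[of i p])
      then show ?thesis unfolding split by (simp add: sum.distrib)
    qed
    moreover have "0 \<le> (\<Sum>j\<in>?U. \<Sum>k\<in>?U. (D i j k)\<^sup>2)" by (intro sum_nonneg) simp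
    ultimately show ?thesis by linarith
  qed
  then have "(\<Sum>i\<in>?U. (D i p p)\<^sup>2 + 2 * (\<Sum>k\<in>?U. (D i p k)\<^sup>2)) \<le> (\<Sum>i\<in>?U. \<Sigma> j k. (D i j k)\<^sup>2)"
    by (rule sum_mono)
  moreover have "(\<Sum>i\<in>?U. (D i p p)\<^sup>2 + 2 * (\<Sum>k\<in>?U. (D i p k)\<^sup>2)) = z + 2 * y"
  proof -
    have "(\<Sum>i\<in>?U. (D i p p)\<^sup>2) = z"
    proof -
      have "D i p p = D p p i" for i by (metis s1 s2)
      then show ?thesis by (simp only: z_def)
    qed
    moreover have "(\<Sum>i\<in>?U. 2 * (\<Sum>k\<in>?U. (D i p k)\<^sup>2)) = 2 * y"
    proof -
      have "D i p k = D p i k" for i k by (rule s1)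
      then show ?thesis by (simp only: y_def sum_distrib_left)
    qed
    ultimately show ?thesis by (simp add: sum.distrib)
  qed
  moreover have "(\<Sigma> i j k. (D i j k)\<^sup>2)
      = (\<Sigma> j k. (D p j k)\<^sup>2) + (\<Sum>i\<in>?U. \<Sigma> j k. (D i j k)\<^sup>2)"
    by (rule split)
  \<comment> \<open>Trace-freeness makes \<open>D p p p\<close> minus a sum of at most four other
    diagonal entries; this is where the dimension bound is used.\<close>
  moreover have "w \<le> 4 * y"
  proof -
    have "D p p p = - (\<Sum>j\<in>?U. D p j j)" using tr[of p] split[of "\<lambda>j. D p j j"] by simp
    then have "w = (\<Sum>j\<in>?U. D p j j * 1)\<^sup>2" by (simp add: w_def)
    also have "\<dots> \<le> (\<Sum>j\<in>?U. (D p j j)\<^sup>2) * (\<Sum>j\<in>?U. 1\<^sup>2)" by (rule Cauchy_Schwarz_ineq_sum)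
    also have "\<dots> \<le> (\<Sum>j\<in>?U. (D p j j)\<^sup>2) * 4"
      using card by (intro mult_left_mono sum_nonneg) (auto simp: card_Diff_singleton)
    also have "(\<Sum>j\<in>?U. (D p j j)\<^sup>2) \<le> y"
      unfolding y_def by (intro sum_mono) (auto intro: member_le_sum[of _ ?U "\<lambda>k. (D p _ k)\<^sup>2"])
    finally show ?thesis by simp
  qed
  moreover have "z \<ge> 0" unfolding z_def by (intro sum_nonneg) simp
  ultimately show ?thesis unfolding slice by argo
qed

section \<open>Computations in an adapted frame\<close>

lemma sum_UNIV_Plus:
  "(\<Sigma> A. F A) = (\<Sigma> i. F (Inl i)) + (\<Sigma> \<alpha>. F (Inr \<alpha>))"
  for F :: "'n::finite + 'm::finite \<Rightarrow> real"
  by (subst UNIV_Plus_UNIV[symmetric], subst sum.Plus) simp_all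

lemma sum_delta_mult:
  fixes F :: "'n::finite \<Rightarrow> real"
  shows "(\<Sigma> j. F j * (if j = k then 1 else 0)) = F k"
    "(\<Sigma> j. F j * (if k = j then 1 else 0)) = F k"
    "(\<Sigma> j. (if j = k then 1 else 0) * F j) = F k"
    "(\<Sigma> j. (if k = j then 1 else 0) * F j) = F k"
  by (simp_all add: if_distrib[of "\<lambda>z. _ * z"] if_distrib[of "\<lambda>z. z * _"] cong: if_cong)

lemma tder_cong: "u = v \<Longrightarrow> tder X a u x = tder X a v x"
  by simp

context minimal_graph
begin

text \<open>The Leibniz rule for P P = P. At an adapted point it kills the two diagonal blocks of
  the derivative of P, leaving the mixed blocks that form the second fundamental form.\<close>

lemma tder_idem:
  "\<delta> a (P b d) x = (\<Sigma> e. \<delta> a (P b e) x * P e d x) + (\<Sigma> e. P b e x * \<delta> a (P e d) x)"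
proof -
  have "P b d = (\<lambda>x. \<Sigma> e. P b e x * P e d x)" by (simp add: proj_idem fun_eq_iff)
  then have "\<delta> a (P b d) x = \<delta> a (\<lambda>x. \<Sigma> e. P b e x * P e d x) x" by (rule tder_cong)
  also have "\<dots> = (\<Sigma> e. \<delta> a (P b e) x * P e d x + P b e x * \<delta> a (P e d) x)"
    by (simp add: tder_sum tder_mult smooth_rules)
  finally show ?thesis by (simp add: sum.distrib)
qed

lemma tder_tder_idem:
  "\<delta> f (\<delta> a (P b d)) x
    = (\<Sigma> e. \<delta> f (\<delta> a (P b e)) x * P e d x) + (\<Sigma> e. \<delta> a (P b e) x * \<delta> f (P e d) x)
      + (\<Sigma> e. \<delta> f (P b e) x * \<delta> a (P e d) x) + (\<Sigma> e. P b e x * \<delta> f (\<delta> a (P e d)) x)"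
proof -
  have "\<delta> a (P b d) = (\<lambda>x. (\<Sigma> e. \<delta> a (P b e) x * P e d x) + (\<Sigma> e. P b e x * \<delta> a (P e d) x))"
    by (rule ext) (rule tder_idem)
  then have "\<delta> f (\<delta> a (P b d)) x = \<delta> f (\<lambda>x. (\<Sigma> e. \<delta> a (P b e) x * P e d x) + (\<Sigma> e. P b e x * \<delta> a (P e d) x)) x"
    by (rule tder_cong)
  then show ?thesis
    by (simp add: tder_add tder_sum tder_mult smooth_rules sum.distrib)
qed

text \<open>The coefficients of the commutator in \<open>tder_commute\<close>. They are named
  because their derivatives, which carry the curvature, occur in all third order
  computations.\<close>

definition tors :: "'a \<Rightarrow> 'a \<Rightarrow> 'a \<Rightarrow> real^'n \<Rightarrow> real"
  where "tors a b d x = \<delta> a (P b d) x - \<delta> b (P a d) x"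

lemma smooth_tors: "smooth (tors a b d)"
  unfolding tors_def[abs_def] by (intro smooth_rules)

lemma tder_tors: "\<delta> e (tors a b d) x = \<delta> e (\<delta> a (P b d)) x - \<delta> e (\<delta> b (P a d)) x"
  by (simp add: tors_def[abs_def] tder_diff smooth_rules)

lemma tder_commute_fun:
  assumes "smooth u"
  shows "\<delta> a (\<delta> b u) = (\<lambda>x. \<delta> b (\<delta> a u) x + (\<Sigma> d. tors a b d x * \<delta> d u x))"
  unfolding tors_def by (rule ext) (rule tder_commute[OF assms])

text \<open>P is the gradient of the ambient coordinates, so exchanging a and b is the commutation
  rule for \<open>X e\<close>. Its value at an adapted point gives the symmetry of h, its derivative
  the Codazzi equation.\<close>

lemma codazzi_fun:
  "\<delta> a (P b e) = (\<lambda>x. \<delta> b (P a e) x + (\<Sigma> d. tors a b d x * P d e x))"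
  unfolding proj_def by (rule tder_commute_fun[OF smooth_X])

lemma tder_sqnorm_A:
  "\<delta> a (sqnorm_A X) x = (\<Sigma> b d e. \<delta> b (P d e) x * \<delta> a (\<delta> b (P d e)) x)"
proof -
  have eq: "sqnorm_A X = (\<lambda>x. 1/2 * (\<Sigma> b d e. \<delta> b (P d e) x * \<delta> b (P d e) x))"
    by (simp add: sqnorm_A_def fun_eq_iff power2_eq_square)
  have "\<delta> a (sqnorm_A X) x = 1/2 * (\<Sigma> b d e. 2 * (\<delta> b (P d e) x * \<delta> a (\<delta> b (P d e)) x))"
    unfolding eq by (subst tder_cmult, intro smooth_rules) (simp add: tder_sum tder_mult smooth_rules mult.commute)
  then show ?thesis by (simp add: sum_distrib_left)
qed

lemma tder_tder_sqnorm_A: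
  "\<delta> a (\<delta> a (sqnorm_A X)) x = (\<Sigma> b d e.
      (\<delta> a (\<delta> b (P d e)) x)\<^sup>2 + \<delta> b (P d e) x * \<delta> a (\<delta> a (\<delta> b (P d e))) x)"
proof -
  have d1: "\<delta> a (sqnorm_A X) = (\<lambda>x. \<Sigma> b d e. \<delta> b (P d e) x * \<delta> a (\<delta> b (P d e)) x)"
    by (rule ext) (rule tder_sqnorm_A)
  show ?thesis unfolding d1 by (simp add: tder_sum tder_mult smooth_rules power2_eq_square)
qed

end

text \<open>Only the value of P at \<open>x0\<close> is normalised. No frame is extended to a
  neighbourhood; the derivatives of P at \<open>x0\<close> carry the geometry.\<close>

locale adapted_graph = minimal_graph X c
  for X :: "'n::finite + 'm::finite \<Rightarrow> real^'n \<Rightarrow> real" and c +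
  fixes x0 :: "real^'n"
  assumes adapted: "\<And>A B. proj X A B x0 = (if A = B \<and> isl A then 1 else 0)"
begin

abbreviation "\<delta>t i \<equiv> \<delta> (Inl i)"

lemma proj_x0 [simp]:
  "P (Inl i) (Inl j) x0 = (if i = j then 1 else 0)" "P (Inl i) (Inr \<alpha>) x0 = 0" "P (Inr \<alpha>) B x0 = 0"
  by (simp_all add: adapted)

lemma tder_normal [simp]: "\<delta> (Inr \<alpha>) u x0 = 0"
  using proj_tder[of "Inr \<alpha>" x0 u] by simp

definition h :: "'m \<Rightarrow> 'n \<Rightarrow> 'n \<Rightarrow> real"
  where "h \<alpha> i j = \<delta>t i (P (Inl j) (Inr \<alpha>)) x0"

lemma tder_proj_TT [simp]: "\<delta>t i (P (Inl j) (Inl k)) x0 = 0"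
  using tder_idem[of "Inl i" "Inl j" "Inl k" x0] by (simp add: sum_UNIV_Plus sum_delta_mult)

lemma tder_proj_NN [simp]: "\<delta>t i (P (Inr \<alpha>) (Inr \<beta>)) x0 = 0"
  using tder_idem[of "Inl i" "Inr \<alpha>" "Inr \<beta>" x0] by (simp add: sum_UNIV_Plus)

lemma tder_proj_TN [simp]: "\<delta>t i (P (Inl j) (Inr \<alpha>)) x0 = h \<alpha> i j"
  by (simp add: h_def)

lemma tder_proj_NT [simp]: "\<delta>t i (P (Inr \<alpha>) (Inl j)) x0 = h \<alpha> i j"
  by (simp only: h_def proj_sym_fun[of "Inr \<alpha>" "Inl j"])

lemma h_sym: "h \<alpha> i j = h \<alpha> j i"
  using codazzi_fun[of "Inl i" "Inl j" "Inr \<alpha>", THEN fun_cong, of x0]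
  by (simp add: sum_UNIV_Plus tors_def)

lemma h_trace: "(\<Sigma> i. h \<alpha> i i) = 0"
  using tder_proj_trace[of "Inr \<alpha>" x0] by (simp add: sum_UNIV_Plus)

text \<open>Operators in normal directions vanish at \<open>x0\<close> but not nearby:
  differentiating \<open>proj_tder\<close> shows that they tilt into the tangent space at the rate
  h.\<close>

lemma tder_tder_normal:
  assumes "smooth u"
  shows "\<delta>t i (\<delta> (Inr \<alpha>) u) x0 = (\<Sigma> j. h \<alpha> i j * \<delta>t j u x0)"
proof -
  have "\<delta> (Inr \<alpha>) u = (\<lambda>x. \<Sigma> B. P (Inr \<alpha>) B x * \<delta> B u x)" by (rule ext) (rule proj_tder[symmetric])
  then have "\<delta>t i (\<delta> (Inr \<alpha>) u) x0 = \<delta>t i (\<lambda>x. \<Sigma> B. P (Inr \<alpha>) B x * \<delta> B u x) x0" by (rule tder_cong)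
  also have "\<dots> = (\<Sigma> B. \<delta>t i (P (Inr \<alpha>) B) x0 * \<delta> B u x0)"
    using assms by (simp add: tder_sum tder_mult smooth_rules)
  finally show ?thesis by (simp add: sum_UNIV_Plus)
qed

lemma tors_x0 [simp]: "tors (Inl i) (Inl j) d x0 = 0"
  by (cases d) (simp_all add: tors_def h_sym)

text \<open>The covariant derivative of the second fundamental form. No connection terms occur,
  because a single derivative cannot change the type of two slots at once.\<close>

definition D :: "'m \<Rightarrow> 'n \<Rightarrow> 'n \<Rightarrow> 'n \<Rightarrow> real"
  where "D \<alpha> i j k = \<delta>t i (\<delta>t j (P (Inl k) (Inr \<alpha>))) x0"

lemma tder2_proj_TN [simp]: "\<delta>t i (\<delta>t j (P (Inl k) (Inr \<alpha>))) x0 = D \<alpha> i j k"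
  by (simp add: D_def)

lemma tder2_proj_NT [simp]: "\<delta>t i (\<delta>t j (P (Inr \<alpha>) (Inl k))) x0 = D \<alpha> i j k"
  by (simp only: D_def proj_sym_fun[of "Inr \<alpha>" "Inl k"])

lemma tder2_proj_TT:
  "\<delta>t i (\<delta>t j (P (Inl k) (Inl l))) x0 = - (\<Sigma> \<alpha>. h \<alpha> i k * h \<alpha> j l + h \<alpha> j k * h \<alpha> i l)"
  using tder_tder_idem[of "Inl i" "Inl j" "Inl k" "Inl l" x0]
  by (simp add: sum_UNIV_Plus sum_delta_mult sum.distrib)

lemma tder2_proj_NN:
  "\<delta>t i (\<delta>t j (P (Inr \<alpha>) (Inr \<beta>))) x0 = (\<Sigma> k. h \<alpha> i k * h \<beta> j k + h \<alpha> j k * h \<beta> i k)"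
  using tder_tder_idem[of "Inl i" "Inl j" "Inr \<alpha>" "Inr \<beta>" x0]
  by (simp add: sum_UNIV_Plus sum.distrib)

lemma tder_tder_commute_x0:
  "smooth u \<Longrightarrow> \<delta>t i (\<delta>t j u) x0 = \<delta>t j (\<delta>t i u) x0"
  using tder_commute_fun[of u "Inl i" "Inl j", THEN fun_cong, of x0] by simp

lemma D_sym1: "D \<alpha> i j k = D \<alpha> j i k"
  unfolding D_def by (intro tder_tder_commute_x0 smooth_rules)

lemma tder_codazzi_x0:
  "\<delta> e (\<delta>t j (P (Inl k) B)) x0 = \<delta> e (\<delta>t k (P (Inl j) B)) x0
    + (\<Sigma> d. \<delta> e (tors (Inl j) (Inl k) d) x0 * P d B x0)"
proof -
  have "\<delta> e (\<delta>t j (P (Inl k) B)) x0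
      = \<delta> e (\<lambda>x. \<delta>t k (P (Inl j) B) x + (\<Sigma> d. tors (Inl j) (Inl k) d x * P d B x)) x0"
    by (rule tder_cong[OF codazzi_fun])
  then show ?thesis
    by (simp add: tder_add tder_sum tder_mult smooth_rules smooth_tors)
qed

lemma D_sym2: "D \<alpha> i j k = D \<alpha> i k j"
  using tder_codazzi_x0[of "Inl i" j k "Inr \<alpha>"] by (simp add: adapted sum_UNIV_Plus)

lemma D_trace: "(\<Sigma> j. D \<alpha> i j j) = 0"
proof -
  have "(\<lambda>x. \<Sigma> a. \<delta> a (P a (Inr \<alpha>)) x) = (\<lambda>_. 0)" using tder_proj_trace by auto
  then have "\<delta>t i (\<lambda>x. \<Sigma> a. \<delta> a (P a (Inr \<alpha>)) x) x0 = 0" by (simp add: tder_const)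
  then have "(\<Sigma> a. \<delta>t i (\<delta> a (P a (Inr \<alpha>))) x0) = 0" by (simp only: tder_sum smooth_rules)
  then show ?thesis
    by (simp add: smooth_rules sum_UNIV_Plus tder_tder_normal)
qed

text \<open>The Gauss equation: the commutator coefficients vanish at \<open>x0\<close>, and their
  derivatives come from the tangent-tangent block of the second derivatives of P.\<close>

lemma tder_tors_x0:
  "\<delta>t m (tors (Inl i) (Inl k) (Inl l)) x0 = (\<Sigma> \<gamma>. h \<gamma> m i * h \<gamma> k l - h \<gamma> m k * h \<gamma> i l)"
  by (simp add: tder_tors tder2_proj_TT sum.distrib sum_subtractf algebra_simps h_sym[of _ k i])

section \<open>Third derivatives of the projection and Simons' identity\<close>

lemma third_commute:
  assumes "smooth u"
  shows "\<delta>t m (\<delta>t i (\<delta>t j u)) x0 = \<delta>t m (\<delta>t j (\<delta>t i u)) x0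
    + (\<Sigma> l. \<delta>t m (tors (Inl i) (Inl j) (Inl l)) x0 * \<delta>t l u x0)"
proof -
  have "\<delta>t m (\<delta>t i (\<delta>t j u)) x0 = \<delta>t m (\<lambda>x. \<delta>t j (\<delta>t i u) x + (\<Sigma> d. tors (Inl i) (Inl j) d x * \<delta> d u x)) x0"
    by (rule tder_cong[OF tder_commute_fun[OF assms]])
  then show ?thesis using assms
    by (simp add: tder_add tder_sum tder_mult smooth_rules smooth_tors sum_UNIV_Plus)
qed

lemma third_codazzi:
  "\<delta>t m (\<delta>t j (\<delta>t i (P (Inl k) (Inr \<alpha>)))) x0 = \<delta>t m (\<delta>t j (\<delta>t k (P (Inl i) (Inr \<alpha>)))) x0
    + (\<Sigma> l. \<delta>t m (tors (Inl i) (Inl k) (Inl l)) x0 * h \<alpha> j l)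
    + (\<Sigma> l. \<delta>t j (tors (Inl i) (Inl k) (Inl l)) x0 * h \<alpha> m l)"
proof -
  have "\<delta>t j (\<delta>t i (P (Inl k) (Inr \<alpha>))) = (\<lambda>x. \<delta>t j (\<delta>t k (P (Inl i) (Inr \<alpha>))) x
      + (\<Sigma> d. \<delta>t j (tors (Inl i) (Inl k) d) x * P d (Inr \<alpha>) x + tors (Inl i) (Inl k) d x * \<delta>t j (P d (Inr \<alpha>)) x))"
  proof
    fix x
    have "\<delta>t j (\<delta>t i (P (Inl k) (Inr \<alpha>))) x = \<delta>t j (\<lambda>x. \<delta>t k (P (Inl i) (Inr \<alpha>)) x
      + (\<Sigma> d. tors (Inl i) (Inl k) d x * P d (Inr \<alpha>) x)) x"
      by (rule tder_cong[OF codazzi_fun])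
    then show "\<delta>t j (\<delta>t i (P (Inl k) (Inr \<alpha>))) x = \<delta>t j (\<delta>t k (P (Inl i) (Inr \<alpha>))) x
      + (\<Sigma> d. \<delta>t j (tors (Inl i) (Inl k) d) x * P d (Inr \<alpha>) x + tors (Inl i) (Inl k) d x * \<delta>t j (P d (Inr \<alpha>)) x)"
      by (simp add: tder_add tder_sum tder_mult smooth_rules smooth_tors)
  qed
  then have "\<delta>t m (\<delta>t j (\<delta>t i (P (Inl k) (Inr \<alpha>)))) x0 = \<delta>t m (\<lambda>x. \<delta>t j (\<delta>t k (P (Inl i) (Inr \<alpha>))) x
      + (\<Sigma> d. \<delta>t j (tors (Inl i) (Inl k) d) x * P d (Inr \<alpha>) x + tors (Inl i) (Inl k) d x * \<delta>t j (P d (Inr \<alpha>)) x)) x0"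
    by (rule tder_cong)
  then show ?thesis
    by (simp add: tder_add tder_sum tder_mult smooth_rules smooth_tors sum_UNIV_Plus sum.distrib)
qed

text \<open>By minimality the trace over all ambient indices vanishes, but its tangential part alone
  does not: the normal summands tilt as in \<open>tder_tder_normal\<close> and contribute h times
  second derivatives of the normal-normal block.\<close>

lemma third_trace:
  "(\<Sigma> i. \<delta>t j (\<delta>t k (\<delta>t i (P (Inl i) (Inr \<alpha>)))) x0)
    = - (\<Sigma> \<beta> l. h \<beta> j l * \<delta>t k (\<delta>t l (P (Inr \<beta>) (Inr \<alpha>))) x0
          + h \<beta> k l * \<delta>t j (\<delta>t l (P (Inr \<beta>) (Inr \<alpha>))) x0)"
proof -
  have normal: "\<delta>t j (\<delta>t k (\<delta> (Inr \<beta>) (P (Inr \<beta>) (Inr \<alpha>)))) x0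
      = (\<Sigma> l. h \<beta> j l * \<delta>t k (\<delta>t l (P (Inr \<beta>) (Inr \<alpha>))) x0
          + h \<beta> k l * \<delta>t j (\<delta>t l (P (Inr \<beta>) (Inr \<alpha>))) x0)" for \<beta>
  proof -
    let ?v = "P (Inr \<beta>) (Inr \<alpha>)"
    have "\<delta> (Inr \<beta>) ?v = (\<lambda>x. \<Sigma> B. P (Inr \<beta>) B x * \<delta> B ?v x)" by (rule ext) (rule proj_tder[symmetric])
    then have "\<delta>t k (\<delta> (Inr \<beta>) ?v) = \<delta>t k (\<lambda>x. \<Sigma> B. P (Inr \<beta>) B x * \<delta> B ?v x)" by (rule arg_cong)
    also have "\<dots> = (\<lambda>x. \<Sigma> B. \<delta>t k (P (Inr \<beta>) B) x * \<delta> B ?v x + P (Inr \<beta>) B x * \<delta>t k (\<delta> B ?v) x)"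
      by (rule ext) (simp add: tder_sum tder_mult smooth_rules)
    finally have "\<delta>t j (\<delta>t k (\<delta> (Inr \<beta>) ?v)) x0
      = \<delta>t j (\<lambda>x. \<Sigma> B. \<delta>t k (P (Inr \<beta>) B) x * \<delta> B ?v x + P (Inr \<beta>) B x * \<delta>t k (\<delta> B ?v) x) x0" by (rule tder_cong)
    also have "\<dots> = (\<Sigma> B. \<delta>t j (\<delta>t k (P (Inr \<beta>) B)) x0 * \<delta> B ?v x0 + \<delta>t k (P (Inr \<beta>) B) x0 * \<delta>t j (\<delta> B ?v) x0
        + \<delta>t j (P (Inr \<beta>) B) x0 * \<delta>t k (\<delta> B ?v) x0)"
      by (simp add: tder_add tder_sum tder_mult smooth_rules add.assoc)
    finally show ?thesis by (simp add: sum_UNIV_Plus add.commute)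
  qed
  have "(\<lambda>x. \<Sigma> a. \<delta> a (P a (Inr \<alpha>)) x) = (\<lambda>_. 0)" using tder_proj_trace by auto
  then have "\<delta>t k (\<lambda>x. \<Sigma> a. \<delta> a (P a (Inr \<alpha>)) x) = (\<lambda>_. 0)" by (simp add: tder_const fun_eq_iff)
  moreover have "\<delta>t k (\<lambda>x. \<Sigma> a. \<delta> a (P a (Inr \<alpha>)) x) = (\<lambda>x. \<Sigma> a. \<delta>t k (\<delta> a (P a (Inr \<alpha>))) x)"
    by (rule ext) (simp add: tder_sum smooth_rules)
  ultimately have "\<delta>t j (\<lambda>x. \<Sigma> a. \<delta>t k (\<delta> a (P a (Inr \<alpha>))) x) x0 = 0" by (simp add: tder_const)
  then have "(\<Sigma> a. \<delta>t j (\<delta>t k (\<delta> a (P a (Inr \<alpha>)))) x0) = 0" by (simp only: tder_sum smooth_rules)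
  then show ?thesis
    by (simp add: sum_UNIV_Plus normal)
qed

lemma laplace_x0: "laplace X u x0 = (\<Sigma> i. \<delta>t i (\<delta>t i u) x0)"
  by (simp add: laplace_def sum_UNIV_Plus)

lemma sqnorm_A_x0: "sqnorm_A X x0 = (\<Sigma> \<alpha> i j. (h \<alpha> i j)\<^sup>2)"
proof -
  have "(\<Sigma> i j \<alpha>. (h \<alpha> i j)\<^sup>2) = (\<Sigma> \<alpha> i j. (h \<alpha> i j)\<^sup>2)"
    by (rule sum_swap3)
  moreover have "(\<Sigma> i \<alpha> j. (h \<alpha> i j)\<^sup>2) = (\<Sigma> \<alpha> i j. (h \<alpha> i j)\<^sup>2)"
    by (rule sum.swap)
  ultimately show ?thesis by (simp add: sqnorm_A_def sum_UNIV_Plus sum.distrib)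
qed

lemma tder_sqnorm_A_x0:
  "\<delta>t i (sqnorm_A X) x0 = 2 * (\<Sigma> \<alpha> j k. h \<alpha> j k * D \<alpha> i j k)"
proof -
  have "(\<Sigma> j k \<alpha>. h \<alpha> j k * D \<alpha> i j k) = (\<Sigma> \<alpha> j k. h \<alpha> j k * D \<alpha> i j k)"
    by (rule sum_swap3)
  moreover have "(\<Sigma> j \<alpha> k. h \<alpha> j k * D \<alpha> i j k) = (\<Sigma> \<alpha> j k. h \<alpha> j k * D \<alpha> i j k)"
    by (rule sum.swap)
  ultimately show ?thesis by (simp add: tder_sqnorm_A sum_UNIV_Plus sum.distrib)
qed

end

locale flat_adapted_graph = adapted_graph X c x0
  for X :: "'n::finite + 'm::finite \<Rightarrow> real^'n \<Rightarrow> real" and c x0 +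
  assumes flat: "\<And>\<alpha> \<beta> i j. (\<Sigma> k. h \<alpha> i k * h \<beta> j k) = (\<Sigma> k. h \<alpha> j k * h \<beta> i k)"
begin

sublocale shape: shape_matrices h
  by unfold_locales (fact h_sym h_trace flat)+

lemma tder2_proj_TT_cT: "\<delta>t i (\<delta>t j (P (Inl k) (Inl l))) x0 = shape.cT i j k l"
  by (simp add: tder2_proj_TT shape.cT_def)

lemma tder2_proj_NN_cN: "\<delta>t i (\<delta>t j (P (Inr \<alpha>) (Inr \<beta>))) x0 = shape.cN i j \<alpha> \<beta>"
  by (simp add: tder2_proj_NN shape.cN_def)

lemma tder_tors_curv: "\<delta>t m (tors (Inl i) (Inl k) (Inl l)) x0 = shape.curv m i k l"
  by (simp add: tder_tors_x0 shape.curv_def)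

text \<open>Simons' commutation. The repeated index i is moved inwards until the trace stands
  innermost and \<open>third_trace\<close> applies. Exchanging the two outermost derivatives is free
  at \<open>x0\<close>; every other exchange costs curvature terms.\<close>

lemma third_derivatives:
  "(\<Sigma> i. \<delta>t i (\<delta>t i (\<delta>t j (P (Inl k) (Inr \<alpha>)))) x0)
    = (\<Sigma> l. (\<Sigma> i. shape.curv i i j l) * h \<alpha> l k) + (\<Sigma> l. (\<Sigma> i. shape.curv i i k l) * h \<alpha> j l)
        + 2 * (\<Sigma> i l. shape.curv j i k l * h \<alpha> i l)
        - (\<Sigma> \<beta> l. h \<beta> j l * shape.cN k l \<beta> \<alpha> + h \<beta> k l * shape.cN j l \<beta> \<alpha>)"
proof -
  have "\<delta>t i (\<delta>t i (\<delta>t j (P (Inl k) (Inr \<alpha>)))) x0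
      = \<delta>t j (\<delta>t k (\<delta>t i (P (Inl i) (Inr \<alpha>)))) x0
        + (\<Sigma> l. shape.curv i i j l * h \<alpha> l k) + (\<Sigma> l. shape.curv i i k l * h \<alpha> j l)
        + 2 * (\<Sigma> l. shape.curv j i k l * h \<alpha> i l)" for i
  proof -
    have 1: "\<delta>t i (\<delta>t i (\<delta>t j (P (Inl k) (Inr \<alpha>)))) x0 = \<delta>t i (\<delta>t j (\<delta>t i (P (Inl k) (Inr \<alpha>)))) x0
        + (\<Sigma> l. shape.curv i i j l * h \<alpha> l k)"
      using third_commute[OF smooth_proj, of i i j "Inl k" "Inr \<alpha>"] by (simp add: tder_tors_curv)
    have 2: "\<delta>t i (\<delta>t j (\<delta>t i (P (Inl k) (Inr \<alpha>)))) x0 = \<delta>t i (\<delta>t j (\<delta>t k (P (Inl i) (Inr \<alpha>)))) x0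
        + (\<Sigma> l. shape.curv i i k l * h \<alpha> j l) + (\<Sigma> l. shape.curv j i k l * h \<alpha> i l)"
      using third_codazzi[of i j i k \<alpha>] by (simp add: tder_tors_curv)
    have 3: "\<delta>t i (\<delta>t j (\<delta>t k (P (Inl i) (Inr \<alpha>)))) x0 = \<delta>t j (\<delta>t i (\<delta>t k (P (Inl i) (Inr \<alpha>)))) x0"
      by (intro tder_tder_commute_x0 smooth_rules)
    have 4: "\<delta>t j (\<delta>t i (\<delta>t k (P (Inl i) (Inr \<alpha>)))) x0 = \<delta>t j (\<delta>t k (\<delta>t i (P (Inl i) (Inr \<alpha>)))) x0
        + (\<Sigma> l. shape.curv j i k l * h \<alpha> i l)"
      using third_commute[OF smooth_proj, of j i k "Inl i" "Inr \<alpha>"] by (simp add: tder_tors_curv h_sym[of _ i])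
    show ?thesis using 1 2 3 4 by simp
  qed
  then have "(\<Sigma> i. \<delta>t i (\<delta>t i (\<delta>t j (P (Inl k) (Inr \<alpha>)))) x0)
      = (\<Sigma> i. \<delta>t j (\<delta>t k (\<delta>t i (P (Inl i) (Inr \<alpha>)))) x0)
        + (\<Sigma> i l. shape.curv i i j l * h \<alpha> l k) + (\<Sigma> i l. shape.curv i i k l * h \<alpha> j l)
        + 2 * (\<Sigma> i l. shape.curv j i k l * h \<alpha> i l)"
    by (simp only: sum.distrib sum_distrib_left)
  moreover have "(\<Sigma> i l. shape.curv i i j l * h \<alpha> l k) = (\<Sigma> l. (\<Sigma> i. shape.curv i i j l) * h \<alpha> l k)"
    by (subst sum.swap) (simp only: sum_distrib_right)
  moreover have "(\<Sigma> i l. shape.curv i i k l * h \<alpha> j l) = (\<Sigma> l. (\<Sigma> i. shape.curv i i k l) * h \<alpha> j l)"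
    by (subst sum.swap) (simp only: sum_distrib_right)
  moreover have "(\<Sigma> i. \<delta>t j (\<delta>t k (\<delta>t i (P (Inl i) (Inr \<alpha>)))) x0)
      = - (\<Sigma> \<beta> l. h \<beta> j l * shape.cN k l \<beta> \<alpha> + h \<beta> k l * shape.cN j l \<beta> \<alpha>)"
    unfolding third_trace tder2_proj_NN_cN ..
  ultimately show ?thesis by simp
qed

definition D_sq :: real
  where "D_sq = (\<Sigma> \<alpha> i j k. (D \<alpha> i j k)\<^sup>2)"

text \<open>The Q terms cancel: the squares of second derivatives supply 2Q from \<open>cT\<close>,
  4Q from \<open>cN\<close> and 2Q from the tilting normal operators, against -8Q from the third
  derivatives. For G, the 2G of \<open>cT\<close> meets -4G.\<close>

lemma laplace_sqnorm_A: "laplace X (sqnorm_A X) x0 = 2 * D_sq - 2 * shape.G"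
proof -
  define E where "E i j k \<alpha> = \<delta>t i (\<delta>t i (\<delta>t j (P (Inl k) (Inr \<alpha>)))) x0" for i j k \<alpha>
  have E': "\<delta>t i (\<delta>t i (\<delta>t j (P (Inr \<alpha>) (Inl k)))) x0 = E i j k \<alpha>" for i j k \<alpha>
    by (simp only: E_def proj_sym_fun[of "Inr \<alpha>" "Inl k"])
  have normal: "(\<Sigma> \<alpha> d e. (\<delta>t i (\<delta> (Inr \<alpha>) (P d e)) x0)\<^sup>2)
      = 2 * (\<Sigma> \<alpha> k \<beta>. (\<Sigma> j. h \<alpha> i j * h \<beta> j k)\<^sup>2)" for i
  proof -
    have "(\<Sigma> \<alpha> \<beta> k. (\<Sigma> j. h \<alpha> i j * h \<beta> j k)\<^sup>2)
        = (\<Sigma> \<alpha> k \<beta>. (\<Sigma> j. h \<alpha> i j * h \<beta> j k)\<^sup>2)"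
      by (rule sum.cong[OF refl], rule sum.swap)
    then show ?thesis
      by (simp add: tder_tder_normal smooth_proj sum_UNIV_Plus sum.distrib)
  qed
  have tangential: "(\<Sigma> d e. (\<delta>t i (\<delta>t j (P d e)) x0)\<^sup>2 + \<delta>t j (P d e) x0 * \<delta>t i (\<delta>t i (\<delta>t j (P d e))) x0)
      = (\<Sigma> k l. (shape.cT i j k l)\<^sup>2) + (\<Sigma> \<alpha> \<beta>. (shape.cN i j \<alpha> \<beta>)\<^sup>2)
        + 2 * (\<Sigma> \<alpha> k. (D \<alpha> i j k)\<^sup>2) + 2 * (\<Sigma> \<alpha> k. h \<alpha> j k * E i j k \<alpha>)" for i j
  proof -
    have s: "(\<Sigma> k \<alpha>. F k \<alpha>) = (\<Sigma> \<alpha> k. F k \<alpha>)" for F :: "'n \<Rightarrow> 'm \<Rightarrow> real"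
      by (rule sum.swap)
    show ?thesis
      by (simp add: sum_UNIV_Plus sum.distrib tder2_proj_TT_cT tder2_proj_NN_cN E' E_def[symmetric] s[of "\<lambda>k \<alpha>. (D \<alpha> i j k)\<^sup>2"]
          s[of "\<lambda>k \<alpha>. h \<alpha> j k * E i j k \<alpha>"])
  qed
  have "laplace X (sqnorm_A X) x0
      = (\<Sigma> i. (\<Sigma> j. (\<Sigma> d e. (\<delta>t i (\<delta>t j (P d e)) x0)\<^sup>2 + \<delta>t j (P d e) x0 * \<delta>t i (\<delta>t i (\<delta>t j (P d e))) x0))
          + (\<Sigma> \<alpha> d e. (\<delta>t i (\<delta> (Inr \<alpha>) (P d e)) x0)\<^sup>2))"
    unfolding laplace_x0 tder_tder_sqnorm_A sum_UNIV_Plus[of "\<lambda>b. \<Sigma> d e. _ b d e"]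
    by simp
  also have "\<dots> = (\<Sigma> i j k l. (shape.cT i j k l)\<^sup>2)
      + (\<Sigma> i j \<alpha> \<beta>. (shape.cN i j \<alpha> \<beta>)\<^sup>2)
      + 2 * (\<Sigma> i j \<alpha> k. (D \<alpha> i j k)\<^sup>2)
      + 2 * (\<Sigma> i j \<alpha> k. h \<alpha> j k * E i j k \<alpha>)
      + 2 * (\<Sigma> i \<alpha> k \<beta>. (\<Sigma> j. h \<alpha> i j * h \<beta> j k)\<^sup>2)"
    unfolding tangential normal by (simp only: sum.distrib sum_distrib_left)
  also have "(\<Sigma> i j \<alpha> k. (D \<alpha> i j k)\<^sup>2) = D_sq"
    unfolding D_sq_def by (rule sum_swap3)
  also have "(\<Sigma> i j \<alpha> k. h \<alpha> j k * E i j k \<alpha>) = - 4 * shape.Q - 2 * shape.G"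
  proof -
    have "(\<Sigma> i j \<alpha> k. h \<alpha> j k * E i j k \<alpha>)
        = (\<Sigma> \<alpha> j k i. h \<alpha> j k * E i j k \<alpha>)"
      unfolding sum.cartesian_product UNIV_Times_UNIV
      by (rule sum.reindex_bij_witness[of _ "\<lambda>(\<alpha>, j, k, i). (i, j, \<alpha>, k)" "\<lambda>(i, j, \<alpha>, k). (\<alpha>, j, k, i)"]) auto
    also have "\<dots> = (\<Sigma> \<alpha> j k. h \<alpha> j k * (\<Sigma> i. E i j k \<alpha>))"
      by (simp only: sum_distrib_left)
    finally show ?thesis unfolding E_def third_derivatives shape.contraction .
  qed
  finally show ?thesis
    by (simp add: shape.sum_cT shape.sum_cN shape.sum_quadratic_normal)
qed

lemma simons_inequality: "laplace X (sqnorm_A X) x0 \<ge> 2 * D_sq - 2 * (sqnorm_A X x0)\<^sup>2"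
  using shape.G_le by (simp add: laplace_sqnorm_A sqnorm_A_x0)

lemma D_sq_nonneg: "D_sq \<ge> 0"
  unfolding D_sq_def by (intro sum_nonneg) simp

text \<open>If the gradient of S points along p, Cauchy-Schwarz bounds it by S times the slice of D
  in direction p, and \<open>symmetric_tracefree_slice\<close> compares this slice with all of D.
  The hypothesis on the gradient is arranged by rotating the tangent frame.\<close>

lemma kato_inequality:
  assumes card: "CARD('n) \<le> 5" and grad: "\<And>i. i \<noteq> p \<Longrightarrow> \<delta>t i (sqnorm_A X) x0 = 0"
  shows "7 / 5 * (\<Sigma> a. (\<delta> a (sqnorm_A X) x0)\<^sup>2) \<le> 4 * sqnorm_A X x0 * D_sq"
proof -
  define s where "s = (\<Sigma> \<alpha> j k. (D \<alpha> p j k)\<^sup>2)"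
  have "(\<Sigma> a. (\<delta> a (sqnorm_A X) x0)\<^sup>2) = (\<Sigma> i. (\<delta>t i (sqnorm_A X) x0)\<^sup>2)"
    by (simp add: sum_UNIV_Plus)
  also have "\<dots> = (\<Sum>i\<in>{p}. (\<delta>t i (sqnorm_A X) x0)\<^sup>2)"
    by (rule sum.mono_neutral_right) (auto simp: grad)
  also have "\<dots> = 4 * (\<Sigma> \<alpha> j k. h \<alpha> j k * D \<alpha> p j k)\<^sup>2"
    by (simp add: tder_sqnorm_A_x0 power_mult_distrib)
  also have "(\<Sigma> \<alpha> j k. h \<alpha> j k * D \<alpha> p j k)\<^sup>2 \<le> sqnorm_A X x0 * s"
    using Cauchy_Schwarz_ineq_sum[of "\<lambda>(\<alpha>, j, k). h \<alpha> j k" "\<lambda>(\<alpha>, j, k). D \<alpha> p j k" UNIV]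
    by (simp add: s_def sqnorm_A_x0 sum.cartesian_product case_prod_unfold)
  finally have "(\<Sigma> a. (\<delta> a (sqnorm_A X) x0)\<^sup>2) \<le> 4 * sqnorm_A X x0 * s" by simp
  moreover have "7 / 5 * s \<le> D_sq"
    unfolding s_def D_sq_def sum_distrib_left[of "7/5" _ "UNIV::'m set"]
    by (intro sum_mono symmetric_tracefree_slice card D_trace D_sym1 D_sym2)
  moreover have "sqnorm_A X x0 \<ge> 0" unfolding sqnorm_A_x0 by (intro sum_nonneg) simp
  ultimately have le: "(\<Sigma> a. (\<delta> a (sqnorm_A X) x0)\<^sup>2) \<le> 4 * sqnorm_A X x0 * s"
    and "4 * sqnorm_A X x0 * (7 / 5 * s) \<le> 4 * sqnorm_A X x0 * D_sq"
    by (simp, intro mult_left_mono, simp_all)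
  then show ?thesis using mult_left_mono[OF le, of "7 / 5"] by (simp add: mult_ac)
qed

text \<open>Differentiating \<open>tder_log_vol\<close> once more produces four terms: the second
  derivatives of the tangent-tangent block give 2S, the derivatives of the normal coordinates -S,
  the trace of D nothing, and the remaining one is the squared gradient.\<close>

lemma laplace_log_vol: "laplace X (log_vol X) x0 = sqnorm_A X x0 + (\<Sigma> a. (\<delta> a (log_vol X) x0)\<^sup>2)"
proof -
  define J where "J k j = partial k (X (Inl j)) x0" for k j
  define E where "E i k j = \<delta>t i (partial k (X (Inl j))) x0" for i k j
  \<comment> \<open>The combination of the vectors \<open>c k\<close> with weights
    \<open>J k j\<close> has the j-th frame vector as tangential part, by \<open>cJ\<close>, and
    column j of \<kappa> as normal part. So \<kappa> is the slope matrix of the span of these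
    vectors over the tangent space.\<close>
  define \<kappa> where "\<kappa> \<alpha> j = (\<Sigma> k. c k (Inr \<alpha>) * J k j)" for \<alpha> j
  have N0: "partial k (X (Inr \<beta>)) x0 = 0" for k \<beta>
    using proj_partial[of "Inr \<beta>" x0 k] by simp
  have M0: "M (Inl l) k x0 = c k (Inl l)" for l k
    by (simp add: dual_eq_proj sum_UNIV_Plus sum_delta_mult)
  have cJ: "(\<Sigma> k. c k (Inl l) * J k j) = (if l = j then 1 else 0)" for l j
    using proj_x0(1)[of l j] by (simp only: proj_def tder_def M0 J_def)
  have Jc: "(\<Sigma> l. J m l * c k (Inl l)) = (if k = m then 1 else 0)" for m k
    using dual_biorthogonal[of k x0 m] by (simp add: sum_UNIV_Plus N0 M0 J_def mult.commute)
  have dN: "\<delta>t i (partial k (X (Inr \<beta>))) x0 = (\<Sigma> j. J k j * h \<beta> i j)" for i k \<beta>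
  proof -
    have "partial k (X (Inr \<beta>)) = (\<lambda>x. \<Sigma> B. P (Inr \<beta>) B x * partial k (X B) x)"
      by (rule ext) (rule proj_partial[symmetric])
    then have "\<delta>t i (partial k (X (Inr \<beta>))) x0 = \<delta>t i (\<lambda>x. \<Sigma> B. P (Inr \<beta>) B x * partial k (X B) x) x0"
      by (rule tder_cong)
    also have "\<dots> = (\<Sigma> B. \<delta>t i (P (Inr \<beta>) B) x0 * partial k (X B) x0 + P (Inr \<beta>) B x0 * \<delta>t i (partial k (X B)) x0)"
      by (simp only: tder_sum tder_mult smooth_rules)
    finally show ?thesis
      by (simp add: sum_UNIV_Plus N0 J_def mult.commute)
  qed
  have dM: "\<delta>t i (M (Inl l) k) x0 = (\<Sigma> \<alpha>. c k (Inr \<alpha>) * h \<alpha> i l)" for i l k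
  proof -
    have "M (Inl l) k = (\<lambda>x. \<Sigma> b. c k b * P (Inl l) b x)" by (rule ext) (rule dual_eq_proj)
    then have "\<delta>t i (M (Inl l) k) x0 = \<delta>t i (\<lambda>x. \<Sigma> b. c k b * P (Inl l) b x) x0" by (rule tder_cong)
    also have "\<dots> = (\<Sigma> b. c k b * \<delta>t i (P (Inl l) b) x0)"
      by (simp only: tder_sum tder_cmult smooth_rules)
    finally show ?thesis by (simp add: sum_UNIV_Plus)
  qed
  have cE: "(\<Sigma> k. c k (Inl l) * E i k j) = - (\<Sigma> \<alpha>. \<kappa> \<alpha> j * h \<alpha> i l)" for i l j
  proof -
    have "P (Inl l) (Inl j) = (\<lambda>x. \<Sigma> k. M (Inl l) k x * partial k (X (Inl j)) x)"
      by (simp only: proj_def tder_def[abs_def])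
    then have "\<delta>t i (P (Inl l) (Inl j)) x0 = \<delta>t i (\<lambda>x. \<Sigma> k. M (Inl l) k x * partial k (X (Inl j)) x) x0"
      by (rule tder_cong)
    then have "0 = (\<Sigma> k. (\<Sigma> \<alpha>. c k (Inr \<alpha>) * h \<alpha> i l) * J k j) + (\<Sigma> k. c k (Inl l) * E i k j)"
      by (simp add: tder_sum tder_mult smooth_rules sum.distrib M0 dM J_def E_def)
    moreover have "(\<Sigma> k. (\<Sigma> \<alpha>. c k (Inr \<alpha>) * h \<alpha> i l) * J k j) = (\<Sigma> \<alpha>. \<kappa> \<alpha> j * h \<alpha> i l)"
      unfolding \<kappa>_def sum_distrib_right by (subst sum.swap) (simp add: mult_ac)
    ultimately show ?thesis by simp
  qed
  have E_eq: "E i m j = - (\<Sigma> l. J m l * (\<Sigma> \<alpha>. \<kappa> \<alpha> j * h \<alpha> i l))" for i m j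
  proof -
    have "E i m j = (\<Sigma> k. (\<Sigma> l. J m l * c k (Inl l)) * E i k j)"
      unfolding Jc by (simp add: sum_delta_mult)
    also have "\<dots> = (\<Sigma> l. J m l * (\<Sigma> k. c k (Inl l) * E i k j))"
      unfolding sum_distrib_left sum_distrib_right by (subst sum.swap) (simp add: mult_ac)
    finally show ?thesis by (simp add: cE sum_negf)
  qed
  have \<kappa>E: "(\<Sigma> k. c k (Inr \<beta>) * E i k j) = - (\<Sigma> l. \<kappa> \<beta> l * (\<Sigma> \<alpha>. \<kappa> \<alpha> j * h \<alpha> i l))" for \<beta> i j
    unfolding E_eq \<kappa>_def[of \<beta>] sum_distrib_right mult_minus_right sum_negf sum_distrib_left[of "c _ _"]
    by (subst sum.swap) (simp add: mult_ac)
  have grad: "\<delta>t i (log_vol X) x0 = - (\<Sigma> \<alpha> j. \<kappa> \<alpha> j * h \<alpha> i j)" for i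
  proof -
    have "\<delta>t i (log_vol X) x0 = - (\<Sigma> m k \<alpha>. c k (Inr \<alpha>) * J k m * h \<alpha> i m)"
      by (simp add: tder_log_vol sum_UNIV_Plus N0 J_def mult.assoc)
    also have "(\<Sigma> m k \<alpha>. c k (Inr \<alpha>) * J k m * h \<alpha> i m)
        = (\<Sigma> \<alpha> m k. c k (Inr \<alpha>) * J k m * h \<alpha> i m)" by (rule sum_swap3)
    finally show ?thesis by (simp only: \<kappa>_def sum_distrib_right)
  qed
  define W where "W i m l = \<delta>t i (\<delta>t i (P (Inl m) (Inl l))) x0" for i m l
  have second: "\<delta>t i (\<delta>t i (log_vol X)) x0 =
      (\<Sigma> m \<alpha>. h \<alpha> i m * (\<Sigma> l. \<kappa> \<alpha> l * (\<Sigma> \<gamma>. \<kappa> \<gamma> m * h \<gamma> i l)))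
      - (\<Sigma> m. W i m m) - (\<Sigma> m \<alpha>. \<kappa> \<alpha> m * D \<alpha> i i m)
      - (\<Sigma> \<beta> m. (h \<beta> i m)\<^sup>2)" for i
  proof -
    have "\<delta>t i (log_vol X) = (\<lambda>x. - (\<Sigma> b k d. c k d * (partial k (X b) x * \<delta>t i (P b d) x)))"
      by (rule ext) (rule tder_log_vol)
    then have "\<delta>t i (\<delta>t i (log_vol X)) x0
        = \<delta>t i (\<lambda>x. - (\<Sigma> b k d. c k d * (partial k (X b) x * \<delta>t i (P b d) x))) x0"
      by (rule tder_cong)
    also have "\<dots> = - (\<Sigma> b k d. c k d * (\<delta>t i (partial k (X b)) x0 * \<delta>t i (P b d) x0
        + partial k (X b) x0 * \<delta>t i (\<delta>t i (P b d)) x0))"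
      by (simp add: tder_minus tder_sum tder_cmult tder_mult smooth_rules)
    also have "\<dots> = - ((\<Sigma> m k. (\<Sigma> l. c k (Inl l) * (J k m * W i m l))
            + (\<Sigma> \<alpha>. c k (Inr \<alpha>) * (E i k m * h \<alpha> i m + J k m * D \<alpha> i i m)))
          + (\<Sigma> \<beta> k l. c k (Inl l) * ((\<Sigma> j. J k j * h \<beta> i j) * h \<beta> i l)))"
      by (simp add: sum_UNIV_Plus N0 dN J_def E_def W_def)
    also have "\<dots> = - ((\<Sigma> m k l. c k (Inl l) * (J k m * W i m l))
            + (\<Sigma> m k \<alpha>. c k (Inr \<alpha>) * (E i k m * h \<alpha> i m))
            + (\<Sigma> m k \<alpha>. c k (Inr \<alpha>) * (J k m * D \<alpha> i i m))
          + (\<Sigma> \<beta> k l. c k (Inl l) * ((\<Sigma> j. J k j * h \<beta> i j) * h \<beta> i l)))"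
      by (simp add: sum.distrib distrib_left)
    also have "(\<Sigma> m k l. c k (Inl l) * (J k m * W i m l)) = (\<Sigma> m. W i m m)"
    proof (rule sum.cong[OF refl])
      fix m
      have "(\<Sigma> k l. c k (Inl l) * (J k m * W i m l)) = (\<Sigma> l. (\<Sigma> k. c k (Inl l) * J k m) * W i m l)"
        unfolding sum_distrib_right by (subst sum.swap) (simp add: mult_ac)
      then show "(\<Sigma> k l. c k (Inl l) * (J k m * W i m l)) = W i m m"
        by (simp add: cJ sum_delta_mult)
    qed
    also have "(\<Sigma> m k \<alpha>. c k (Inr \<alpha>) * (E i k m * h \<alpha> i m))
        = (\<Sigma> m \<alpha>. - (h \<alpha> i m * (\<Sigma> l. \<kappa> \<alpha> l * (\<Sigma> \<gamma>. \<kappa> \<gamma> m * h \<gamma> i l))))"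
    proof (rule sum.cong[OF refl])
      fix m
      have "(\<Sigma> k \<alpha>. c k (Inr \<alpha>) * (E i k m * h \<alpha> i m)) = (\<Sigma> \<alpha>. h \<alpha> i m * (\<Sigma> k. c k (Inr \<alpha>) * E i k m))"
        unfolding sum_distrib_left by (subst sum.swap) (simp add: mult_ac)
      then show "(\<Sigma> k \<alpha>. c k (Inr \<alpha>) * (E i k m * h \<alpha> i m))
          = (\<Sigma> \<alpha>. - (h \<alpha> i m * (\<Sigma> l. \<kappa> \<alpha> l * (\<Sigma> \<gamma>. \<kappa> \<gamma> m * h \<gamma> i l))))"
        by (simp only: \<kappa>E mult_minus_right)
    qed
    also have "(\<Sigma> m k \<alpha>. c k (Inr \<alpha>) * (J k m * D \<alpha> i i m))
        = (\<Sigma> m \<alpha>. \<kappa> \<alpha> m * D \<alpha> i i m)"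
      unfolding \<kappa>_def sum_distrib_right by (rule sum.cong[OF refl], subst sum.swap) (simp add: mult_ac)
    also have "(\<Sigma> \<beta> k l. c k (Inl l) * ((\<Sigma> j. J k j * h \<beta> i j) * h \<beta> i l)) = (\<Sigma> \<beta> m. (h \<beta> i m)\<^sup>2)"
    proof (rule sum.cong[OF refl])
      fix \<beta>
      have "(\<Sigma> k l. c k (Inl l) * ((\<Sigma> j. J k j * h \<beta> i j) * h \<beta> i l))
          = (\<Sigma> k l j. c k (Inl l) * J k j * (h \<beta> i j * h \<beta> i l))"
        by (simp add: sum_distrib_left sum_distrib_right mult_ac)
      also have "\<dots> = (\<Sigma> l j k. c k (Inl l) * J k j * (h \<beta> i j * h \<beta> i l))"
        by (rule sum_swap3[symmetric])
      also have "\<dots> = (\<Sigma> l j. (if l = j then 1 else 0) * (h \<beta> i j * h \<beta> i l))"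
        by (simp only: sum_distrib_right[symmetric] cJ)
      finally show "(\<Sigma> k l. c k (Inl l) * ((\<Sigma> j. J k j * h \<beta> i j) * h \<beta> i l)) = (\<Sigma> m. (h \<beta> i m)\<^sup>2)"
        by (simp add: sum_delta_mult power2_eq_square)
    qed
    finally show ?thesis by (simp add: sum_negf)
  qed
  \<comment> \<open>Flatness enters here. The expanded sum pairs each \<kappa> with the tangential
    index of the other shape matrix; commutation uncrosses them and leaves the square of the
    gradient in \<open>grad\<close>.\<close>
  have T1: "(\<Sigma> i m \<alpha>. h \<alpha> i m * (\<Sigma> l. \<kappa> \<alpha> l * (\<Sigma> \<gamma>. \<kappa> \<gamma> m * h \<gamma> i l)))
      = (\<Sigma> a. (\<delta> a (log_vol X) x0)\<^sup>2)"
  proof -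
    have "(\<Sigma> i m \<alpha>. h \<alpha> i m * (\<Sigma> l. \<kappa> \<alpha> l * (\<Sigma> \<gamma>. \<kappa> \<gamma> m * h \<gamma> i l)))
        = (\<Sigma> i m \<alpha> l \<gamma>. h \<alpha> i m * (\<kappa> \<alpha> l * (\<kappa> \<gamma> m * h \<gamma> i l)))"
      by (simp only: sum_distrib_left)
    also have "\<dots> = (\<Sigma> m \<alpha> l \<gamma> i. \<kappa> \<alpha> l * \<kappa> \<gamma> m * (h \<alpha> m i * h \<gamma> l i))"
      unfolding sum.cartesian_product UNIV_Times_UNIV
      by (rule sum.reindex_bij_witness[of _ "\<lambda>(m, \<alpha>, l, \<gamma>, i). (i, m, \<alpha>, l, \<gamma>)" "\<lambda>(i, m, \<alpha>, l, \<gamma>). (m, \<alpha>, l, \<gamma>, i)"])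
        (auto simp: h_sym)
    also have "\<dots> = (\<Sigma> m \<alpha> l \<gamma> i. \<kappa> \<alpha> l * \<kappa> \<gamma> m * (h \<alpha> l i * h \<gamma> m i))"
      unfolding sum_distrib_left[symmetric] by (subst flat) (rule refl)
    also have "\<dots> = (\<Sigma> i \<alpha> l \<gamma> m. (\<kappa> \<alpha> l * h \<alpha> i l) * (\<kappa> \<gamma> m * h \<gamma> i m))"
      unfolding sum.cartesian_product UNIV_Times_UNIV
      by (rule sum.reindex_bij_witness[of _ "\<lambda>(i, \<alpha>, l, \<gamma>, m). (m, \<alpha>, l, \<gamma>, i)" "\<lambda>(m, \<alpha>, l, \<gamma>, i). (i, \<alpha>, l, \<gamma>, m)"])
        (auto simp: h_sym)
    also have "\<dots> = (\<Sigma> i. (\<Sigma> \<alpha> l. \<kappa> \<alpha> l * h \<alpha> i l)\<^sup>2)"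
      by (simp only: power2_eq_square sum_distrib_left sum_distrib_right) (simp add: mult_ac)
    finally show ?thesis by (simp add: sum_UNIV_Plus grad)
  qed
  have T2: "(\<Sigma> i m. W i m m) = - 2 * sqnorm_A X x0"
  proof -
    have "(\<Sigma> i m. W i m m) = (\<Sigma> i m. - (\<Sigma> \<alpha>. 2 * (h \<alpha> i m)\<^sup>2))"
      by (simp add: W_def tder2_proj_TT power2_eq_square)
    also have "\<dots> = - (\<Sigma> \<alpha> i m. 2 * (h \<alpha> i m)\<^sup>2)"
      unfolding sum_negf by (subst sum_swap3) (rule refl)
    also have "\<dots> = - (2 * sqnorm_A X x0)"
      unfolding sqnorm_A_x0 sum_distrib_left ..
    finally show ?thesis by simp
  qed
  have T3: "(\<Sigma> i m \<alpha>. \<kappa> \<alpha> m * D \<alpha> i i m) = 0"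
  proof -
    have "(\<Sigma> i. D \<alpha> i i m) = 0" for \<alpha> m
      using D_trace[of \<alpha> m] by (metis (no_types, lifting) D_sym1 D_sym2 sum.cong)
    moreover have "(\<Sigma> i m \<alpha>. \<kappa> \<alpha> m * D \<alpha> i i m) = (\<Sigma> m \<alpha> i. \<kappa> \<alpha> m * D \<alpha> i i m)"
      by (rule sum_swap3[symmetric])
    ultimately show ?thesis by (simp add: sum_distrib_left[symmetric])
  qed
  have T4: "(\<Sigma> i \<beta> m. (h \<beta> i m)\<^sup>2) = sqnorm_A X x0"
    unfolding sqnorm_A_x0 by (rule sum.swap)
  show ?thesis
    unfolding laplace_x0 second sum_subtractf T1 T2 T3 T4 by simp
qed

end

section \<open>Rotating the ambient coordinates\<close>

definition rotated :: "real^'a^'a \<Rightarrow> ('a::finite \<Rightarrow> real^'n \<Rightarrow> real) \<Rightarrow> 'a \<Rightarrow> real^'n \<Rightarrow> real"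
  where "rotated T X a x = (\<Sigma> b. T $ a $ b * X b x)"

text \<open>Transforms like the coordinates, so that orthogonality preserves the pairing which
  recovers the chart.\<close>

definition rotate_coeffs :: "real^'a^'a \<Rightarrow> ('n \<Rightarrow> 'a::finite \<Rightarrow> real) \<Rightarrow> 'n \<Rightarrow> 'a \<Rightarrow> real"
  where "rotate_coeffs T c k a = (\<Sigma> b. T $ a $ b * c k b)"

lemma orthogonal_matrix_columns:
  assumes "orthogonal_matrix T"
  shows "(\<Sigma> a. T $ a $ b * T $ a $ d) = (if b = d then 1 else 0 :: real)"
proof -
  have "transpose T ** T = mat 1" using assms by (simp add: orthogonal_matrix_def)
  then have "(transpose T ** T) $ b $ d = mat 1 $ b $ d" by simp
  then show ?thesis by (simp add: matrix_matrix_mult_def transpose_def mat_def)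
qed

lemma orthogonal_sum_product:
  assumes "orthogonal_matrix T"
  shows "(\<Sigma> a. (\<Sigma> b. T $ a $ b * u b) * (\<Sigma> d. T $ a $ d * v d)) = (\<Sigma> b. u b * v b :: real)"
proof -
  have "(\<Sigma> a. (\<Sigma> b. T $ a $ b * u b) * (\<Sigma> d. T $ a $ d * v d))
      = (\<Sigma> a b d. u b * v d * (T $ a $ b * T $ a $ d))"
    by (simp only: sum_product) (simp add: mult_ac)
  also have "\<dots> = (\<Sigma> b d a. u b * v d * (T $ a $ b * T $ a $ d))"
    by (rule sum_swap3[symmetric])
  also have "\<dots> = (\<Sigma> b d. u b * v d * (if b = d then 1 else 0))"
    by (simp only: sum_distrib_left[symmetric] orthogonal_matrix_columns[OF assms])
  finally show ?thesis by (simp add: sum_delta_mult)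
qed

lemma orthogonal_sum_square:
  assumes "orthogonal_matrix T"
  shows "(\<Sigma> a. (\<Sigma> b. T $ a $ b * u b)\<^sup>2) = (\<Sigma> b. (u b :: real)\<^sup>2)"
  using orthogonal_sum_product[OF assms, of u u] by (simp add: power2_eq_square)

context minimal_graph
begin

context
  fixes T :: "real^'a^'a"
  assumes orth: "orthogonal_matrix T"
begin

lemma partial_rotate: "partial i (rotated T X a) x = (\<Sigma> b. T $ a $ b * partial i (X b) x)"
  unfolding rotated_def[abs_def]
  by (simp add: partial_sum partial_mult partial_const smooth_differentiable smooth_rules)

lemma gram_rotate: "gram (rotated T X) = gram X"
  by (simp add: gram_def partial_rotate fun_eq_iff vec_eq_iff orthogonal_sum_product[OF orth])

lemma dual_rotate: "dual (rotated T X) a i x = (\<Sigma> b. T $ a $ b * M b i x)"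
proof -
  have "dual (rotated T X) a i x = (\<Sigma> j b. T $ a $ b * (matrix_inv (gram X x) $ i $ j * partial j (X b) x))"
    by (simp add: dual_def gram_rotate partial_rotate sum_distrib_left mult_ac)
  then show ?thesis unfolding dual_def sum_distrib_left by (subst sum.swap)
qed

lemma tder_rotate: "tder (rotated T X) a u x = (\<Sigma> b. T $ a $ b * \<delta> b u x)"
proof -
  have "tder (rotated T X) a u x = (\<Sigma> i b. T $ a $ b * (M b i x * partial i u x))"
    by (simp add: tder_def dual_rotate sum_distrib_right sum_distrib_left mult_ac)
  then show ?thesis unfolding tder_def sum_distrib_left by (subst sum.swap)
qed

lemma tder_rotate_fun: "tder (rotated T X) a u = (\<lambda>x. \<Sigma> b. T $ a $ b * \<delta> b u x)"
  by (rule ext) (rule tder_rotate)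

lemma proj_rotate_fun: "proj (rotated T X) a b = (\<lambda>x. \<Sigma> e. T $ b $ e * (\<Sigma> d. T $ a $ d * P d e x))"
proof
  fix x
  have "proj (rotated T X) a b x = (\<Sigma> d. T $ a $ d * \<delta> d (\<lambda>x. \<Sigma> e. T $ b $ e * X e x) x)"
    by (simp only: proj_def tder_rotate) (simp only: rotated_def[abs_def])
  also have "\<dots> = (\<Sigma> d. T $ a $ d * (\<Sigma> e. T $ b $ e * P d e x))"
    by (simp add: tder_sum tder_cmult smooth_rules proj_def)
  also have "\<dots> = (\<Sigma> d e. T $ b $ e * (T $ a $ d * P d e x))"
    by (simp add: sum_distrib_left mult_ac)
  also have "\<dots> = (\<Sigma> e. T $ b $ e * (\<Sigma> d. T $ a $ d * P d e x))"
    unfolding sum_distrib_left by (rule sum.swap)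
  finally show "proj (rotated T X) a b x = (\<Sigma> e. T $ b $ e * (\<Sigma> d. T $ a $ d * P d e x))" .
qed

text \<open>As T is constant, the derivative of the projection transforms as a 3-tensor. This gives
  the invariance of S and the formula for h in a rotated frame.\<close>

lemma tder_proj_rotate:
  "tder (rotated T X) a (proj (rotated T X) b d) x
    = (\<Sigma> d'. T $ d $ d' * (\<Sigma> b'. T $ b $ b' * (\<Sigma> a'. T $ a $ a' * \<delta> a' (P b' d') x)))"
proof -
  have "tder (rotated T X) a (proj (rotated T X) b d) x
      = (\<Sigma> a'. T $ a $ a' * (\<Sigma> d'. T $ d $ d' * (\<Sigma> b'. T $ b $ b' * \<delta> a' (P b' d') x)))"
    by (simp add: tder_rotate proj_rotate_fun tder_sum tder_cmult smooth_rules)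
  also have "\<dots> = (\<Sigma> a' d' b'. T $ d $ d' * (T $ b $ b' * (T $ a $ a' * \<delta> a' (P b' d') x)))"
    by (simp add: sum_distrib_left mult_ac)
  also have "\<dots> = (\<Sigma> d' b' a'. T $ d $ d' * (T $ b $ b' * (T $ a $ a' * \<delta> a' (P b' d') x)))"
    by (rule sum_swap3[symmetric])
  finally show ?thesis by (simp only: sum_distrib_left)
qed

lemma log_vol_rotate: "log_vol (rotated T X) = log_vol X"
  by (simp add: log_vol_def[abs_def] gram_rotate)

lemma sum_tder_square_rotate: "(\<Sigma> a. (tder (rotated T X) a u x)\<^sup>2) = (\<Sigma> a. (\<delta> a u x)\<^sup>2)"
  by (simp add: tder_rotate orthogonal_sum_square[OF orth])

lemma laplace_rotate:
  assumes "smooth u"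
  shows "laplace (rotated T X) u x = laplace X u x"
proof -
  have "laplace (rotated T X) u x = (\<Sigma> a b d. \<delta> b (\<delta> d u) x * (T $ a $ b * T $ a $ d))"
  proof -
    have "tder (rotated T X) a (tder (rotated T X) a u) x
        = (\<Sigma> b. T $ a $ b * (\<Sigma> d. T $ a $ d * \<delta> b (\<delta> d u) x))" for a
      unfolding tder_rotate[of a "tder _ _ _"] unfolding tder_rotate_fun
      using assms by (simp only: tder_sum tder_cmult smooth_rules)
    then show ?thesis by (simp add: laplace_def sum_distrib_left mult_ac)
  qed
  also have "\<dots> = (\<Sigma> b d a. \<delta> b (\<delta> d u) x * (T $ a $ b * T $ a $ d))"
    by (rule sum_swap3[symmetric])
  also have "\<dots> = (\<Sigma> b d. \<delta> b (\<delta> d u) x * (if b = d then 1 else 0))"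
    by (simp only: sum_distrib_left[symmetric] orthogonal_matrix_columns[OF orth])
  finally show ?thesis by (simp add: sum_delta_mult laplace_def)
qed

lemma sqnorm_A_rotate: "sqnorm_A (rotated T X) = sqnorm_A X"
proof
  fix x
  have "(\<Sigma> a b d. (tder (rotated T X) a (proj (rotated T X) b d) x)\<^sup>2)
      = (\<Sigma> a b d. (\<Sigma> b'. T $ b $ b' * (\<Sigma> a'. T $ a $ a' * \<delta> a' (P b' d) x))\<^sup>2)"
    by (simp only: tder_proj_rotate orthogonal_sum_square[OF orth])
  also have "\<dots> = (\<Sigma> a d b. (\<Sigma> b'. T $ b $ b' * (\<Sigma> a'. T $ a $ a' * \<delta> a' (P b' d) x))\<^sup>2)"
    by (rule sum.cong[OF refl], rule sum.swap)
  also have "\<dots> = (\<Sigma> a d b. (\<Sigma> a'. T $ a $ a' * \<delta> a' (P b d) x)\<^sup>2)"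
    by (simp only: orthogonal_sum_square[OF orth])
  also have "\<dots> = (\<Sigma> d b a. (\<Sigma> a'. T $ a $ a' * \<delta> a' (P b d) x)\<^sup>2)"
    by (rule sum_swap3[symmetric])
  also have "\<dots> = (\<Sigma> d b a. (\<delta> a (P b d) x)\<^sup>2)"
    by (simp only: orthogonal_sum_square[OF orth])
  also have "\<dots> = (\<Sigma> a d b. (\<delta> a (P b d) x)\<^sup>2)"
    by (rule sum_swap3)
  also have "\<dots> = (\<Sigma> a b d. (\<delta> a (P b d) x)\<^sup>2)"
    by (rule sum.cong[OF refl], rule sum.swap)
  finally show "sqnorm_A (rotated T X) x = sqnorm_A X x" by (simp add: sqnorm_A_def)
qed

lemma minimal_graph_rotate: "minimal_graph (rotated T X) (rotate_coeffs T c)"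
proof
  fix a show "smooth (rotated T X a)"
    unfolding rotated_def[abs_def] by (intro smooth_rules)
next
  fix k x show "(\<Sigma> a. rotate_coeffs T c k a * rotated T X a x) = x $ k"
    unfolding rotated_def rotate_coeffs_def orthogonal_sum_product[OF orth] by (rule chart)
next
  fix a x
  have "partial i (\<lambda>y. sqrt (det (gram X y)) * (\<Sigma> b. T $ a $ b * M b i y)) x
      = (\<Sigma> b. T $ a $ b * partial i (\<lambda>y. sqrt (det (gram X y)) * M b i y) x)" for i
  proof -
    have "(\<lambda>y. sqrt (det (gram X y)) * (\<Sigma> b. T $ a $ b * M b i y)) = (\<lambda>y. \<Sigma> b. T $ a $ b * (sqrt (det (gram X y)) * M b i y))"
      by (simp add: sum_distrib_left mult_ac)
    moreover have "partial i (\<lambda>y. \<Sigma> b. T $ a $ b * (sqrt (det (gram X y)) * M b i y)) x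
        = (\<Sigma> b. partial i (\<lambda>y. T $ a $ b * (sqrt (det (gram X y)) * M b i y)) x)"
      by (intro partial_sum smooth_differentiable smooth_rules)
    moreover have "partial i (\<lambda>y. T $ a $ b * (sqrt (det (gram X y)) * M b i y)) x
        = T $ a $ b * partial i (\<lambda>y. sqrt (det (gram X y)) * M b i y) x" for b
      by (subst partial_mult) (auto intro!: smooth_differentiable smooth_rules simp: partial_const)
    ultimately show ?thesis by simp
  qed
  then have "(\<Sigma> i. partial i (\<lambda>y. sqrt (det (gram (rotated T X) y)) * dual (rotated T X) a i y) x)
      = (\<Sigma> i b. T $ a $ b * partial i (\<lambda>y. sqrt (det (gram X y)) * M b i y) x)"
    by (simp add: gram_rotate dual_rotate)
  also have "\<dots> = (\<Sigma> b. T $ a $ b * (\<Sigma> i. partial i (\<lambda>y. sqrt (det (gram X y)) * M b i y) x))"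
    unfolding sum_distrib_left by (rule sum.swap)
  finally show "(\<Sigma> i. partial i (\<lambda>y. sqrt (det (gram (rotated T X) y)) * dual (rotated T X) a i y) x) = 0"
    by (simp add: minimal)
qed

end

end

text \<open>Turning only the tangential indices keeps the projection diagonal, so an adapted point
  stays adapted.\<close>

definition tangent_rotation :: "real^'n^'n \<Rightarrow> real^('n::finite + 'm::finite)^('n + 'm)"
  where "tangent_rotation R = (\<chi> A B. case (A, B) of (Inl i, Inl j) \<Rightarrow> R $ i $ j
    | (Inr \<alpha>, Inr \<beta>) \<Rightarrow> (if \<alpha> = \<beta> then 1 else 0) | _ \<Rightarrow> 0)"

lemma tangent_rotation_simps [simp]:
  "tangent_rotation R $ Inl i $ Inl j = R $ i $ j"
  "tangent_rotation R $ Inr \<alpha> $ Inr \<beta> = (if \<alpha> = \<beta> then 1 else 0)"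
  "tangent_rotation R $ Inl i $ Inr \<beta> = 0"
  "tangent_rotation R $ Inr \<alpha> $ Inl j = 0"
  by (simp_all add: tangent_rotation_def)

lemma orthogonal_tangent_rotation:
  fixes R :: "real^'n^'n"
  assumes "orthogonal_matrix R"
  shows "orthogonal_matrix (tangent_rotation R :: real^('n::finite + 'm::finite)^('n + 'm))"
proof -
  let ?T = "tangent_rotation R :: real^('n + 'm)^('n + 'm)"
  have "(\<Sigma> C. ?T $ C $ A * ?T $ C $ B) = (if A = B then 1 else 0)" for A B
    by (cases A; cases B) (auto simp: sum_UNIV_Plus orthogonal_matrix_columns[OF assms] sum_delta_mult)
  then have "transpose ?T ** ?T = mat 1"
    by (simp add: matrix_matrix_mult_def transpose_def mat_def vec_eq_iff)
  then show ?thesis by (simp add: orthogonal_matrix)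
qed

text \<open>Complete the unit vector along s to an orthonormal basis with s in column p; the
  transposed matrix turns s into the p-th axis.\<close>

lemma orthogonal_matrix_aligning:
  fixes s :: "real^'n"
  obtains R :: "real^'n^'n" where "orthogonal_matrix R" "\<And>i. i \<noteq> p \<Longrightarrow> (\<Sigma> j. R $ i $ j * s $ j) = 0"
proof (cases "s = 0")
  case True
  then show ?thesis using that[OF orthogonal_matrix_id] by simp
next
  case False
  then have "norm (s /\<^sub>R norm s) = 1" by simp
  then obtain A where A: "orthogonal_matrix A" "A *v axis p 1 = s /\<^sub>R norm s"
    using orthogonal_matrix_exists_basis by blast
  have "s $ j = norm s * A $ j $ p" for j
  proof -
    have "(A *v axis p 1) $ j = A $ j $ p"
      by (simp add: matrix_vector_mult_def axis_def if_distrib cong: if_cong)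
    then show ?thesis using False by (simp add: A(2) field_simps)
  qed
  then have "(\<Sigma> j. transpose A $ i $ j * s $ j) = norm s * (\<Sigma> j. A $ j $ i * A $ j $ p)" for i
    by (simp add: transpose_def sum_distrib_left mult_ac)
  then show ?thesis using A(1) orthogonal_matrix_columns[OF A(1)]
    by (intro that[of "transpose A"]) auto
qed

context flat_adapted_graph
begin

text \<open>All shape matrices are conjugated by the same orthogonal matrix, hence still
  commute.\<close>

lemma flat_adapted_graph_tangent_rotation:
  assumes R: "orthogonal_matrix R"
  shows "flat_adapted_graph (rotated (tangent_rotation R) X) (rotate_coeffs (tangent_rotation R) c) x0"
proof -
  let ?T = "tangent_rotation R :: real^('n + 'm)^('n + 'm)"
  let ?X = "rotated ?T X"
  have T: "orthogonal_matrix ?T" by (rule orthogonal_tangent_rotation[OF R])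
  have rows: "(\<Sigma> k. R $ i $ k * R $ j $ k) = (if i = j then 1 else 0)" for i j
  proof -
    have "orthogonal_matrix (transpose R)" using R by simp
    from orthogonal_matrix_columns[OF this, of i j] show ?thesis by (simp add: transpose_def)
  qed
  interpret R: minimal_graph ?X "rotate_coeffs ?T c" by (rule minimal_graph_rotate[OF T])
  interpret R: adapted_graph ?X "rotate_coeffs ?T c" x0
  proof
    fix A B show "proj ?X A B x0 = (if A = B \<and> isl A then 1 else 0)"
      by (cases A; cases B)
        (auto simp: proj_rotate_fun[OF T] sum_UNIV_Plus sum_delta_mult rows)
  qed
  have h: "R.h \<alpha> i j = (\<Sigma> k. R $ j $ k * (\<Sigma> l. R $ i $ l * h \<alpha> l k))" for \<alpha> i j
    unfolding R.h_def tder_proj_rotate[OF T] by (simp add: sum_UNIV_Plus sum_delta_mult)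
  have "(\<Sigma> k. R.h \<alpha> i k * R.h \<beta> j k) = (\<Sigma> k. R.h \<alpha> j k * R.h \<beta> i k)" for \<alpha> \<beta> i j
  proof -
    have "(\<Sigma> k. R.h \<alpha> i k * R.h \<beta> j k)
        = (\<Sigma> l l'. R $ i $ l * R $ j $ l' * (\<Sigma> k. h \<alpha> l k * h \<beta> l' k))" for \<alpha> \<beta> i j
    proof -
      have "(\<Sigma> k. R.h \<alpha> i k * R.h \<beta> j k) = (\<Sigma> k. (\<Sigma> l. R $ i $ l * h \<alpha> l k) * (\<Sigma> l'. R $ j $ l' * h \<beta> l' k))"
        unfolding h by (rule orthogonal_sum_product[OF R])
      also have "\<dots> = (\<Sigma> k l l'. R $ i $ l * R $ j $ l' * (h \<alpha> l k * h \<beta> l' k))"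
        by (simp only: sum_product) (simp add: mult_ac)
      also have "\<dots> = (\<Sigma> l l' k. R $ i $ l * R $ j $ l' * (h \<alpha> l k * h \<beta> l' k))"
        by (rule sum_swap3[symmetric])
      finally show ?thesis by (simp only: sum_distrib_left)
    qed
    note eq = this
    have "(\<Sigma> k. R.h \<alpha> i k * R.h \<beta> j k)
        = (\<Sigma> l l'. R $ i $ l * R $ j $ l' * (\<Sigma> k. h \<alpha> l' k * h \<beta> l k))"
      unfolding eq by (subst flat) (rule refl)
    also have "\<dots> = (\<Sigma> k. R.h \<alpha> j k * R.h \<beta> i k)"
      unfolding eq by (subst sum.swap) (simp add: mult_ac)
    finally show ?thesis .
  qed
  then show ?thesis by unfold_locales
qed

text \<open>Both inequalities must hold for the same D, namely the squared norm of the covariant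
  derivative in the frame aligned with the gradient of S.\<close>

lemma bochner_inequalities:
  assumes card: "CARD('n) \<le> 5"
  obtains D where "D \<ge> 0" "laplace X (sqnorm_A X) x0 \<ge> 2 * D - 2 * (sqnorm_A X x0)\<^sup>2"
    "7 / 5 * (\<Sigma> a. (\<delta> a (sqnorm_A X) x0)\<^sup>2) \<le> 4 * sqnorm_A X x0 * D"
proof -
  obtain p :: 'n where True by blast
  obtain R :: "real^'n^'n" where R: "orthogonal_matrix R"
    and align: "\<And>i. i \<noteq> p \<Longrightarrow> (\<Sigma> j. R $ i $ j * (\<chi> j. \<delta>t j (sqnorm_A X) x0) $ j) = 0"
    using orthogonal_matrix_aligning by blast
  let ?T = "tangent_rotation R :: real^('n + 'm)^('n + 'm)"
  let ?X = "rotated ?T X"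
  have T: "orthogonal_matrix ?T" by (rule orthogonal_tangent_rotation[OF R])
  interpret R: flat_adapted_graph ?X "rotate_coeffs ?T c" x0
    by (rule flat_adapted_graph_tangent_rotation[OF R])
  have "tder ?X (Inl i) (sqnorm_A ?X) x0 = 0" if "i \<noteq> p" for i
    using align[OF that] by (simp add: sqnorm_A_rotate[OF T] tder_rotate[OF T] sum_UNIV_Plus)
  from R.kato_inequality[OF card this] R.simons_inequality R.D_sq_nonneg
  show ?thesis
    using that[of R.D_sq]
    by (simp only: sqnorm_A_rotate[OF T] laplace_rotate[OF T smooth_sqnorm_A] sum_tder_square_rotate[OF T])
qed

end

section \<open>Graphs with flat normal bundle\<close>

definition graph_coord :: "(real^'n \<Rightarrow> real^'m) \<Rightarrow> 'n::finite + 'm::finite \<Rightarrow> real^'n \<Rightarrow> real"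
  where "graph_coord f a x = (case a of Inl i \<Rightarrow> x $ i | Inr \<alpha> \<Rightarrow> f x $ \<alpha>)"

definition graph_coeff :: "'n \<Rightarrow> 'n + 'm \<Rightarrow> real"
  where "graph_coeff k a = (if a = Inl k then 1 else 0)"

definition pair_comp :: "(real^'n) \<times> (real^'m) \<Rightarrow> 'n::finite + 'm::finite \<Rightarrow> real"
  where "pair_comp z a = (case a of Inl i \<Rightarrow> fst z $ i | Inr \<alpha> \<Rightarrow> snd z $ \<alpha>)"

lemma graph_coord_simps [simp]:
  "graph_coord f (Inl i) = (\<lambda>x. x $ i)" "graph_coord f (Inr \<alpha>) = (\<lambda>x. f x $ \<alpha>)"
  by (simp_all add: graph_coord_def fun_eq_iff)

lemma pair_comp_simps [simp]: "pair_comp z (Inl i) = fst z $ i" "pair_comp z (Inr \<alpha>) = snd z $ \<alpha>"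
  by (simp_all add: pair_comp_def)

lemma sum_pair_comp: "(\<Sigma> a. pair_comp z a * pair_comp w a) = z \<bullet> w"
  by (simp add: sum_UNIV_Plus inner_prod_def inner_vec_def)

lemma bounded_linear_pair_comp: "bounded_linear (\<lambda>z. pair_comp z a)"
proof (cases a)
  case (Inl i)
  then show ?thesis
    using bounded_linear_compose[OF bounded_linear_vec_nth bounded_linear_fst] by simp
next
  case (Inr \<alpha>)
  then show ?thesis
    using bounded_linear_compose[OF bounded_linear_vec_nth bounded_linear_snd] by simp
qed

lemma immersed_chart_graph:
  assumes "smooth_on UNIV f"
  shows "immersed_chart (graph_coord f) graph_coeff"
proof
  fix a show "smooth (graph_coord f a)"
    by (cases a) (use smooth_component[OF assms] in \<open>auto intro: smooth_coord\<close>)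
  fix k x show "(\<Sigma> a. graph_coeff k a * graph_coord f a x) = x $ k"
    by (simp add: sum_UNIV_Plus graph_coeff_def if_distrib[of "\<lambda>z. z * _"] cong: if_cong)
qed

lemma gram_graph: "gram (graph_coord f) = metric f"
  by (simp add: fun_eq_iff gram_def metric_def vec_eq_iff sum_UNIV_Plus partial_coord
      if_distrib[of "\<lambda>z. z * _"] cong: if_cong)

text \<open>The system only states the equations for the components of f. Those for the base
  coordinates follow from \<open>mean_curvature_normal\<close>: once the last m components of the
  mean curvature vector vanish, its product with the k-th tangent vector is its k-th
  component.\<close>

lemma minimal_graph_graph:
  assumes smooth: "smooth_on UNIV f" and minimal: "minimal_surface_system f"
  shows "minimal_graph (graph_coord f) graph_coeff"
proof -
  interpret immersed_chart "graph_coord f" graph_coeff by (rule immersed_chart_graph[OF smooth])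
  define H where "H a x = (\<Sigma> i. partial i (\<lambda>y. sqrt (det (gram (graph_coord f) y)) * M a i y) x)" for a x
  have HN: "H (Inr \<alpha>) x = 0" for \<alpha> x
  proof -
    have "(\<lambda>y. sqrt (det (gram (graph_coord f) y)) * M (Inr \<alpha>) i y)
        = (\<lambda>y. \<Sigma> j. sqrt (det (metric f y)) * matrix_inv (metric f y) $ i $ j * partial j (\<lambda>z. f z $ \<alpha>) y)" for i
      by (simp add: dual_def gram_graph sum_distrib_left mult_ac)
    moreover have "smooth (\<lambda>y. sqrt (det (metric f y)) * matrix_inv (metric f y) $ i $ j * partial j (\<lambda>z. f z $ \<alpha>) y)" for i j
      using smooth_vol smooth_matrix_inv[OF smooth_gram det_gram_pos] smooth_component[OF smooth]
      unfolding gram_graph by (intro smooth_mult smooth_partial)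
    ultimately show ?thesis
      using minimal unfolding H_def minimal_surface_system_def
      by (simp add: partial_sum smooth_differentiable)
  qed
  have HT: "H (Inl k) x = 0" for k x
    using mean_curvature_normal[of x k]
    by (simp add: H_def[symmetric] sum_UNIV_Plus HN partial_coord if_distrib[of "\<lambda>z. _ * z"] cong: if_cong)
  show ?thesis
  proof
    fix a x
    have "H a x = 0" by (cases a) (simp_all add: HN HT)
    then show "(\<Sigma> i. partial i (\<lambda>y. sqrt (det (gram (graph_coord f) y)) * dual (graph_coord f) a i y) x) = 0"
      by (simp add: H_def)
  qed
qed

lemma smooth_on_differentiable: "smooth_on U u \<Longrightarrow> x \<in> U \<Longrightarrow> u differentiable (at x)"
  unfolding smooth_on_def by (metis Ck_on.simps(2))

lemma pair_comp_tangent: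
  assumes "smooth_on UNIV f" "z = (v, frechet_derivative f (at x) v)"
  shows "pair_comp z a = (\<Sigma> k. v $ k * partial k (graph_coord f a) x)"
proof (cases a)
  case (Inl i)
  then show ?thesis
    by (simp add: assms(2) partial_coord if_distrib[of "\<lambda>z. _ * z"] cong: if_cong)
next
  case (Inr \<alpha>)
  have d: "f differentiable (at x)" using smooth_on_differentiable[OF assms(1)] by simp
  have "frechet_derivative f (at x) = (\<lambda>v. \<Sigma> i. v $ i *\<^sub>R partial i f x)"
    using frechet_derivative_at[OF has_derivative_partial_sum[OF d]] by simp
  then show ?thesis
    using Inr partial_bounded_linear[OF bounded_linear_vec_nth d] by (simp add: assms(2))
qed

text \<open>The rows of T are the frame vectors at p, which diagonalises P there. The normal
  curvature is quadratic in the second fundamental form, so the opposite sign of h and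
  \<open>second_ff\<close> is harmless.\<close>

lemma flat_adapted_graph_exists:
  fixes f :: "real^'n \<Rightarrow> real^'m"
  assumes smooth: "smooth_on UNIV f" and mss: "minimal_surface_system f"
    and flat: "flat_normal_bundle f"
  obtains T where "orthogonal_matrix T"
    "flat_adapted_graph (rotated T (graph_coord f)) (rotate_coeffs T graph_coeff) p"
proof -
  let ?X = "graph_coord f"
  interpret minimal_graph ?X graph_coeff by (rule minimal_graph_graph[OF smooth mss])
  obtain U e \<nu> where U: "open U" "p \<in> U" and af: "adapted_frame f U e \<nu>"
    and nc: "\<And>\<alpha> \<beta> i j. normal_curvature e \<nu> p \<alpha> \<beta> i j = 0"
    using flat unfolding flat_normal_bundle_def by metis
  define E where "E A y = (case A of Inl i \<Rightarrow> e i y | Inr \<alpha> \<Rightarrow> \<nu> \<alpha> y)" for A y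
  have tan: "e i y \<in> tangent_space f y" and nor: "w \<in> tangent_space f y \<Longrightarrow> \<nu> \<alpha> y \<bullet> w = 0"
    and ee: "e i y \<bullet> e j y = (if i = j then 1 else 0)" and nn: "\<nu> \<alpha> y \<bullet> \<nu> \<beta> y = (if \<alpha> = \<beta> then 1 else 0)"
    if "y \<in> U" for i j \<alpha> \<beta> y w
    using af that unfolding adapted_frame_def by blast+
  have d\<nu>: "\<nu> \<alpha> differentiable (at p)" for \<alpha>
    using af U(2) unfolding adapted_frame_def by (blast intro: smooth_on_differentiable)
  have e_eq: "pair_comp (e i y) a = (\<Sigma> k. fst (e i y) $ k * partial k (?X a) y)" if y: "y \<in> U" for i y a
  proof -
    obtain v where "e i y = (v, frechet_derivative f (at y) v)" using tan[OF y] unfolding tangent_space_def by blast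
    then show ?thesis using pair_comp_tangent[OF smooth] by (metis fst_conv)
  qed
  define T :: "real^('n + 'm)^('n + 'm)" where "T = (\<chi> A a. pair_comp (E A p) a)"
  have T_simps: "T $ Inl i $ a = pair_comp (e i p) a" "T $ Inr \<alpha> $ a = pair_comp (\<nu> \<alpha> p) a" for i \<alpha> a
    by (simp_all add: T_def E_def)
  have rows: "(\<Sigma> a. T $ A $ a * T $ B $ a) = (if A = B then 1 else 0)" for A B
  proof -
    have "E A p \<bullet> E B p = (if A = B then 1 else 0)"
      using ee[OF U(2)] nn[OF U(2)] nor[OF U(2) tan[OF U(2)]]
      by (cases A; cases B) (auto simp: E_def inner_commute)
    then show ?thesis by (simp add: T_def sum_pair_comp)
  qed
  then have "T ** transpose T = mat 1"
    by (simp add: matrix_matrix_mult_def transpose_def mat_def vec_eq_iff)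
  then have T: "orthogonal_matrix T"
    by (metis matrix_left_right_inverse orthogonal_matrix_def)
  let ?Y = "rotated T ?X"
  have P_tan: "(\<Sigma> b. P a b p * pair_comp (e i p) b) = pair_comp (e i p) a" for i a
  proof -
    have "(\<Sigma> b. P a b p * pair_comp (e i p) b)
        = (\<Sigma> k. fst (e i p) $ k * (\<Sigma> b. P a b p * partial k (?X b) p))"
      unfolding e_eq[OF U(2)] sum_distrib_left by (subst sum.swap) (simp add: mult_ac)
    then show ?thesis by (simp only: proj_partial e_eq[OF U(2)])
  qed
  \<comment> \<open>Stated on all of U and not only at p, because this identity is differentiated at
    p below.\<close>
  have P_nor: "(\<Sigma> b. P a b y * pair_comp (\<nu> \<alpha> y) b) = 0" if "y \<in> U" for \<alpha> a y
  proof -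
    have "(\<Sigma> b. partial i (?X b) y * pair_comp (\<nu> \<alpha> y) b) = 0" for i
    proof -
      let ?z = "(axis i 1, frechet_derivative f (at y) (axis i 1))"
      have "pair_comp ?z b = partial i (?X b) y" for b
        using pair_comp_tangent[OF smooth refl, of "axis i 1" y b]
        by (simp add: axis_def if_distrib[of "\<lambda>z. z * _"] cong: if_cong)
      moreover have "?z \<bullet> \<nu> \<alpha> y = 0"
        using nor[OF that, of ?z] unfolding tangent_space_def by (simp add: inner_commute)
      ultimately show ?thesis using sum_pair_comp[of ?z "\<nu> \<alpha> y"] by simp
    qed
    moreover have "(\<Sigma> b. P a b y * pair_comp (\<nu> \<alpha> y) b)
        = (\<Sigma> i. M a i y * (\<Sigma> b. partial i (?X b) y * pair_comp (\<nu> \<alpha> y) b))"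
      unfolding proj_def tder_def sum_distrib_left sum_distrib_right by (subst sum.swap) (simp add: mult_ac)
    ultimately show ?thesis by simp
  qed
  have e_dir: "(\<Sigma> a. T $ Inl i $ a * \<delta> a u p) = (\<Sigma> k. fst (e i p) $ k * partial k u p)" for i u
  proof -
    have "(\<Sigma> a. T $ Inl i $ a * \<delta> a u p)
        = (\<Sigma> k. fst (e i p) $ k * (\<Sigma> a. partial k (?X a) p * \<delta> a u p))"
      unfolding T_simps e_eq[OF U(2)] sum_distrib_left sum_distrib_right by (subst sum.swap) (simp add: mult_ac)
    then show ?thesis by (simp only: partial_eq_tder[symmetric])
  qed
  interpret R: minimal_graph ?Y "rotate_coeffs T graph_coeff" by (rule minimal_graph_rotate[OF T])
  interpret R: adapted_graph ?Y "rotate_coeffs T graph_coeff" p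
  proof
    fix A B
    have PT: "(\<Sigma> d. T $ A $ d * P d b p) = (if isl A then T $ A $ b else 0)" for b
    proof -
      have "(\<Sigma> d. T $ A $ d * P d b p) = (\<Sigma> d. P b d p * pair_comp (E A p) d)"
        by (simp add: T_def mult.commute proj_sym[of _ b])
      then show ?thesis
        by (cases A) (simp_all add: E_def P_tan P_nor[OF U(2)] T_def)
    qed
    show "proj ?Y A B p = (if A = B \<and> isl A then 1 else 0)"
      unfolding proj_rotate_fun[OF T] PT
      using rows[of B A] by (cases "isl A") auto
  qed
  \<comment> \<open>Differentiating P \<nu> = 0 moves the derivative from the projection to the
    normal field, which produces the sign.\<close>
  have h: "R.h \<alpha> i j = - second_ff e \<nu> p \<alpha> i j" for \<alpha> i j
  proof -
    let ?n = "\<lambda>b y. pair_comp (\<nu> \<alpha> y) b"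
    have dn: "?n b differentiable (at p)" for b
      using differentiable_compose[OF bounded_linear_imp_differentiable[OF bounded_linear_pair_comp] d\<nu>] .
    have zero: "(\<Sigma> d. \<delta> a (P b d) p * ?n d p + P b d p * \<delta> a (?n d) p) = 0" for a b
    proof -
      have d: "(\<lambda>y. P b d y * ?n d y) differentiable (at p)" for d
        by (intro differentiable_mult dn smooth_differentiable smooth_rules)
      have "((\<lambda>y. \<Sigma> d. P b d y * ?n d y) has_derivative (\<lambda>_. 0)) (at p)"
        by (rule has_derivative_transform_within_open[OF has_derivative_const[of 0] U]) (simp add: P_nor)
      then have "\<delta> a (\<lambda>y. \<Sigma> d. P b d y * ?n d y) p = 0"
        unfolding tder_def by (simp add: partial_eqI)
      then have "(\<Sigma> d. \<delta> a (\<lambda>y. P b d y * ?n d y) p) = 0"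
        by (simp only: tder_sum_at d)
      then show ?thesis
        by (simp only: tder_mult_at[OF smooth_differentiable[OF smooth_proj] dn])
    qed
    have second: "second_ff e \<nu> p \<alpha> i j = (\<Sigma> b. pair_comp (e j p) b * (\<Sigma> a. T $ Inl i $ a * \<delta> a (?n b) p))"
    proof -
      have "frechet_derivative (\<nu> \<alpha>) (at p) = (\<lambda>v. \<Sigma> i. v $ i *\<^sub>R partial i (\<nu> \<alpha>) p)"
        using frechet_derivative_at[OF has_derivative_partial_sum[OF d\<nu>]] by simp
      then have "pair_comp (frechet_derivative (\<nu> \<alpha>) (at p) v) b = (\<Sigma> k. v $ k * partial k (?n b) p)" for v b
        by (simp add: partial_bounded_linear[OF bounded_linear_pair_comp d\<nu>]
            linear_sum[OF bounded_linear.linear[OF bounded_linear_pair_comp]]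
            linear_cmul[OF bounded_linear.linear[OF bounded_linear_pair_comp]])
      then show ?thesis
        unfolding second_ff_def sum_pair_comp[symmetric] e_dir by (simp add: mult.commute)
    qed
    have "R.h \<alpha> i j = (\<Sigma> d. T $ Inr \<alpha> $ d * (\<Sigma> b. T $ Inl j $ b * (\<Sigma> a. T $ Inl i $ a * \<delta> a (P b d) p)))"
      unfolding R.h_def by (rule tder_proj_rotate[OF T])
    also have "\<dots> = (\<Sigma> d b a. T $ Inl j $ b * (T $ Inl i $ a * (\<delta> a (P b d) p * ?n d p)))"
      by (simp add: T_simps sum_distrib_left mult_ac)
    also have "\<dots> = (\<Sigma> b a. T $ Inl j $ b * (T $ Inl i $ a * (\<Sigma> d. \<delta> a (P b d) p * ?n d p)))"
      by (subst sum_swap3[symmetric]) (simp only: sum_distrib_left)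
    also have "\<dots> = - (\<Sigma> b a. T $ Inl j $ b * (T $ Inl i $ a * (\<Sigma> d. P b d p * \<delta> a (?n d) p)))"
    proof -
      have "(\<Sigma> d. \<delta> a (P b d) p * ?n d p) = - (\<Sigma> d. P b d p * \<delta> a (?n d) p)" for a b
        using zero[of a b] by (simp add: sum.distrib)
      then show ?thesis by (simp add: sum_negf)
    qed
    also have "(\<Sigma> b a. T $ Inl j $ b * (T $ Inl i $ a * (\<Sigma> d. P b d p * \<delta> a (?n d) p)))
        = (\<Sigma> b a d. T $ Inl i $ a * \<delta> a (?n d) p * (T $ Inl j $ b * P b d p))"
      by (simp add: sum_distrib_left mult_ac)
    also have "\<dots> = (\<Sigma> a d b. T $ Inl i $ a * \<delta> a (?n d) p * (T $ Inl j $ b * P b d p))"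
      by (rule sum_swap3[symmetric])
    also have "\<dots> = (\<Sigma> a d. T $ Inl i $ a * \<delta> a (?n d) p * pair_comp (e j p) d)"
    proof -
      have "(\<Sigma> b. T $ Inl j $ b * P b d p) = pair_comp (e j p) d" for d
        using P_tan[of d j] by (simp add: T_simps mult.commute proj_sym[of _ d])
      then show ?thesis by (simp only: sum_distrib_left[symmetric])
    qed
    also have "\<dots> = second_ff e \<nu> p \<alpha> i j"
      unfolding second sum_distrib_left by (subst sum.swap) (simp add: mult_ac)
    finally show ?thesis .
  qed
  have "flat_adapted_graph ?Y (rotate_coeffs T graph_coeff) p"
  proof
    fix \<alpha> \<beta> i j
    show "(\<Sigma> k. R.h \<alpha> i k * R.h \<beta> j k) = (\<Sigma> k. R.h \<alpha> j k * R.h \<beta> i k)"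
      using nc[of \<alpha> \<beta> i j] by (simp add: h normal_curvature_def sum_subtractf)
  qed
  then show ?thesis using that T by blast
qed

text \<open>Every point gets its own rotation; all quantities involved are rotation invariant, so
  the identities at adapted points hold for the graph itself.\<close>

lemma
  fixes f :: "real^'n \<Rightarrow> real^'m"
  assumes smooth: "smooth_on UNIV f" and mss: "minimal_surface_system f"
    and flat: "flat_normal_bundle f"
  defines "X \<equiv> graph_coord f"
  shows laplace_log_vol_graph:
      "laplace X (log_vol X) x = sqnorm_A X x + (\<Sigma> a. (tder X a (log_vol X) x)\<^sup>2)"
    and laplace_sqnorm_A_graph: "CARD('n) \<le> 5 \<Longrightarrow> \<exists>D\<ge>0. laplace X (sqnorm_A X) x \<ge> 2 * D - 2 * (sqnorm_A X x)\<^sup>2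
      \<and> 7 / 5 * (\<Sigma> a. (tder X a (sqnorm_A X) x)\<^sup>2) \<le> 4 * sqnorm_A X x * D"
proof -
  interpret minimal_graph X graph_coeff unfolding X_def by (rule minimal_graph_graph[OF smooth mss])
  obtain T where T: "orthogonal_matrix T" and "flat_adapted_graph (rotated T X) (rotate_coeffs T graph_coeff) x"
    using flat_adapted_graph_exists[OF smooth mss flat] unfolding X_def by blast
  then interpret R: flat_adapted_graph "rotated T X" "rotate_coeffs T graph_coeff" x by simp
  note eqs = log_vol_rotate[OF T] sqnorm_A_rotate[OF T] laplace_rotate[OF T smooth_log_vol]
    laplace_rotate[OF T smooth_sqnorm_A] sum_tder_square_rotate[OF T]
  show "laplace X (log_vol X) x = sqnorm_A X x + (\<Sigma> a. (tder X a (log_vol X) x)\<^sup>2)"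
    using R.laplace_log_vol unfolding eqs .
  show "\<exists>D\<ge>0. laplace X (sqnorm_A X) x \<ge> 2 * D - 2 * (sqnorm_A X x)\<^sup>2
      \<and> 7 / 5 * (\<Sigma> a. (tder X a (sqnorm_A X) x)\<^sup>2) \<le> 4 * sqnorm_A X x * D" if "CARD('n) \<le> 5"
    using R.bochner_inequalities[OF that] unfolding eqs by metis
qed

section \<open>The curvature estimate\<close>

lemma DERIV_max_0_power:
  "((\<lambda>r. max 0 r ^ Suc (Suc k)) has_real_derivative real (Suc (Suc k)) * max 0 r ^ Suc k) (at r)"
proof -
  consider "r > 0" | "r < 0" | "r = 0" by linarith
  then show ?thesis
  proof cases
    case 1
    have "((\<lambda>r. r ^ Suc (Suc k)) has_real_derivative real (Suc (Suc k)) * r ^ Suc k) (at r)"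
      using DERIV_pow[of "Suc (Suc k)" r] by simp
    then have "((\<lambda>r. max 0 r ^ Suc (Suc k)) has_real_derivative real (Suc (Suc k)) * r ^ Suc k) (at r)"
      by (rule has_field_derivative_transform_within_open[where S = "{0<..}"]) (use 1 in auto)
    then show ?thesis using 1 by simp
  next
    case 2
    have "((\<lambda>r. max 0 r ^ Suc (Suc k)) has_real_derivative 0) (at r)"
      by (rule has_field_derivative_transform_within_open[OF DERIV_const[of 0], where S = "{..<0}"]) (use 2 in auto)
    then show ?thesis using 2 by simp
  next
    case 3
    have "((\<lambda>h::real. max 0 h ^ Suc (Suc k) / h) \<longlongrightarrow> 0) (at 0)"
    proof (rule Lim_null_comparison)
      have "norm (max 0 h ^ Suc (Suc k) / h) \<le> \<bar>h\<bar> ^ Suc k" for h :: real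
      proof (cases "h > 0")
        case False
        then have "max 0 h ^ Suc (Suc k) = 0" by simp
        then show ?thesis by (metis abs_ge_zero div_0 norm_zero zero_le_power)
      qed (simp add: max_def)
      then show "\<forall>\<^sub>F h in at 0. norm (max 0 h ^ Suc (Suc k) / h) \<le> \<bar>h :: real\<bar> ^ Suc k"
        by (intro always_eventually allI)
      show "((\<lambda>h::real. \<bar>h\<bar> ^ Suc k) \<longlongrightarrow> 0) (at 0)"
        by (auto intro!: tendsto_eq_intros)
    qed
    then show ?thesis using 3 by (simp add: DERIV_def)
  qed
qed

text \<open>For each ambient index, a is the derivative of S, b is T times that of the log density
  and e is T times that of the cutoff. Completing squares in a and then b leaves the small
  coefficient 909/162500 on the b square, since the form is barely definite; this is why the
  constant 1000 is large.\<close>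

lemma cutoff_quadratic_form:
  fixes a b e t :: real
  shows "t\<^sup>2 * (65/100 * a\<^sup>2 + 1616/1000 * (a * b) + 101/100 * b\<^sup>2) + t * e * (3 * a + 606/100 * b) \<ge> - 1000 * e\<^sup>2"
proof -
  have "t\<^sup>2 * (65/100 * a\<^sup>2 + 1616/1000 * (a * b) + 101/100 * b\<^sup>2) + t * e * (3 * a + 606/100 * b) + 1000 * e\<^sup>2
    = 65/100 * (t * a + 404/325 * (t * b) + 30/13 * e)\<^sup>2 + 909/162500 * (t * b + 625/3 * e)\<^sup>2 + 3015/4 * e\<^sup>2"
    by (simp add: power2_eq_square algebra_simps)
  moreover have "\<dots> \<ge> 0" by simp
  ultimately show ?thesis by linarith
qed

text \<open>A Young inequality done by cases: either half of the good term absorbs the error, or T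
  t^2 is bounded by a multiple of 1/R^2 and the error itself has size R^(-26/5).\<close>

lemma absorb_cutoff:
  fixes s t R :: real
  assumes s: "s \<ge> 0" and t: "0 \<le> t" "t \<le> 1" and R: "R > 0"
  defines "T \<equiv> s + 1 / R\<^sup>2"
  shows "T powr (8/5) * (s / 100 * t ^ 6 - 4000 * t ^ 4 / R\<^sup>2)
    \<ge> T powr (8/5) * s * t ^ 6 / 200 - 4000 / R\<^sup>2 * (800001 / R\<^sup>2) powr (8/5)"
proof -
  have T: "T > 0" using s R by (simp add: T_def add_nonneg_pos)
  have K: "4000 / R\<^sup>2 * (800001 / R\<^sup>2) powr (8/5) \<ge> 0" by simp
  show ?thesis
  \<comment> \<open>The threshold is 800000 = 4000 * 200; the extra unit in 800001 accounts for the
    shift of T by 1/R^2.\<close>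
  proof (cases "s * t\<^sup>2 \<ge> 800000 / R\<^sup>2")
    case True
    then have "t ^ 4 / 200 * (800000 / R\<^sup>2) \<le> t ^ 4 / 200 * (s * t\<^sup>2)" by (rule mult_left_mono) simp
    also have "\<dots> = s * t ^ 6 / 200" by (simp add: power_numeral_reduce)
    finally have "4000 * t ^ 4 / R\<^sup>2 \<le> s * t ^ 6 / 200" by simp
    then have "s * t ^ 6 / 200 \<le> s / 100 * t ^ 6 - 4000 * t ^ 4 / R\<^sup>2" by simp
    then have "T powr (8/5) * (s * t ^ 6 / 200) \<le> T powr (8/5) * (s / 100 * t ^ 6 - 4000 * t ^ 4 / R\<^sup>2)"
      by (rule mult_left_mono) simp
    moreover have "T powr (8/5) * s * t ^ 6 / 200 = T powr (8/5) * (s * t ^ 6 / 200)" by simp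
    ultimately show ?thesis using K by linarith
  next
    case False
    have "t\<^sup>2 \<le> 1" using t by (simp add: power_le_one)
    then have "T * t\<^sup>2 \<le> s * t\<^sup>2 + 1 / R\<^sup>2"
      using R mult_left_mono[of "t\<^sup>2" 1 "1 / R\<^sup>2"] by (simp add: T_def distrib_right)
    also have "\<dots> \<le> 800001 / R\<^sup>2" using False by (simp add: add_divide_distrib[symmetric] field_simps)
    finally have le: "T * t\<^sup>2 \<le> 800001 / R\<^sup>2" .
    \<comment> \<open>Each power of T has to be paired with t^2, which needs 16/5 powers of t; four
      are available as t <= 1. This is why the cutoff has exponent 6, the first integer above
      26/5.\<close>
    have "t ^ 4 \<le> (t\<^sup>2) powr (8/5)"
    proof (cases "t = 0")
      case False
      then have "t\<^sup>2 > 0" by simp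
      then have "t ^ 4 = (t\<^sup>2) powr 2" by (simp add: powr_numeral power_mult[symmetric])
      also have "\<dots> \<le> (t\<^sup>2) powr (8/5)" using \<open>t\<^sup>2 \<le> 1\<close> \<open>t\<^sup>2 > 0\<close> by (intro powr_mono') auto
      finally show ?thesis .
    qed simp
    then have "T powr (8/5) * t ^ 4 \<le> T powr (8/5) * (t\<^sup>2) powr (8/5)" by (rule mult_left_mono) simp
    also have "\<dots> = (T * t\<^sup>2) powr (8/5)" using T by (simp add: powr_mult)
    also have "\<dots> \<le> (800001 / R\<^sup>2) powr (8/5)" using T le by (intro powr_mono2) auto
    finally have "4000 / R\<^sup>2 * (T powr (8/5) * t ^ 4) \<le> 4000 / R\<^sup>2 * (800001 / R\<^sup>2) powr (8/5)"
      by (rule mult_left_mono) simp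
    moreover have "T powr (8/5) * s * t ^ 6 / 200 \<le> T powr (8/5) * s * t ^ 6 / 100"
      using s t by (intro divide_left_mono mult_nonneg_nonneg) auto
    moreover have "T powr (8/5) * (s / 100 * t ^ 6 - 4000 * t ^ 4 / R\<^sup>2)
        = T powr (8/5) * s * t ^ 6 / 100 - 4000 / R\<^sup>2 * (T powr (8/5) * t ^ 4)"
      by (simp add: algebra_simps)
    ultimately show ?thesis by linarith
  qed
qed

text \<open>Collects what the integral estimate needs from the geometry. \<open>proper\<close>
  ensures that a cutoff in the ambient distance has compact support in the chart.\<close>

locale bernstein_graph = minimal_graph X c
  for X :: "'a::finite \<Rightarrow> real^'n \<Rightarrow> real" and c +
  assumes laplace_log_vol: "\<And>x. laplace X (log_vol X) x = sqnorm_A X x + (\<Sigma> a. (tder X a (log_vol X) x)\<^sup>2)"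
    and simons_kato: "\<And>x. \<exists>D\<ge>0. laplace X (sqnorm_A X) x \<ge> 2 * D - 2 * (sqnorm_A X x)\<^sup>2
      \<and> 7 / 5 * (\<Sigma> a. (tder X a (sqnorm_A X) x)\<^sup>2) \<le> 4 * sqnorm_A X x * D"
    and proper: "\<And>x. (norm x)\<^sup>2 \<le> (\<Sigma> a. (X a x)\<^sup>2)"
begin

abbreviation "S \<equiv> sqnorm_A X"

definition rho :: "real^'n \<Rightarrow> real" where "rho x = (\<Sigma> a. (X a x)\<^sup>2)"

lemma smooth_rho: "smooth rho"
  unfolding rho_def[abs_def] by (intro smooth_rules)

lemma S_nonneg: "S x \<ge> 0"
  unfolding sqnorm_A_def by (simp add: sum_nonneg)

text \<open>The gradient of \<open>rho\<close> is twice the tangential projection v of the position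
  vector, and a projection does not increase length.\<close>

lemma sum_tder_rho_square: "(\<Sigma> a. (\<delta> a rho x)\<^sup>2) \<le> 4 * rho x"
proof -
  define v where "v a = (\<Sigma> b. P a b x * X b x)" for a
  have "\<delta> a rho x = 2 * v a" for a
    unfolding rho_def[abs_def] v_def
    by (simp add: power2_eq_square tder_sum tder_mult smooth_rules proj_def[symmetric] sum_distrib_left mult_ac)
  then have "(\<Sigma> a. (\<delta> a rho x)\<^sup>2) = 4 * (\<Sigma> a. v a * v a)"
    by (simp add: power2_eq_square sum_distrib_left)
  moreover have vv: "(\<Sigma> a. v a * v a) = (\<Sigma> a. X a x * v a)"
  proof -
    have "(\<Sigma> a. v a * v a) = (\<Sigma> b. X b x * (\<Sigma> a. P b a x * v a))"
      unfolding sum_distrib_left by (subst sum.swap)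
        (simp add: v_def[of _] sum_distrib_right proj_sym[of _] mult_ac)
    moreover have "(\<Sigma> a. P b a x * v a) = v b" for b
    proof -
      have "(\<Sigma> a. P b a x * v a) = (\<Sigma> d. (\<Sigma> a. P b a x * P a d x) * X d x)"
        unfolding v_def sum_distrib_left sum_distrib_right by (subst sum.swap) (simp add: mult_ac)
      then show ?thesis by (simp add: proj_idem v_def)
    qed
    ultimately show ?thesis by simp
  qed
  moreover have "0 \<le> (\<Sigma> a. (X a x - v a)\<^sup>2)" by (intro sum_nonneg) simp
  moreover have "(\<Sigma> a. (X a x - v a)\<^sup>2) = rho x - (\<Sigma> a. v a * v a)"
    using vv by (simp add: rho_def power2_eq_square algebra_simps sum.distrib sum_subtractf sum_distrib_left)
  ultimately show ?thesis by linarith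
qed

section \<open>The divergence estimate at scale R\<close>

context
  fixes R :: real
  assumes R: "R > 0"
begin

definition cutoff :: "real^'n \<Rightarrow> real" where "cutoff x = max 0 (1 - rho x / R\<^sup>2)"

text \<open>The shift by \<open>1 / R\<^sup>2\<close> makes the fractional powers smooth. It has the size of the error
  terms caused by the cutoff, so that no limit has to be taken. The exponents of \<open>T\<close> in \<open>Z\<close> are
  q and 1 + q with q = 3/5: the final decay needs 4 + 2q > 5, and the quadratic form in
  \<open>cutoff_quadratic_form\<close> is positive definite because q is less than the square root of 2/5.\<close>

definition T :: "real^'n \<Rightarrow> real" where "T x = S x + 1 / R\<^sup>2"

definition Z :: "'a \<Rightarrow> real^'n \<Rightarrow> real"
  where "Z a x = 1/2 * (T x powr (3/5) * \<delta> a S x) + 101/100 * (T x powr (8/5) * \<delta> a (log_vol X) x)"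

lemma T_pos: "T x > 0"
  using S_nonneg[of x] R by (simp add: T_def add_nonneg_pos)

lemma smooth_T: "smooth T"
  unfolding T_def[abs_def] by (intro smooth_rules)

lemma smooth_Z: "smooth (Z a)"
  unfolding Z_def[abs_def] by (intro smooth_rules smooth_T T_pos)

lemma tder_T: "\<delta> a T x = \<delta> a S x"
  unfolding T_def[abs_def] by (simp add: tder_add smooth_rules tder_const)

lemma tder_T_powr: "\<delta> a (\<lambda>x. T x powr r) x = r * T x powr (r - 1) * \<delta> a S x"
  using tder_compose_real[where X = X, OF has_real_derivative_powr[OF T_pos] smooth_differentiable[OF smooth_T]]
  by (simp add: tder_T)

lemma T_powr:
  "T x powr (3/5) = T x * T x powr (-2/5)" "T x powr (8/5) = (T x)\<^sup>2 * T x powr (-2/5)"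
proof -
  have "T x powr (1 + (-2/5)) = T x powr 1 * T x powr (-2/5)" "T x powr (2 + (-2/5)) = T x powr 2 * T x powr (-2/5)"
    by (rule powr_add)+
  then show "T x powr (3/5) = T x * T x powr (-2/5)" "T x powr (8/5) = (T x)\<^sup>2 * T x powr (-2/5)"
    using T_pos[of x] by (simp_all add: powr_numeral)
qed

text \<open>The product rule gives 3/10 = 1/2 * 3/5 and 1616/1000 = 101/100 * 8/5; the Kato
  inequality adds 7/20 to the former, making 65/100. The weight 101/100 exceeds 1 so that T^2 S /
  100 is left after compensating the negative term of Simons' inequality.\<close>

lemma sum_tder_Z:
  "(\<Sigma> a. \<delta> a (Z a) x) \<ge> T x powr (-2/5) * ((\<Sigma> a. 65/100 * (\<delta> a S x)\<^sup>2
      + 1616/1000 * (\<delta> a S x * (T x * \<delta> a (log_vol X) x)) + 101/100 * (T x * \<delta> a (log_vol X) x)\<^sup>2) + (T x)\<^sup>2 * S x / 100)"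
proof -
  define w where "w = T x powr (-2/5)"
  have w: "w > 0" using T_pos[of x] by (simp add: w_def)
  define gS where "gS = (\<Sigma> a. (\<delta> a S x)\<^sup>2)"
  define gl where "gl = (\<Sigma> a. (\<delta> a (log_vol X) x)\<^sup>2)"
  define gSl where "gSl = (\<Sigma> a. \<delta> a S x * \<delta> a (log_vol X) x)"
  have Za: "\<delta> a (Z a) x = w * (3/10 * (\<delta> a S x)\<^sup>2 + T x / 2 * \<delta> a (\<delta> a S) x
      + 1616/1000 * T x * (\<delta> a S x * \<delta> a (log_vol X) x) + 101/100 * (T x)\<^sup>2 * \<delta> a (\<delta> a (log_vol X)) x)" for a
  proof -
    have sm: "smooth (\<lambda>x. T x powr r)" for r by (intro smooth_rules smooth_T T_pos)
    have "\<delta> a (Z a) x = 1/2 * (3/5 * T x powr (-2/5) * \<delta> a S x * \<delta> a S x + T x powr (3/5) * \<delta> a (\<delta> a S) x)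
        + 101/100 * (8/5 * T x powr (3/5) * \<delta> a S x * \<delta> a (log_vol X) x + T x powr (8/5) * \<delta> a (\<delta> a (log_vol X)) x)"
      unfolding Z_def[abs_def]
      by (simp add: tder_add tder_cmult tder_mult sm smooth_rules tder_T_powr del: times_divide_eq_left)
    then show ?thesis unfolding T_powr w_def[symmetric] by (simp add: power2_eq_square algebra_simps)
  qed
  have "(\<Sigma> a. \<delta> a (Z a) x) = w * (3/10 * gS + T x / 2 * laplace X S x + 1616/1000 * T x * gSl
      + 101/100 * (T x)\<^sup>2 * (S x + gl))"
    unfolding Za gl_def laplace_log_vol[symmetric]
    by (simp only: sum.distrib sum_distrib_left[symmetric] gS_def gSl_def laplace_def)
  moreover have "w * (3/10 * gS + T x / 2 * laplace X S x + 1616/1000 * T x * gSl + 101/100 * (T x)\<^sup>2 * (S x + gl))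
      \<ge> w * ((65/100 * gS + 1616/1000 * (T x * gSl) + 101/100 * ((T x)\<^sup>2 * gl)) + (T x)\<^sup>2 * S x / 100)"
  proof (rule mult_left_mono[OF _ less_imp_le[OF w]])
    obtain D where D: "D \<ge> 0" "laplace X S x \<ge> 2 * D - 2 * (S x)\<^sup>2" "7 / 5 * gS \<le> 4 * S x * D"
      using simons_kato[of x] unfolding gS_def by blast
    have TS: "S x \<le> T x" by (simp add: T_def)
    have "T x / 2 * (2 * D - 2 * (S x)\<^sup>2) \<le> T x / 2 * laplace X S x"
      using D(2) T_pos[of x] by (intro mult_left_mono) auto
    moreover have "T x / 2 * (2 * D - 2 * (S x)\<^sup>2) = T x * D - T x * (S x)\<^sup>2" by (simp add: algebra_simps)
    moreover have "S x * D \<le> T x * D" using TS D(1) by (rule mult_right_mono)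
    moreover have "T x * (S x)\<^sup>2 \<le> (T x)\<^sup>2 * S x"
      using mult_left_mono[OF TS, of "T x * S x"] T_pos[of x] S_nonneg[of x] by (simp add: power2_eq_square mult_ac)
    moreover have "101/100 * (T x)\<^sup>2 * (S x + gl) = 101/100 * ((T x)\<^sup>2 * S x) + 101/100 * ((T x)\<^sup>2 * gl)"
      by (simp add: algebra_simps)
    ultimately show "(65/100 * gS + 1616/1000 * (T x * gSl) + 101/100 * ((T x)\<^sup>2 * gl)) + (T x)\<^sup>2 * S x / 100
      \<le> 3/10 * gS + T x / 2 * laplace X S x + 1616/1000 * T x * gSl + 101/100 * (T x)\<^sup>2 * (S x + gl)"
      using D(3) by linarith
  qed
  moreover have "(\<Sigma> a. 65/100 * (\<delta> a S x)\<^sup>2 + 1616/1000 * (\<delta> a S x * (T x * \<delta> a (log_vol X) x))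
      + 101/100 * (T x * \<delta> a (log_vol X) x)\<^sup>2) = 65/100 * gS + 1616/1000 * (T x * gSl) + 101/100 * ((T x)\<^sup>2 * gl)"
    by (simp only: sum.distrib sum_distrib_left gS_def gSl_def gl_def power_mult_distrib mult.left_commute[of "T x"])
  ultimately show ?thesis by (simp add: w_def)
qed

lemma cutoff_derivative:
  "((\<lambda>r. max 0 (1 - r / R\<^sup>2) ^ 6) has_real_derivative 6 * max 0 (1 - r / R\<^sup>2) ^ 5 * (- 1 / R\<^sup>2)) (at r)"
proof -
  have "((\<lambda>r. 1 - r / R\<^sup>2) has_real_derivative - 1 / R\<^sup>2) (at r)"
  proof -
    have "((\<lambda>r. 1 - r * (1 / R\<^sup>2)) has_real_derivative 0 - 1 * (1 / R\<^sup>2)) (at r)"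
      by (intro DERIV_diff DERIV_const DERIV_cmult_right DERIV_ident)
    then show ?thesis by simp
  qed
  from DERIV_chain2[OF DERIV_max_0_power[of 4] this] show ?thesis by (simp add: numeral_eq_Suc)
qed

lemma cutoff6_differentiable: "(\<lambda>x. cutoff x ^ 6) differentiable (at x)"
proof -
  have "(\<lambda>r. max 0 (1 - r / R\<^sup>2) ^ 6) differentiable (at (rho x))"
    using cutoff_derivative real_differentiable_def by blast
  from differentiable_compose[OF this smooth_differentiable[OF smooth_rho]]
  show ?thesis by (simp add: cutoff_def)
qed

lemma tder_cutoff6: "\<delta> a (\<lambda>x. cutoff x ^ 6) x = 6 * cutoff x ^ 5 * (- 1 / R\<^sup>2) * \<delta> a rho x"
  unfolding cutoff_def by (rule tder_compose_real[OF cutoff_derivative smooth_differentiable[OF smooth_rho]])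

lemma partial_cutoff6: "partial i (\<lambda>x. cutoff x ^ 6) x = 6 * cutoff x ^ 5 * (- 1 / R\<^sup>2) * partial i rho x"
  unfolding cutoff_def by (rule partial_compose_real[OF cutoff_derivative smooth_differentiable[OF smooth_rho]])

lemma continuous_cut: "continuous_on UNIV cutoff"
  unfolding cutoff_def[abs_def] using R by (intro continuous_intros smooth_continuous[OF smooth_rho]) auto

lemma cutoff_bounds: "0 \<le> cutoff x" "cutoff x \<le> 1"
proof -
  have "rho x \<ge> 0" unfolding rho_def by (intro sum_nonneg) simp
  then show "0 \<le> cutoff x" "cutoff x \<le> 1" by (auto simp: cutoff_def)
qed

lemma cutoff_eq_0: "rho x \<ge> R\<^sup>2 \<Longrightarrow> cutoff x = 0"
  using R by (simp add: cutoff_def)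

lemma cutoff_eq_0_norm: "norm x > R \<Longrightarrow> cutoff x = 0"
  using proper[of x, folded rho_def] R power_mono[of R "norm x" 2] by (intro cutoff_eq_0) linarith

definition flux :: "real^'n \<Rightarrow> real"
  where "flux x = sqrt (det (gram X x)) * (\<Sigma> a. \<delta> a (\<lambda>x. Z a x * cutoff x ^ 6) x)"

text \<open>By \<open>divergence\<close> the flux is a sum of chart partials of C^1 functions that
  vanish outside the ball of radius R.\<close>

lemma integral_flux: "integrable lborel flux" "integral\<^sup>L lborel flux = 0"
proof -
  define W where "W i x = sqrt (det (gram X x)) * (\<Sigma> a. M a i x * Z a x)" for i x
  have smW: "smooth (W i)" for i
    unfolding W_def[abs_def] by (intro smooth_rules smooth_Z)
  have Y: "(\<lambda>x. Z a x * cutoff x ^ 6) differentiable (at x)" for a x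
    by (intro differentiable_mult smooth_differentiable[OF smooth_Z] cutoff6_differentiable)
  have "(\<lambda>y. sqrt (det (gram X y)) * (\<Sigma> a. M a i y * (Z a y * cutoff y ^ 6))) = (\<lambda>y. W i y * cutoff y ^ 6)" for i
    by (simp add: W_def sum_distrib_left sum_distrib_right mult_ac)
  then have flux: "flux = (\<lambda>x. \<Sigma> i. partial i (\<lambda>y. W i y * cutoff y ^ 6) x)"
    using divergence[of "\<lambda>a x. Z a x * cutoff x ^ 6", OF Y] by (simp add: flux_def[abs_def])
  have part: "partial i (\<lambda>y. W i y * cutoff y ^ 6) = (\<lambda>x. partial i (W i) x * cutoff x ^ 6
      + W i x * (6 * cutoff x ^ 5 * (- 1 / R\<^sup>2) * partial i rho x))" for i
    by (rule ext) (simp only: partial_mult[OF smooth_differentiable[OF smW] cutoff6_differentiable] partial_cutoff6)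
  have "continuous_on UNIV (partial i (\<lambda>y. W i y * cutoff y ^ 6))" for i
    unfolding part using smooth_continuous[OF smW] smooth_continuous[OF smooth_partial[OF smW]]
      smooth_continuous[OF smooth_partial[OF smooth_rho]] continuous_cut
    by (intro continuous_on_add continuous_on_mult continuous_on_power continuous_on_const)
  then have I: "integrable lborel (partial i (\<lambda>y. W i y * cutoff y ^ 6))"
    "integral\<^sup>L lborel (partial i (\<lambda>y. W i y * cutoff y ^ 6)) = 0" for i
    using integral_partial_eq_0[of "\<lambda>y. W i y * cutoff y ^ 6" i R] cutoff_eq_0_norm
      differentiable_mult[OF smooth_differentiable[OF smW] cutoff6_differentiable] by auto
  show "integrable lborel flux" unfolding flux using I by (intro Bochner_Integration.integrable_sum)
  show "integral\<^sup>L lborel flux = 0" unfolding flux using I by (simp add: Bochner_Integration.integral_sum)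
qed

text \<open>After factoring out w t^4 each ambient index contributes the form of
  \<open>cutoff_quadratic_form\<close>, with linear coefficients 3 = 6 * 1/2 and 606/100 = 6 *
  101/100 from differentiating the sixth power.\<close>

lemma flux_lower_bound:
  "flux x \<ge> sqrt (det (gram X x)) * (T x powr (8/5) * S x * cutoff x ^ 6 / 200)
    - 4000 / R\<^sup>2 * (800001 / R\<^sup>2) powr (8/5) * (sqrt (det (gram X x)) * indicator {x. rho x < R\<^sup>2} x)"
proof (cases "rho x < R\<^sup>2")
  case False
  then have "cutoff x = 0" by (intro cutoff_eq_0) simp
  then have "flux x = 0"
    by (simp add: flux_def tder_mult_at[OF smooth_differentiable[OF smooth_Z] cutoff6_differentiable] tder_cutoff6)
  then show ?thesis using False \<open>cutoff x = 0\<close> by simp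
next
  case True
  define t where "t = cutoff x"
  define w where "w = T x powr (-2/5)"
  have w: "w > 0" using T_pos[of x] by (simp add: w_def)
  \<comment> \<open>In the region considered this is the tangential derivative of the
    cutoff.\<close>
  define e where "e a = - \<delta> a rho x / R\<^sup>2" for a
  define sa where "sa a = \<delta> a S x" for a
  define la where "la a = T x * \<delta> a (log_vol X) x" for a
  define q where "q a = 65/100 * (sa a)\<^sup>2 + 1616/1000 * (sa a * la a) + 101/100 * (la a)\<^sup>2" for a
  have e2: "(\<Sigma> a. (e a)\<^sup>2) \<le> 4 / R\<^sup>2"
  proof -
    have "(\<Sigma> a. (e a)\<^sup>2) = (\<Sigma> a. (\<delta> a rho x)\<^sup>2) / (R\<^sup>2)\<^sup>2"
      by (simp add: e_def power_divide sum_divide_distrib)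
    also have "\<dots> \<le> 4 * R\<^sup>2 / (R\<^sup>2)\<^sup>2"
      using sum_tder_rho_square[of x] True by (intro divide_right_mono) auto
    also have "\<dots> = 4 / R\<^sup>2" 
    proof -
      have "4 * r / (r * r) = 4 / r" for r :: real by simp
      then show ?thesis by (simp only: power2_eq_square[of "R\<^sup>2"])
    qed
    finally show ?thesis .
  qed
  have "(\<Sigma> a. \<delta> a (\<lambda>x. Z a x * cutoff x ^ 6) x)
      = (\<Sigma> a. \<delta> a (Z a) x) * t ^ 6 + (\<Sigma> a. Z a x * (6 * t ^ 5 * e a))"
    by (simp add: tder_mult_at[OF smooth_differentiable[OF smooth_Z] cutoff6_differentiable] tder_cutoff6
        sum.distrib sum_distrib_right sum_subtractf sum_negf t_def e_def)
  also have "\<dots> \<ge> w * ((\<Sigma> a. q a) + (T x)\<^sup>2 * S x / 100) * t ^ 6 + (\<Sigma> a. Z a x * (6 * t ^ 5 * e a))"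
    using sum_tder_Z[of x] cutoff_bounds[of x]
    unfolding w_def[symmetric] sa_def[symmetric] la_def[symmetric] q_def[symmetric] t_def[symmetric]
    by (intro add_right_mono mult_right_mono) auto
  also have "w * ((\<Sigma> a. q a) + (T x)\<^sup>2 * S x / 100) * t ^ 6 + (\<Sigma> a. Z a x * (6 * t ^ 5 * e a))
      = w * t ^ 4 * (\<Sigma> a. t\<^sup>2 * q a + t * (T x * e a) * (3 * sa a + 606/100 * la a)) + w * (T x)\<^sup>2 * (S x / 100 * t ^ 6)"
  proof -
    have "Z a x * (6 * t ^ 5 * e a) = w * t ^ 4 * (t * (T x * e a) * (3 * sa a + 606/100 * la a))" for a
      unfolding Z_def T_powr w_def[symmetric] sa_def[symmetric]
      by (simp add: la_def power2_eq_square power_numeral_reduce algebra_simps)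
    moreover have "w * (\<Sigma> a. q a) * t ^ 6 = w * t ^ 4 * (\<Sigma> a. t\<^sup>2 * q a)"
      by (simp add: sum_distrib_left[symmetric] power_numeral_reduce power2_eq_square mult_ac)
    ultimately show ?thesis
      by (simp add: sum.distrib sum_distrib_left distrib_left distrib_right)
  qed
  finally have lower: "(\<Sigma> a. \<delta> a (\<lambda>x. Z a x * cutoff x ^ 6) x)
      \<ge> w * t ^ 4 * (\<Sigma> a. t\<^sup>2 * q a + t * (T x * e a) * (3 * sa a + 606/100 * la a)) + w * (T x)\<^sup>2 * (S x / 100 * t ^ 6)" .
  \<comment> \<open>The constant 4000 is the 1000 of the quadratic form times the 4 of
    \<open>e2\<close>.\<close>
  have "w * t ^ 4 * (\<Sigma> a. t\<^sup>2 * q a + t * (T x * e a) * (3 * sa a + 606/100 * la a))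
      \<ge> w * t ^ 4 * (- 4000 * (T x)\<^sup>2 / R\<^sup>2)"
  proof (rule mult_left_mono)
    have "(\<Sigma> a. t\<^sup>2 * q a + t * (T x * e a) * (3 * sa a + 606/100 * la a)) \<ge> (\<Sigma> a. - 1000 * (T x * e a)\<^sup>2)"
      unfolding q_def by (intro sum_mono cutoff_quadratic_form)
    also have "(\<Sigma> a. - 1000 * (T x * e a)\<^sup>2) = - 1000 * (T x)\<^sup>2 * (\<Sigma> a. (e a)\<^sup>2)"
      by (simp add: power_mult_distrib sum_distrib_left mult.assoc)
    also have "\<dots> \<ge> - 1000 * (T x)\<^sup>2 * (4 / R\<^sup>2)"
      using e2 by (intro mult_left_mono_neg) auto
    finally show "- 4000 * (T x)\<^sup>2 / R\<^sup>2 \<le> (\<Sigma> a. t\<^sup>2 * q a + t * (T x * e a) * (3 * sa a + 606/100 * la a))"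
      by simp
  qed (use w in simp)
  with lower have "(\<Sigma> a. \<delta> a (\<lambda>x. Z a x * cutoff x ^ 6) x)
      \<ge> w * t ^ 4 * (- 4000 * (T x)\<^sup>2 / R\<^sup>2) + w * (T x)\<^sup>2 * (S x / 100 * t ^ 6)" by linarith
  also have "w * t ^ 4 * (- 4000 * (T x)\<^sup>2 / R\<^sup>2) + w * (T x)\<^sup>2 * (S x / 100 * t ^ 6)
      = T x powr (8/5) * (S x / 100 * t ^ 6 - 4000 * t ^ 4 / R\<^sup>2)"
    unfolding T_powr w_def[symmetric] by (simp add: algebra_simps)
  also have "\<dots> \<ge> T x powr (8/5) * S x * t ^ 6 / 200 - 4000 / R\<^sup>2 * (800001 / R\<^sup>2) powr (8/5)"
    unfolding T_def t_def by (rule absorb_cutoff[OF S_nonneg cutoff_bounds R])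
  finally have "sqrt (det (gram X x)) * (T x powr (8/5) * S x * t ^ 6 / 200 - 4000 / R\<^sup>2 * (800001 / R\<^sup>2) powr (8/5)) \<le> flux x"
    unfolding flux_def using det_gram_pos[of x] by (intro mult_left_mono) auto
  then show ?thesis using True by (simp add: t_def right_diff_distrib mult_ac)
qed

lemma curvature_estimate:
  assumes vol: "integrable lborel (\<lambda>x. sqrt (det (gram X x)) * indicator {x. rho x < R\<^sup>2} x)"
  shows "integrable lborel (\<lambda>x. sqrt (det (gram X x)) * (T x powr (8/5) * S x * cutoff x ^ 6 / 200))"
    and "(\<integral>x. sqrt (det (gram X x)) * (T x powr (8/5) * S x * cutoff x ^ 6 / 200) \<partial>lborel)
      \<le> 4000 / R\<^sup>2 * (800001 / R\<^sup>2) powr (8/5) * (\<integral>x. sqrt (det (gram X x)) * indicator {x. rho x < R\<^sup>2} x \<partial>lborel)"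
proof -
  let ?f = "\<lambda>x. sqrt (det (gram X x)) * (T x powr (8/5) * S x * cutoff x ^ 6 / 200)"
  let ?v = "\<lambda>x. sqrt (det (gram X x)) * indicator {x. rho x < R\<^sup>2} x"
  let ?K = "4000 / R\<^sup>2 * (800001 / R\<^sup>2) powr (8/5)"
  have "smooth (\<lambda>x. T x powr (8/5))" by (intro smooth_rules smooth_T T_pos)
  then have "continuous_on UNIV ?f"
    using smooth_continuous[OF smooth_vol] smooth_continuous[OF smooth_sqnorm_A] smooth_continuous continuous_cut
    by (intro continuous_on_mult continuous_on_divide continuous_on_power continuous_on_const) auto
  then show f: "integrable lborel ?f"
    using cutoff_eq_0_norm by (intro integrable_continuous_compact_support[of _ R]) auto
  have "integral\<^sup>L lborel ?f - ?K * integral\<^sup>L lborel ?v = (\<integral>x. ?f x - ?K * ?v x \<partial>lborel)"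
    using f vol by simp
  also have "\<dots> \<le> integral\<^sup>L lborel flux"
    using f vol integral_flux(1) flux_lower_bound by (intro integral_mono) auto
  finally show "integral\<^sup>L lborel ?f \<le> ?K * integral\<^sup>L lborel ?v" using integral_flux(2) by simp
qed

end

end

section \<open>The Bernstein theorem\<close>

context bernstein_graph
begin

text \<open>If S were positive at \<open>x1\<close>, the integral in
  \<open>curvature_estimate\<close> would stay above a fixed positive number for all large R, while
  its bound is of order R^(n - 26/5) and tends to 0.\<close>

lemma sqnorm_A_eq_0:
  assumes card: "CARD('n) \<le> 5" and V: "V \<ge> 0"
    and vol: "\<And>R. R > 0 \<Longrightarrow> integrable lborel (\<lambda>x. sqrt (det (gram X x)) * indicator {x. rho x < R\<^sup>2} x)"
      "\<And>R. R > 0 \<Longrightarrow> (\<integral>x. sqrt (det (gram X x)) * indicator {x. rho x < R\<^sup>2} x \<partial>lborel) \<le> V * R ^ CARD('n)"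
  shows "S x1 = 0"
proof (rule ccontr)
  assume "S x1 \<noteq> 0"
  then have S1: "S x1 > 0" using S_nonneg[of x1] by simp
  let ?v = "\<lambda>x. sqrt (det (gram X x))"
  have v1: "?v x1 > 0" using det_gram_pos by simp
  have cont: "(u \<longlongrightarrow> u x1) (nhds x1)" if "smooth u" for u
    using smooth_continuous[OF that]
    by (simp add: continuous_on_eq_continuous_at isCont_def tendsto_at_iff_tendsto_nhds)
  have "\<forall>\<^sub>F x in nhds x1. S x > S x1 / 2 \<and> ?v x > ?v x1 / 2 \<and> rho x < rho x1 + 1"
  proof (intro eventually_conj)
    show "\<forall>\<^sub>F x in nhds x1. S x > S x1 / 2"
      by (rule order_tendstoD(1)[OF cont[OF smooth_sqnorm_A]]) (use S1 in simp)
    show "\<forall>\<^sub>F x in nhds x1. ?v x > ?v x1 / 2"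
      by (rule order_tendstoD(1)[OF cont[OF smooth_vol]]) (use v1 in linarith)
    show "\<forall>\<^sub>F x in nhds x1. rho x < rho x1 + 1"
      by (rule order_tendstoD(2)[OF cont[OF smooth_rho]]) simp
  qed
  then obtain r where r: "r > 0"
    and near: "\<And>x. x \<in> ball x1 r \<Longrightarrow> S x > S x1 / 2 \<and> ?v x > ?v x1 / 2 \<and> rho x < rho x1 + 1"
    unfolding eventually_nhds_metric by (auto simp: dist_commute)
  \<comment> \<open>Lower bound for the integrand on the ball: half of the density and of S at
    \<open>x1\<close>, and the value 1/2 for the cutoff, which is guaranteed once R^2 >= 2 (rho x1 +
    1).\<close>
  define m where "m = ?v x1 / 2 * ((S x1 / 2) powr (8/5) * (S x1 / 2) * (1 / 2) ^ 6 / 200)"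
  have m: "m > 0" using S1 v1 by (simp add: m_def)
  define B where "B = measure lborel (ball x1 r)"
  have B: "B > 0" unfolding B_def using r by (rule content_ball_pos)
  define K where "K = 4000 * 800001 powr (8/5) * V"
  have K: "K \<ge> 0" using V by (simp add: K_def)
  have est: "m * B \<le> K * R powr (- 1/5)" if R: "R \<ge> 1" "R\<^sup>2 \<ge> 2 * (rho x1 + 1)" for R
  proof -
    have R0: "R > 0" using R(1) by simp
    let ?f = "\<lambda>x. ?v x * (T R x powr (8/5) * S x * cutoff R x ^ 6 / 200)"
    have f0: "?f x \<ge> 0" for x
      using det_gram_pos[of x] S_nonneg[of x] cutoff_bounds(1)[OF R0, of x] by simp
    have "m * indicator (ball x1 r) x \<le> ?f x" for x
    proof (cases "x \<in> ball x1 r")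
      case True
      note n = near[OF True]
      have "S x1 / 2 \<le> T R x" using n by (simp add: T_def[OF R0] add_increasing2)
      then have "(S x1 / 2) powr (8/5) \<le> T R x powr (8/5)" using S1 by (intro powr_mono2) auto
      moreover have "1 / 2 \<le> cutoff R x"
      proof -
        have "rho x / R\<^sup>2 \<le> 1 / 2" using n R R0 by (simp add: field_simps)
        then show ?thesis unfolding cutoff_def[OF R0] by (intro max.coboundedI2) linarith
      qed
      then have "(1 / 2) ^ 6 \<le> cutoff R x ^ 6" by (intro power_mono) auto
      ultimately have "m \<le> ?f x"
        unfolding m_def using n S1 v1 S_nonneg[of x] less_imp_le[OF det_gram_pos[of x]]
        by (intro mult_mono divide_right_mono) auto
      then show ?thesis using True by simp
    qed (use f0 in simp)
    moreover have I: "integrable lborel (\<lambda>x. m * indicator (ball x1 r) x :: real)"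
      using emeasure_lborel_ball_finite[of x1 r]
      by (intro integrable_mult_right integrable_real_indicator) auto
    ultimately have "(\<integral>x. m * indicator (ball x1 r) x \<partial>lborel) \<le> integral\<^sup>L lborel ?f"
      using curvature_estimate(1)[OF R0 vol(1)[OF R0]] by (intro integral_mono) auto
    moreover have "(\<integral>x. m * indicator (ball x1 r) x \<partial>lborel) = m * B"
      by (simp add: B_def)
    moreover have "integral\<^sup>L lborel ?f \<le> 4000 / R\<^sup>2 * (800001 / R\<^sup>2) powr (8/5) * (\<integral>x. ?v x * indicator {x. rho x < R\<^sup>2} x \<partial>lborel)"
      by (rule curvature_estimate(2)[OF R0 vol(1)[OF R0]])
    moreover have "\<dots> \<le> 4000 / R\<^sup>2 * (800001 / R\<^sup>2) powr (8/5) * (V * R ^ CARD('n))"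
      using vol(2)[OF R0] by (rule mult_left_mono) simp
    moreover have "\<dots> \<le> K * R powr (- 1/5)"
    proof -
      \<comment> \<open>The exponents add up to -2 - 16/5 + 5 = -1/5, after replacing R^n by R^5 for
        R >= 1.\<close>
      have "R\<^sup>2 = R powr 2" using R0 by (simp add: powr_numeral)
      then have "(R\<^sup>2) powr (8/5) = R powr (16/5)" by (simp only: powr_powr) simp
      then have p: "(800001 / R\<^sup>2) powr (8/5) = 800001 powr (8/5) * R powr (- 16/5)" "1 / R\<^sup>2 = R powr (-2)"
        using R0 by (simp_all add: powr_divide powr_minus_divide)
      have "R ^ CARD('n) = R powr real CARD('n)" using R0 by (simp add: powr_realpow)
      also have "\<dots> \<le> R powr 5" using R(1) card by (intro powr_mono) auto
      finally have "R ^ CARD('n) \<le> R powr 5" .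
      then have "V * R ^ CARD('n) \<le> V * R powr 5" using V by (rule mult_left_mono)
      then have "4000 * R powr (-2) * (800001 powr (8/5) * R powr (- 16/5)) * (V * R ^ CARD('n))
          \<le> 4000 * R powr (-2) * (800001 powr (8/5) * R powr (- 16/5)) * (V * R powr 5)"
        by (rule mult_left_mono) simp
      also have "\<dots> = K * (R powr (-2) * R powr (- 16/5) * R powr 5)" by (simp add: K_def)
      also have "R powr (-2) * R powr (- 16/5) * R powr 5 = R powr (- 1/5)" by (simp add: powr_add[symmetric])
      finally show ?thesis unfolding p(1) by (simp only: p(2)[symmetric] times_divide_eq_right mult_1_right)
    qed
    ultimately show ?thesis by linarith
  qed
  have "((\<lambda>R. K * R powr (- 1/5)) \<longlongrightarrow> K * 0) at_top"
    by (intro tendsto_mult tendsto_const tendsto_neg_powr filterlim_ident) simp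
  moreover have "m * B > K * 0" using m B by simp
  ultimately have "\<forall>\<^sub>F R in at_top. K * R powr (- 1/5) < m * B" by (rule order_tendstoD)
  then have "\<forall>\<^sub>F R in at_top. K * R powr (- 1/5) < m * B \<and> R \<ge> max 1 (2 * (rho x1 + 1))"
    by (intro eventually_conj eventually_ge_at_top)
  then obtain R where R: "K * R powr (- 1/5) < m * B" "R \<ge> 1" "R \<ge> 2 * (rho x1 + 1)"
    using eventually_happens[of _ "at_top :: real filter"] by force
  moreover have "R\<^sup>2 \<ge> R" using R(2) by (simp add: power2_eq_square)
  ultimately show False using est[of R] by linarith
qed

end

section \<open>From vanishing second fundamental form to a plane\<close>

context minimal_graph
begin

lemma proj_constant:
  assumes "\<And>x. sqnorm_A X x = 0"
  shows "P a b x = P a b y"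
proof -
  have "\<delta> d (P a b) x = 0" for d x
  proof -
    have "(\<Sigma> d a b. (\<delta> d (P a b) x)\<^sup>2) = 0"
      using assms[of x] by (simp add: sqnorm_A_def)
    then show ?thesis by (simp add: sum_nonneg_eq_0_iff sum_nonneg)
  qed
  then have "partial i (P a b) x = 0" for i x
    by (subst partial_eq_tder) simp
  then have "(P a b has_derivative (\<lambda>_. 0)) (at x)" for x
    using has_derivative_partial_sum[OF smooth_differentiable[OF smooth_proj], of a b x] by simp
  then show ?thesis
    using has_derivative_zero_unique[of UNIV "P a b" x y] by auto
qed

end

lemma affine_if_partials_constant:
  fixes f :: "real^'n \<Rightarrow> real^'m"
  assumes diff: "\<And>x. f differentiable (at x)" and const: "\<And>i x. partial i f x = partial i f 0"
  shows "\<exists>L b. linear L \<and> (\<forall>x. f x = L x + b)"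
proof -
  define L where "L v = (\<Sigma> i. v $ i *\<^sub>R partial i f 0)" for v
  have D: "(f has_derivative L) (at x)" for x
    using has_derivative_partial_sum[OF diff, of x] by (simp add: L_def[abs_def] const[of _ x])
  then have bl: "bounded_linear L" by (rule has_derivative_bounded_linear)
  have "((\<lambda>x. f x - L x) has_derivative (\<lambda>_. 0)) (at x)" for x
    using has_derivative_diff[OF D bounded_linear_imp_has_derivative[OF bl]] by simp
  then have "f x - L x = f 0 - L 0" for x
    using has_derivative_zero_unique[of UNIV "\<lambda>x. f x - L x" x 0] by auto
  then have "f x = L x + (f 0 - L 0)" for x by (metis add.commute diff_add_cancel)
  then show ?thesis using bl bounded_linear.linear by blast
qed

text \<open>A constant projection makes M constant by \<open>dual_eq_proj\<close>. The base
  components of M are the entries of the inverse metric, so the metric is constant, and lowering the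
  index of M recovers constant first derivatives of f.\<close>

lemma affine_if_totally_geodesic:
  fixes f :: "real^'n \<Rightarrow> real^'m"
  assumes smooth: "smooth_on UNIV f" and mss: "minimal_surface_system f"
    and zero: "\<And>x. sqnorm_A (graph_coord f) x = 0"
  shows "\<exists>L b. linear L \<and> (\<forall>x. f x = L x + b)"
proof (rule affine_if_partials_constant)
  let ?X = "graph_coord f"
  interpret minimal_graph ?X graph_coeff by (rule minimal_graph_graph[OF smooth mss])
  show diff: "f differentiable (at x)" for x by (rule smooth_on_differentiable[OF smooth]) simp
  have M: "M a k x = M a k 0" for a k x
    unfolding dual_eq_proj using proj_constant[OF zero, of _ _ x 0] by simp
  have inv: "matrix_inv (gram ?X x) = matrix_inv (gram ?X 0)" for x
  proof -
    have "M (Inl j) i x = matrix_inv (gram ?X x) $ i $ j" for i j x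
      by (simp add: dual_def partial_coord if_distrib cong: if_cong)
    then show ?thesis using M by (metis vec_eq_iff)
  qed
  have gram: "gram ?X x = gram ?X 0" for x
  proof -
    have "gram ?X x = gram ?X x ** (matrix_inv (gram ?X 0) ** gram ?X 0)"
      by (simp only: matrix_inv_mult(2)[OF det_gram_nz] matrix_mul_rid)
    also have "\<dots> = (gram ?X x ** matrix_inv (gram ?X x)) ** gram ?X 0"
      by (simp only: matrix_mul_assoc inv[of x])
    finally show ?thesis by (simp only: matrix_inv_mult(1)[OF det_gram_nz] matrix_mul_lid)
  qed
  have "partial j (?X a) x = (\<Sigma> k. gram ?X x $ j $ k * M a k x)" for j a x
  proof -
    have "(\<Sigma> k. gram ?X x $ j $ k * M a k x)
        = (\<Sigma> l. (\<Sigma> k. gram ?X x $ j $ k * matrix_inv (gram ?X x) $ k $ l) * partial l (?X a) x)"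
      unfolding dual_def sum_distrib_left sum_distrib_right by (subst sum.swap) (simp add: mult_ac)
    also have "\<dots> = (\<Sigma> l. (gram ?X x ** matrix_inv (gram ?X x)) $ j $ l * partial l (?X a) x)"
      by (simp add: matrix_matrix_mult_def)
    finally show ?thesis
      by (simp add: matrix_inv_mult(1)[OF det_gram_nz] mat_def sum_delta_mult)
  qed
  then have "partial j (?X a) x = partial j (?X a) 0" for j a x
    using gram[of x] M[of a _ x] by simp
  from this[of _ "Inr _"] show "partial i f x = partial i f 0" for i x
    using partial_bounded_linear[OF bounded_linear_vec_nth diff]
    by (simp add: vec_eq_iff)
qed

theorem theorem1p2:
  fixes f :: "real^'n \<Rightarrow> real^'m" and c :: real
  assumes "CARD('n) \<le> 5"
    and "smooth_on UNIV f"
    and "minimal_surface_system f"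
    and "flat_normal_bundle f"
    and "\<And>R::real. R > 0 \<Longrightarrow>
           graph_volume f (ball 0 R) \<le> ennreal (c * R ^ CARD('n))"
  shows "\<exists>L b. linear L \<and> (\<forall>x. f x = L x + b)"
proof -
  let ?X = "graph_coord f"
  interpret minimal_graph ?X graph_coeff by (rule minimal_graph_graph[OF assms(2,3)])
  have norm: "(norm (x, f x))\<^sup>2 = (\<Sigma> a. (?X a x)\<^sup>2)" for x
    by (simp add: norm_Pair sum_UNIV_Plus norm_vec_def L2_set_def sum_nonneg)
  interpret bernstein_graph ?X graph_coeff
  proof
    fix x
    show "laplace ?X (log_vol ?X) x = sqnorm_A ?X x + (\<Sigma> a. (tder ?X a (log_vol ?X) x)\<^sup>2)"
      by (rule laplace_log_vol_graph[OF assms(2-4)])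
    show "\<exists>D\<ge>0. laplace ?X (sqnorm_A ?X) x \<ge> 2 * D - 2 * (sqnorm_A ?X x)\<^sup>2
        \<and> 7 / 5 * (\<Sigma> a. (tder ?X a (sqnorm_A ?X) x)\<^sup>2) \<le> 4 * sqnorm_A ?X x * D"
      by (rule laplace_sqnorm_A_graph[OF assms(2-4,1)])
    show "(norm x)\<^sup>2 \<le> (\<Sigma> a. (?X a x)\<^sup>2)"
      unfolding norm[symmetric] by (simp add: norm_Pair)
  qed
  let ?v = "\<lambda>R x. sqrt (det (gram ?X x)) * indicator {x. rho x < R\<^sup>2} x"
  have vol: "(\<integral>\<^sup>+x. ennreal (?v R x) \<partial>lborel) \<le> ennreal (c * R ^ CARD('n))" if R: "R > 0" for R
  proof -
    have "norm (x, f x) < R \<longleftrightarrow> rho x < R\<^sup>2" for x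
      unfolding rho_def norm[symmetric] using R power_strict_mono[of "norm (x, f x)" R 2]
        power_less_imp_less_base[of "norm (x, f x)" 2 R] by auto
    then have "ennreal (?v R x) = ennreal (sqrt (det (metric f x))) * indicator ((\<lambda>x. (x, f x)) -` ball 0 R) x" for x
      by (auto simp: gram_graph indicator_def)
    then show ?thesis using assms(5)[OF R] by (simp add: graph_volume_def)
  qed
  have meas: "?v R \<in> borel_measurable lborel" for R
  proof -
    have "{x. rho x < R\<^sup>2} \<in> sets borel"
      using smooth_continuous[OF smooth_rho] by (intro borel_open open_Collect_less continuous_intros)
    then show ?thesis
      using borel_measurable_continuous_onI[OF smooth_continuous[OF smooth_vol]] by auto
  qed
  have nonneg: "?v R x \<ge> 0" for R x using det_gram_pos[of x] by simp
  have int: "integrable lborel (?v R)" if "R > 0" for R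
    using vol[OF that] meas nonneg by (intro integrableI_nonneg) (auto intro: le_less_trans)
  \<comment> \<open>\<open>ennreal\<close> truncates negative bounds to 0, so c is replaced by
    \<open>max c 0\<close>; this also provides the nonnegative constant V of
    \<open>sqnorm_A_eq_0\<close>.\<close>
  have "integral\<^sup>L lborel (?v R) \<le> max c 0 * R ^ CARD('n)" if R: "R > 0" for R
  proof -
    have "integral\<^sup>L lborel (?v R) = enn2real (\<integral>\<^sup>+x. ennreal (?v R x) \<partial>lborel)"
      using meas nonneg by (intro integral_eq_nn_integral) auto
    also have "\<dots> \<le> enn2real (ennreal (c * R ^ CARD('n)))"
      using vol[OF R] by (intro enn2real_mono) auto
    also have "\<dots> \<le> max c 0 * R ^ CARD('n)"
      using R by (cases "c \<ge> 0") (auto simp: ennreal_neg mult_nonpos_nonneg)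
    finally show ?thesis .
  qed
  then have "sqnorm_A ?X x = 0" for x
    using sqnorm_A_eq_0[OF assms(1) _ int, of "max c 0"] by simp
  then show ?thesis by (rule affine_if_totally_geodesic[OF assms(2,3)])
qed

end
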